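(* Let $\mathcal V$ be a $\mathsf{VS}$ $1$-groupoid. Then its $1$-dual $\mathcal V^{1*}$ is (canonically identified with) the $\mathsf{VS}$ $1$-groupoid $$\mathcal V_1^*\rightrightarrows O_0,\qquad O_0=\mathrm{Ann}(s_0\mathcal V_0)\subseteq\mathcal V_1^*,$$ with face maps given for $\xi\in\mathcal V_1^*$ and $v\in\mathcal V_1$ by $$\check d_0\xi(v)=\xi(v-s_0d_1v),\qquad\check d_1\xi(v)=\xi(v-s_0d_0v),$$ and unit map $\check s_0:O_0\to\mathcal V_1^*$ the inclusion. The multiplication $\check m_1$ is given by $$\langle\check m_1(\eta,\xi),m_1(v,w)\rangle=\langle\xi\cdot\eta,w\cdot v\rangle=\langle\eta,v\rangle+\langle\xi,w\rangle$$ for all composable pairs $(\eta,\xi)\in\Lambda^2_1(\mathcal V^{1*})$ and $(v,w)\in\Lambda^2_1(\mathcal V)$.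
   Context: Vector spaces are finite-dimensional over $\mathbb R$; simplicial vector spaces have faces $d_i$ and degeneracies $s_j$; $\mathsf{SVec}$ is their category. For $m\ge1$, $0\le k\le m$, $\Lambda^m_k(\mathcal V)$ is the space of tuples $(x_0,\dots,\widehat{x_k},\dots,x_m)$ in $\mathcal V_{m-1}$ with $d_ix_j=d_{j-1}x_i$ for $i<j$, $i,j\ne k$; $p^m_k(x)=(d_ix)_{i\ne k}$. A $\mathsf{VS}$ $n$-groupoid is a simplicial vector space with $p^m_k$ surjective for all $m\ge1$ and bijective for $m\ge n+1$. A $\mathsf{VS}$ $1$-groupoid is the nerve of a groupoid object $\mathcal V_1\rightrightarrows\mathcal V_0$ in vector spaces, with multiplication $m_1=d_1\circ(p^2_1)^{-1}$; for $(v,w)\in\Lambda^2_1(\mathcal V)$ (that is $(x_0,x_2)=(v,w)$ with $d_1v=d_0w$) one writes $w\cdot v=m_1(v,w)$. The same notation $\check m_1$, $\xi\cdot\eta$ is used for the $1$-dual. $B^1\mathbb R$ is the simplicial vector space whose $m$-simplices are functions $c:\Delta[m]_1\to\mathbb R$ vanishing on degenerate simplices with $c(d_0\sigma)-c(d_1\sigma)+c(d_2\sigma)=0$ for all $\sigma\in\Delta[m]_2$; $(B^1\mathbb R)_1=\mathbb R$, $(B^1\mathbb R)_0=0$. $1$-dual: $\Delta[m]_l$ is the set of order-preserving maps $[l]\to[m]$; $(\mathcal V\otimes\Delta[m])_l=\bigoplus_{u\in\Delta[m]_l}\mathcal V_l^u$ with $d_i(v^u)=(d_iv)^{d_iu}$,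 $s_i(v^u)=(s_iv)^{s_iu}$. $\mathcal V^{1*}_m=\mathsf{SVec}(\mathcal V\otimes\Delta[m],B^1\mathbb R)$, with structure maps $\check d_i,\check s_i$ by precomposition with those between the $\Delta[m]$'s. The identification sends $f\in\mathcal V^{1*}_0$ to $f_1:\mathcal V_1\to\mathbb R$ and $f\in\mathcal V^{1*}_1$ to its component $v\mapsto f_1(v^{01})$ at the nondegenerate simplex $01\in\Delta[1]_1$; under it the $1$-dual pairing at level $1$ is evaluation, $\langle\xi,v\rangle=\xi(v)$. *)

theory Defs
  imports "HOL-Analysis.Analysis" "HOL-Library.Function_Algebras"
begin

text \<open>
  Function spaces carry the pointwise vector space structure; addition is the one of
  \<^theory>\<open>HOL-Library.Function_Algebras\<close>.
\<close>

instantiation "fun" :: (type, scaleR) scaleR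
begin

definition scaleR_fun_def: "r *\<^sub>R f = (\<lambda>x. r *\<^sub>R f x)"

instance ..

end

instance "fun" :: (type, real_vector) real_vector
  by standard (simp_all add: scaleR_fun_def fun_eq_iff scaleR_add_right scaleR_add_left)

text \<open>
  A finite-dimensional real vector space is a finitely generated subspace of an ambient type of
  class \<^class>\<open>real_vector\<close>. A map out of such a subspace matters only on the subspace;
  where sets of maps are formed, the maps are normalised to be 0 outside it.
\<close>

definition fin_dim :: "'a::real_vector set \<Rightarrow> bool" where
  "fin_dim S \<longleftrightarrow> (\<exists>B. finite B \<and> S = span B)"

definition lin_map :: "'a::real_vector set \<Rightarrow> 'b::real_vector set \<Rightarrow> ('a \<Rightarrow> 'b) \<Rightarrow> bool" where
  "lin_map S T f \<longleftrightarrow> f \<in> S \<rightarrow> T \<and> (\<forall>x\<in>S. \<forall>y\<in>S. f (x + y) = f x + f y)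
     \<and> (\<forall>r. \<forall>x\<in>S. f (r *\<^sub>R x) = r *\<^sub>R f x)"

definition lin_iso :: "'a::real_vector set \<Rightarrow> 'b::real_vector set \<Rightarrow> ('a \<Rightarrow> 'b) \<Rightarrow> bool" where
  "lin_iso S T f \<longleftrightarrow> lin_map S T f \<and> bij_betw f S T"

definition dual_space :: "'a::real_vector set \<Rightarrow> ('a \<Rightarrow> real) set" where
  "dual_space S = {\<xi>. lin_map S UNIV \<xi> \<and> (\<forall>v. v \<notin> S \<longrightarrow> \<xi> v = 0)}"

definition Ann :: "'a::real_vector set \<Rightarrow> 'a set \<Rightarrow> ('a \<Rightarrow> real) set" where
  "Ann S T = {\<xi> \<in> dual_space S. \<forall>v\<in>T. \<xi> v = 0}"

section \<open>Simplicial vector spaces\<close>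

text \<open>
  \<open>sp X m\<close> is the space of \<open>m\<close>-simplices. The level of the argument is an explicit parameter of
  the structure maps, since the spaces \<open>sp X m\<close> may overlap inside the ambient type:
  \<open>face X m i\<close> is the map \<open>d\<^sub>i\<close> from level \<open>m\<close> to level \<open>m - 1\<close> (for \<open>m \<ge> 1\<close>), and
  \<open>degen X m j\<close> is the map \<open>s\<^sub>j\<close> from level \<open>m\<close> to level \<open>m + 1\<close>. The ambient type is arbitrary,
  so every sequence of finite-dimensional spaces occurs (e.g. inside its direct sum).
\<close>

record 'a svec =
  sp :: "nat \<Rightarrow> 'a set"
  face :: "nat \<Rightarrow> nat \<Rightarrow> 'a \<Rightarrow> 'a"
  degen :: "nat \<Rightarrow> nat \<Rightarrow> 'a \<Rightarrow> 'a"

definition simplicial_vs :: "'a::real_vector svec \<Rightarrow> bool" where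
  "simplicial_vs X \<longleftrightarrow>
     (\<forall>m. fin_dim (sp X m))
   \<and> (\<forall>m i. i \<le> Suc m \<longrightarrow> lin_map (sp X (Suc m)) (sp X m) (face X (Suc m) i))
   \<and> (\<forall>m j. j \<le> m \<longrightarrow> lin_map (sp X m) (sp X (Suc m)) (degen X m j))
   \<and> (\<forall>m i j. i < j \<and> j \<le> Suc (Suc m) \<longrightarrow> (\<forall>x\<in>sp X (Suc (Suc m)).
        face X (Suc m) i (face X (Suc (Suc m)) j x)
          = face X (Suc m) (j - 1) (face X (Suc (Suc m)) i x)))
   \<and> (\<forall>m i j. i < j \<and> j \<le> Suc m \<longrightarrow> (\<forall>x\<in>sp X (Suc m).
        face X (Suc (Suc m)) i (degen X (Suc m) j x) = degen X m (j - 1) (face X (Suc m) i x)))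
   \<and> (\<forall>m j. j \<le> m \<longrightarrow> (\<forall>x\<in>sp X m.
        face X (Suc m) j (degen X m j x) = x \<and> face X (Suc m) (Suc j) (degen X m j x) = x))
   \<and> (\<forall>m i j. Suc j < i \<and> i \<le> Suc (Suc m) \<longrightarrow> (\<forall>x\<in>sp X (Suc m).
        face X (Suc (Suc m)) i (degen X (Suc m) j x) = degen X m j (face X (Suc m) (i - 1) x)))
   \<and> (\<forall>m i j. i \<le> j \<and> j \<le> m \<longrightarrow> (\<forall>x\<in>sp X m.
        degen X (Suc m) i (degen X m j x) = degen X (Suc m) (Suc j) (degen X m i x)))"

definition SVec :: "'a::real_vector svec \<Rightarrow> 'b::real_vector svec \<Rightarrow> (nat \<Rightarrow> 'a \<Rightarrow> 'b) set" where
  "SVec X Y = {f.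
     (\<forall>l. lin_map (sp X l) (sp Y l) (f l) \<and> (\<forall>x. x \<notin> sp X l \<longrightarrow> f l x = 0))
   \<and> (\<forall>l i. i \<le> Suc l \<longrightarrow> (\<forall>x\<in>sp X (Suc l).
        f l (face X (Suc l) i x) = face Y (Suc l) i (f (Suc l) x)))
   \<and> (\<forall>l j. j \<le> l \<longrightarrow> (\<forall>x\<in>sp X l.
        f (Suc l) (degen X l j x) = degen Y l j (f l x)))}"

definition svec_iso :: "(nat \<Rightarrow> 'a \<Rightarrow> 'b) \<Rightarrow> 'a::real_vector svec \<Rightarrow> 'b::real_vector svec \<Rightarrow> bool" where
  "svec_iso f X Y \<longleftrightarrow> f \<in> SVec X Y \<and> (\<forall>l. lin_iso (sp X l) (sp Y l) (f l))"

section \<open>Horns and higher groupoids\<close>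

text \<open>
  Horns are families indexed by \<^typ>\<open>nat\<close>, with value 0 at the omitted index \<open>k\<close> and beyond \<open>m\<close>.
\<close>

definition horn :: "'a::real_vector svec \<Rightarrow> nat \<Rightarrow> nat \<Rightarrow> (nat \<Rightarrow> 'a) set" where
  "horn X m k = {x.
     (\<forall>i. if i \<le> m \<and> i \<noteq> k then x i \<in> sp X (m - 1) else x i = 0)
   \<and> (\<forall>i j. i < j \<and> j \<le> m \<and> i \<noteq> k \<and> j \<noteq> k \<longrightarrow>
        face X (m - 1) i (x j) = face X (m - 1) (j - 1) (x i))}"

definition horn_proj :: "'a::real_vector svec \<Rightarrow> nat \<Rightarrow> nat \<Rightarrow> 'a \<Rightarrow> (nat \<Rightarrow> 'a)" where
  "horn_proj X m k x = (\<lambda>i. if i \<le> m \<and> i \<noteq> k then face X m i x else 0)"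

definition vs_groupoid :: "nat \<Rightarrow> 'a::real_vector svec \<Rightarrow> bool" where
  "vs_groupoid n X \<longleftrightarrow> simplicial_vs X
   \<and> (\<forall>m k. 1 \<le> m \<and> k \<le> m \<longrightarrow> horn_proj X m k ` sp X m = horn X m k)
   \<and> (\<forall>m k. n + 1 \<le> m \<and> k \<le> m \<longrightarrow> bij_betw (horn_proj X m k) (sp X m) (horn X m k))"

text \<open>The pair \<open>(v, w)\<close> as the family with \<open>x\<^sub>0 = v\<close> and \<open>x\<^sub>2 = w\<close>.\<close>

definition pair21 :: "'a::real_vector \<Rightarrow> 'a \<Rightarrow> (nat \<Rightarrow> 'a)" where
  "pair21 v w = (\<lambda>_. 0)(0 := v, 2 := w)"

definition face_mult :: "'a::real_vector svec \<Rightarrow> 'a \<Rightarrow> 'a \<Rightarrow> 'a" where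
  "face_mult X v w = face X 2 1 (inv_into (sp X 2) (horn_proj X 2 1) (pair21 v w))"

section \<open>Groupoid objects in vector spaces and their nerves\<close>

text \<open>
  \<open>tgt\<close> and \<open>src\<close> are the faces \<open>d\<^sub>0\<close> and \<open>d\<^sub>1\<close>. The composite \<open>cmp G v w\<close> is \<open>w \<cdot> v\<close>, defined if
  \<open>d\<^sub>1 v = d\<^sub>0 w\<close>; it runs first along \<open>w\<close> and then along \<open>v\<close>.
\<close>

record 'a vs_gpd =
  Ob :: "'a set"
  Ar :: "'a set"
  tgt :: "'a \<Rightarrow> 'a"
  src :: "'a \<Rightarrow> 'a"
  unt :: "'a \<Rightarrow> 'a"
  cmp :: "'a \<Rightarrow> 'a \<Rightarrow> 'a"

definition composable :: "('a, 'z) vs_gpd_scheme \<Rightarrow> ('a \<times> 'a) set" where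
  "composable G = {(v, w). v \<in> Ar G \<and> w \<in> Ar G \<and> src G v = tgt G w}"

definition groupoid_object :: "'a::real_vector vs_gpd \<Rightarrow> bool" where
  "groupoid_object G \<longleftrightarrow>
     fin_dim (Ob G) \<and> fin_dim (Ar G)
   \<and> lin_map (Ar G) (Ob G) (tgt G) \<and> lin_map (Ar G) (Ob G) (src G)
   \<and> lin_map (Ob G) (Ar G) (unt G)
   \<and> lin_map (composable G) (Ar G) (\<lambda>(v, w). cmp G v w)
   \<and> (\<forall>x\<in>Ob G. tgt G (unt G x) = x \<and> src G (unt G x) = x)
   \<and> (\<forall>(v, w)\<in>composable G. tgt G (cmp G v w) = tgt G v \<and> src G (cmp G v w) = src G w)
   \<and> (\<forall>v\<in>Ar G. cmp G v (unt G (src G v)) = v \<and> cmp G (unt G (tgt G v)) v = v)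
   \<and> (\<forall>u v w. (u, v) \<in> composable G \<and> (v, w) \<in> composable G \<longrightarrow>
        cmp G (cmp G u v) w = cmp G u (cmp G v w))
   \<and> (\<exists>\<iota>. lin_map (Ar G) (Ar G) \<iota> \<and> (\<forall>v\<in>Ar G.
        tgt G (\<iota> v) = src G v \<and> src G (\<iota> v) = tgt G v
      \<and> cmp G v (\<iota> v) = unt G (tgt G v) \<and> cmp G (\<iota> v) v = unt G (src G v)))"

text \<open>The maps \<open>\<delta>\<^sup>i\<close> (omit \<open>i\<close>) and \<open>\<sigma>\<^sup>i\<close> (repeat \<open>i\<close>) of the simplex category.\<close>

definition coface :: "nat \<Rightarrow> nat \<Rightarrow> nat" where
  "coface i p = (if p < i then p else Suc p)"

definition codegen :: "nat \<Rightarrow> nat \<Rightarrow> nat" where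
  "codegen i p = (if p \<le> i then p else p - 1)"

text \<open>
  An \<open>m\<close>-simplex of the nerve is a functor from the poset \<open>{0 \<le> \<dots> \<le> m}\<close>, given by its objects
  \<open>x i\<close> and its arrows \<open>a i j\<close> from \<open>x i\<close> to \<open>x j\<close> for \<open>i \<le> j\<close>.
\<close>

definition nerve_reindex ::
  "nat \<Rightarrow> (nat \<Rightarrow> nat) \<Rightarrow> (nat \<Rightarrow> 'a::zero) \<times> (nat \<Rightarrow> nat \<Rightarrow> 'a) \<Rightarrow> (nat \<Rightarrow> 'a) \<times> (nat \<Rightarrow> nat \<Rightarrow> 'a)"
  where
  "nerve_reindex m \<theta> = (\<lambda>(x, a).
     (\<lambda>p. if p \<le> m then x (\<theta> p) else 0,
      \<lambda>p q. if p \<le> q \<and> q \<le> m then a (\<theta> p) (\<theta> q) else 0))"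

definition nerve :: "'a::real_vector vs_gpd \<Rightarrow> ((nat \<Rightarrow> 'a) \<times> (nat \<Rightarrow> nat \<Rightarrow> 'a)) svec" where
  "nerve G = \<lparr>
     sp = (\<lambda>m. {(x, a).
        (\<forall>i. if i \<le> m then x i \<in> Ob G else x i = 0)
      \<and> (\<forall>i j. if i \<le> j \<and> j \<le> m
           then a i j \<in> Ar G \<and> src G (a i j) = x i \<and> tgt G (a i j) = x j
           else a i j = 0)
      \<and> (\<forall>i\<le>m. a i i = unt G (x i))
      \<and> (\<forall>i j k. i \<le> j \<and> j \<le> k \<and> k \<le> m \<longrightarrow> a i k = cmp G (a j k) (a i j))}),
     face = (\<lambda>m i. nerve_reindex (m - 1) (coface i)),
     degen = (\<lambda>m j. nerve_reindex (Suc m) (codegen j)) \<rparr>"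

section \<open>Standard simplices and the coefficient object\<close>

text \<open>\<open>\<Delta> m l\<close> is the set of order-preserving maps from \<open>{0..l}\<close> to \<open>{0..m}\<close>.\<close>

definition \<Delta> :: "nat \<Rightarrow> nat \<Rightarrow> (nat \<Rightarrow> nat) set" where
  "\<Delta> m l = {u \<in> {..l} \<rightarrow>\<^sub>E {..m}. mono_on {..l} u}"

text \<open>Faces and degeneracies of an \<open>l\<close>-simplex \<open>u\<close>, i.e. precomposition with \<open>\<delta>\<^sup>i\<close> and \<open>\<sigma>\<^sup>i\<close>.\<close>

definition sface :: "nat \<Rightarrow> nat \<Rightarrow> (nat \<Rightarrow> nat) \<Rightarrow> (nat \<Rightarrow> nat)" where
  "sface l i u = compose {..l - 1} u (coface i)"

definition sdegen :: "nat \<Rightarrow> nat \<Rightarrow> (nat \<Rightarrow> nat) \<Rightarrow> (nat \<Rightarrow> nat)" where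
  "sdegen l i u = compose {..Suc l} u (codegen i)"

text \<open>The simplices \<open>00 \<in> \<Delta>[0]\<^sub>1\<close> and \<open>01 \<in> \<Delta>[1]\<^sub>1\<close>.\<close>

definition s00 :: "nat \<Rightarrow> nat" where "s00 = (\<lambda>i\<in>{..1}. 0)"
definition s01 :: "nat \<Rightarrow> nat" where "s01 = (\<lambda>i\<in>{..1}. i)"

text \<open>
  \<open>B\<^sup>1\<real>\<close>: normalised 1-cocycles on the standard simplices. The degenerate 1-simplices are those
  of the form \<open>s\<^sub>0 \<tau>\<close>. A map \<open>\<theta>\<close> of ordinals acts by precomposition with \<open>\<sigma> \<mapsto> \<theta> \<circ> \<sigma>\<close>.
\<close>

definition B1R_pull :: "nat \<Rightarrow> (nat \<Rightarrow> nat) \<Rightarrow> ((nat \<Rightarrow> nat) \<Rightarrow> real) \<Rightarrow> ((nat \<Rightarrow> nat) \<Rightarrow> real)" where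
  "B1R_pull n \<theta> c = (\<lambda>\<sigma>. if \<sigma> \<in> \<Delta> n 1 then c (compose {..1} \<theta> \<sigma>) else 0)"

definition B1R :: "((nat \<Rightarrow> nat) \<Rightarrow> real) svec" where
  "B1R = \<lparr>
     sp = (\<lambda>m. {c.
        (\<forall>\<sigma>. \<sigma> \<notin> \<Delta> m 1 \<longrightarrow> c \<sigma> = 0)
      \<and> (\<forall>\<tau>\<in>\<Delta> m 0. c (sdegen 0 0 \<tau>) = 0)
      \<and> (\<forall>\<sigma>\<in>\<Delta> m 2. c (sface 2 0 \<sigma>) - c (sface 2 1 \<sigma>) + c (sface 2 2 \<sigma>) = 0)}),
     face = (\<lambda>m i. B1R_pull (m - 1) (coface i)),
     degen = (\<lambda>m j. B1R_pull (Suc m) (codegen j)) \<rparr>"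

section \<open>The 1-dual\<close>

text \<open>The element \<open>v\<^sup>u\<close>: the vector \<open>v\<close> in the summand with index \<open>u\<close>.\<close>

definition at_simplex :: "(nat \<Rightarrow> nat) \<Rightarrow> 'a::real_vector \<Rightarrow> ((nat \<Rightarrow> nat) \<Rightarrow> 'a)" where
  "at_simplex u v = (\<lambda>u'. if u' = u then v else 0)"

definition tensor :: "'a::real_vector svec \<Rightarrow> nat \<Rightarrow> ((nat \<Rightarrow> nat) \<Rightarrow> 'a) svec" where
  "tensor V m = \<lparr>
     sp = (\<lambda>l. {y. \<forall>u. if u \<in> \<Delta> m l then y u \<in> sp V l else y u = 0}),
     face = (\<lambda>l i y. \<Sum>u\<in>\<Delta> m l. at_simplex (sface l i u) (face V l i (y u))),
     degen = (\<lambda>l j y. \<Sum>u\<in>\<Delta> m l. at_simplex (sdegen l j u) (degen V l j (y u))) \<rparr>"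

text \<open>
  Level \<open>l\<close> of the map \<open>\<V> \<otimes> \<Delta>[n] \<rightarrow> \<V> \<otimes> \<Delta>[m]\<close> induced by an order-preserving map \<open>\<theta>\<close> from
  \<open>{0..n}\<close> to \<open>{0..m}\<close>; it sends \<open>v\<^sup>u\<close> to \<open>v\<close> placed at \<open>\<theta> \<circ> u\<close>.
\<close>

definition tensor_push ::
  "nat \<Rightarrow> (nat \<Rightarrow> nat) \<Rightarrow> nat \<Rightarrow> ((nat \<Rightarrow> nat) \<Rightarrow> 'a::real_vector) \<Rightarrow> ((nat \<Rightarrow> nat) \<Rightarrow> 'a)" where
  "tensor_push n \<theta> l y = (\<Sum>u\<in>\<Delta> n l. at_simplex (compose {..l} \<theta> u) (y u))"

type_synonym 'a dual_simplex = "nat \<Rightarrow> ((nat \<Rightarrow> nat) \<Rightarrow> 'a) \<Rightarrow> ((nat \<Rightarrow> nat) \<Rightarrow> real)"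

definition dual_pull ::
  "'a::real_vector svec \<Rightarrow> nat \<Rightarrow> (nat \<Rightarrow> nat) \<Rightarrow> 'a dual_simplex \<Rightarrow> 'a dual_simplex" where
  "dual_pull V n \<theta> f =
     (\<lambda>l y. if y \<in> sp (tensor V n) l then f l (tensor_push n \<theta> l y) else 0)"

definition dual1 :: "'a::real_vector svec \<Rightarrow> 'a dual_simplex svec" where
  "dual1 V = \<lparr>
     sp = (\<lambda>m. SVec (tensor V m) B1R),
     face = (\<lambda>m i. dual_pull V (m - 1) (coface i)),
     degen = (\<lambda>m j. dual_pull V (Suc m) (codegen j)) \<rparr>"

text \<open>
  The identifications of levels 0 and 1 with spaces of functionals on \<open>\<V>\<^sub>1\<close>. Evaluation at \<open>01\<close> is
  the identification of \<open>(B\<^sup>1\<real>)\<^sub>1\<close> with the reals. Both functions vanish outside \<open>\<V>\<^sub>1\<close>, because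
  the elements of \<^const>\<open>SVec\<close> vanish outside their domain.
\<close>

definition ident0 :: "'a::real_vector dual_simplex \<Rightarrow> 'a \<Rightarrow> real" where
  "ident0 f = (\<lambda>v. f 1 (at_simplex s00 v) s01)"

definition ident1 :: "'a::real_vector dual_simplex \<Rightarrow> 'a \<Rightarrow> real" where
  "ident1 f = (\<lambda>v. f 1 (at_simplex s01 v) s01)"

definition pairing :: "'a::real_vector dual_simplex \<Rightarrow> 'a \<Rightarrow> real" where
  "pairing \<xi> v = ident1 \<xi> v"

end

theory Submission
  imports Defs
begin

text \<open>
  In vector spaces the composition of a groupoid object is forced by linearity: a composable pair
  \<open>(v, w)\<close> is the sum of \<open>(v, e)\<close> and \<open>(0, w - e)\<close>, where \<open>e\<close> is the unit at \<open>d\<^sub>1 v = d\<^sub>0 w\<close>, so that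
  \<open>w \<cdot> v = v + w - e\<close>. A groupoid object is thus the same thing as a finite-dimensional reflexive
  graph (\<open>gpd_cmp\<close>, \<open>groupoid_object_of_reflexive_graph\<close>), and in a \<open>1\<close>-groupoid \<open>\<V>\<close> every
  \<open>z \<in> \<V>\<^sub>2\<close> satisfies \<open>d\<^sub>1 z = d\<^sub>0 z + d\<^sub>2 z - s\<^sub>0 d\<^sub>1 d\<^sub>0 z\<close> (\<open>face_2_1\<close>).

  An \<open>m\<close>-simplex \<open>f\<close> of the dual takes values in cocycles, so it is known once its values
  \<open>a\<^bsub>i j\<^esub>(v) = f(v\<^bsup>i j\<^esup>)\<close> on the edges \<open>i \<le> j\<close> of \<open>\<Delta>[m]\<close> are known (\<open>dual1_eqI\<close>). The \<open>a\<^bsub>i j\<^esub>\<close> are functionals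
  on \<open>\<V>\<^sub>1\<close>, and the cocycle condition becomes \<open>a\<^bsub>i k\<^esub>(w \<cdot> v) = a\<^bsub>j k\<^esub>(v) + a\<^bsub>i j\<^esub>(w)\<close>. Evaluating it at
  the degenerate triangles \<open>s\<^sub>0 v\<close> and \<open>s\<^sub>1 v\<close> shows that \<open>a\<^bsub>i j\<^esub>\<close> is an arrow from \<open>a\<^bsub>i i\<^esub>\<close> to
  \<open>a\<^bsub>j j\<^esub>\<close> in the reflexive graph of functionals with the source and target of the theorem, and that
  \<open>a\<^bsub>i k\<^esub> = a\<^bsub>j k\<^esub> + a\<^bsub>i j\<^esub> - a\<^bsub>j j\<^esub>\<close>. These are the conditions defining a simplex of the nerve of that
  groupoid (\<open>to_nerve_in\<close>). Conversely, a simplex of the nerve defines \<open>f\<close> by restricting the simplices of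
  \<open>\<V>\<close> to their edges and summing; the cocycle condition then holds because the edges of a triangle
  in \<open>\<V>\<close> are related by the composition of \<open>\<V>\<close> (\<open>edge_op_triangle\<close>, \<open>of_nerve_in\<close>).

  Hence the dual is isomorphic to a nerve. The nerve of a groupoid object is a \<open>1\<close>-groupoid
  (\<open>vs_groupoid_nerve\<close>): in dimension at least 2, simplices and horns are both described by one
  vertex and the arrows at it, and in dimension 1 degeneracies fill the horns. This property passes
  to the dual along the isomorphism.
\<close>

section \<open>Linear maps between subspaces\<close>

lemma lin_mapI:
  assumes "\<And>x. x \<in> S \<Longrightarrow> f x \<in> T" "\<And>x y. x \<in> S \<Longrightarrow> y \<in> S \<Longrightarrow> f (x + y) = f x + f y"
    "\<And>r x. x \<in> S \<Longrightarrow> f (r *\<^sub>R x) = r *\<^sub>R f x"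
  shows "lin_map S T f"
  using assms by (auto simp: lin_map_def)

lemma lin_map_in: "lin_map S T f \<Longrightarrow> x \<in> S \<Longrightarrow> f x \<in> T"
  and lin_map_add: "lin_map S T f \<Longrightarrow> x \<in> S \<Longrightarrow> y \<in> S \<Longrightarrow> f (x + y) = f x + f y"
  and lin_map_scale: "lin_map S T f \<Longrightarrow> x \<in> S \<Longrightarrow> f (r *\<^sub>R x) = r *\<^sub>R f x"
  by (auto simp: lin_map_def)

lemma lin_map_zero: "lin_map S T f \<Longrightarrow> subspace S \<Longrightarrow> f 0 = 0"
  using lin_map_scale[of S T f 0 0] subspace_0[of S] by simp

lemma lin_map_minus:
  assumes "lin_map S T f" "x \<in> S" shows "f (- x) = - f x"
  using lin_map_scale[OF assms, of "-1"] by simp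

lemma lin_map_diff:
  assumes "lin_map S T f" "subspace S" "x \<in> S" "y \<in> S"
  shows "f (x - y) = f x - f y"
  using lin_map_add[OF assms(1,3), of "- y"] lin_map_minus[OF assms(1,4)] subspace_neg[OF assms(2,4)]
  by simp

lemma lin_map_sum:
  assumes "lin_map S T f" "subspace S" "\<And>u. u \<in> A \<Longrightarrow> g u \<in> S"
  shows "f (\<Sum>u\<in>A. g u) = (\<Sum>u\<in>A. f (g u))"
  using assms(3)
proof (induction A rule: infinite_finite_induct)
  case (insert u A)
  then have "(\<Sum>u\<in>A. g u) \<in> S"
    using assms(2) by (intro subspace_sum) auto
  with insert show ?case
    by (simp add: lin_map_add[OF assms(1)])
qed (use lin_map_zero[OF assms(1,2)] in auto)

lemma lin_map_subspace_image:
  assumes "lin_map S T f" "subspace S"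
  shows "subspace (f ` S)"
proof (rule subspaceI)
  show "0 \<in> f ` S" using lin_map_zero[OF assms] subspace_0[OF assms(2)] by force
  show "x + y \<in> f ` S" if "x \<in> f ` S" "y \<in> f ` S" for x y
    using that lin_map_add[OF assms(1)] subspace_add[OF assms(2)] by (smt (verit) image_iff)
  show "r *\<^sub>R x \<in> f ` S" if "x \<in> f ` S" for r x
    using that lin_map_scale[OF assms(1)] subspace_scale[OF assms(2)] by (smt (verit) image_iff)
qed

lemma lin_iso_inv_into:
  assumes "lin_iso S T f" "subspace S"
  shows "lin_map T S (inv_into S f)"
proof -
  have f: "lin_map S T f" "bij_betw f S T" using assms by (auto simp: lin_iso_def)
  let ?g = "inv_into S f"
  have g: "?g x \<in> S" "f (?g x) = x" if "x \<in> T" for x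
    using f(2) that by (auto simp: bij_betw_def inv_into_into f_inv_into_f)
  have eq: "?g x = s" if "s \<in> S" "x = f s" for x s
    using f(2) that by (auto simp: bij_betw_def)
  show ?thesis
    by (rule lin_mapI)
       (auto intro!: eq subspace_add[OF assms(2)] subspace_scale[OF assms(2)]
         simp: g lin_map_add[OF f(1)] lin_map_scale[OF f(1)])
qed

lemma lin_map_compose:
  "lin_map S T f \<Longrightarrow> lin_map T U g \<Longrightarrow> lin_map S U (\<lambda>x. g (f x))"
  by (simp add: lin_map_def Pi_iff)

lemma lin_iso_compose:
  assumes "lin_iso S T f" "lin_iso T U g"
  shows "lin_iso S U (\<lambda>x. g (f x))"
  using assms lin_map_compose[of S T f U g] bij_betw_trans[of f S T g U]
  by (simp add: lin_iso_def comp_def)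

lemma lin_iso_cong:
  assumes "lin_iso S T f" "subspace S" "\<And>x. x \<in> S \<Longrightarrow> f x = g x"
  shows "lin_iso S T g"
proof -
  have "lin_map S T f" "bij_betw f S T" using assms(1) by (auto simp: lin_iso_def)
  then show ?thesis
    using bij_betw_cong[of S f g T] assms(3) subspace_add[OF assms(2)] subspace_scale[OF assms(2)]
    by (auto simp: lin_iso_def lin_map_def Pi_iff)
qed

section \<open>Finite dimension\<close>

lemma fin_dim_imp_subspace: "fin_dim S \<Longrightarrow> subspace S"
  by (auto simp: fin_dim_def)

lemma fin_dim_subset:
  assumes "fin_dim S" "subspace T" "T \<subseteq> S"
  shows "fin_dim T"
proof -
  obtain C where C: "finite C" "S = span C" using assms(1) by (auto simp: fin_dim_def)
  obtain B where B: "B \<subseteq> T" "independent B" "T \<subseteq> span B"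
    using basis_exists by metis
  have "finite B" using independent_span_bound[of C B] B C assms(3) by auto
  moreover have "T = span B" using B assms(2) by (simp add: span_minimal subset_antisym)
  ultimately show ?thesis by (auto simp: fin_dim_def)
qed

lemma fin_dim_image:
  assumes "lin_map S T f" "fin_dim S"
  shows "fin_dim (f ` S)"
proof -
  obtain C where C: "finite C" "S = span C" using assms(2) by (auto simp: fin_dim_def)
  have sub: "subspace S" using assms(2) by (rule fin_dim_imp_subspace)
  have CS: "C \<subseteq> S" using C span_superset by auto
  have "f x \<in> span (f ` C)" if "x \<in> span C" for x
  proof -
    have "x \<in> S \<and> f x \<in> span (f ` C)" using that
    proof (induction rule: span_induct)
      case base
      show ?case
      proof (rule subspaceI, goal_cases)
        case 1 show ?case using lin_map_zero[OF assms(1) sub] subspace_0[OF sub] by (simp add: span_zero)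
      next
        case (2 x y) then show ?case
          by (simp add: lin_map_add[OF assms(1)] subspace_add[OF sub] span_add)
      next
        case (3 c x) then show ?case
          by (simp add: lin_map_scale[OF assms(1)] subspace_scale[OF sub] span_scale)
      qed
    next
      case (step x) then show ?case using CS by (auto simp: span_base)
    qed
    then show ?thesis ..
  qed
  moreover have "span (f ` C) \<subseteq> f ` S"
    using lin_map_subspace_image[OF assms(1) sub] CS by (intro span_minimal) auto
  ultimately have "f ` S = span (f ` C)" using C by auto
  then show ?thesis using C(1) by (auto simp: fin_dim_def)
qed

text \<open>
  The image of \<open>f\<close> lies in a finite-dimensional space, and the inverse of \<open>f\<close> carries a finite
  spanning set of it back. This gives finite dimension of the dual levels without any dimension count.
\<close>
lemma fin_dim_inj:
  assumes "lin_map S T f" "inj_on f S" "subspace S" "fin_dim T"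
  shows "fin_dim S"
proof -
  have im: "subspace (f ` S)" "f ` S \<subseteq> T"
    using lin_map_subspace_image[OF assms(1,3)] assms(1) by (auto simp: lin_map_def)
  have iso: "lin_iso S (f ` S) f"
    using assms by (auto simp: lin_iso_def lin_map_def bij_betw_def)
  have "fin_dim (inv_into S f ` (f ` S))"
    by (rule fin_dim_image[OF lin_iso_inv_into[OF iso assms(3)] fin_dim_subset[OF assms(4) im]])
  then show ?thesis using assms(2) by (simp add: inv_into_image_cancel)
qed

lemma fin_dim_Times:
  assumes "fin_dim S" "fin_dim T"
  shows "fin_dim (S \<times> T)"
proof -
  obtain B C where BC: "finite B" "S = span B" "finite C" "T = span C"
    using assms by (auto simp: fin_dim_def)
  let ?D = "(B \<times> {0}) \<union> ({0} \<times> C)"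
  have "(a, b) \<in> span ?D" if "a \<in> S" "b \<in> T" for a b
  proof -
    have "(a, 0) \<in> span ?D" "(0, b) \<in> span ?D"
      using that BC span_mono[of "B \<times> {0}" ?D] span_mono[of "{0} \<times> C" ?D]
      by (auto simp: span_Times_sing1 span_Times_sing2)
    from span_add[OF this] show ?thesis by simp
  qed
  moreover have "span ?D \<subseteq> S \<times> T"
    using BC by (intro span_minimal subspace_Times) (auto simp: span_base span_zero)
  ultimately have "S \<times> T = span ?D" by auto
  moreover have "finite ?D" using BC by simp
  ultimately show ?thesis unfolding fin_dim_def by blast
qed

lemma sum_fun_apply: "(\<Sum>u\<in>A. g u) x = (\<Sum>u\<in>A. g u x)"
  for g :: "'i \<Rightarrow> 'b \<Rightarrow> 'c::real_vector"
  by (induction A rule: infinite_finite_induct) auto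

lemma scaleR_fun_apply: "(r *\<^sub>R f) x = r *\<^sub>R f x"
  by (simp add: scaleR_fun_def)

definition supp_fun :: "'i set \<Rightarrow> 'a::real_vector set \<Rightarrow> ('i \<Rightarrow> 'a) set" where
  "supp_fun I S = {x. \<forall>i. if i \<in> I then x i \<in> S else x i = 0}"

lemma subspace_supp_fun: "subspace S \<Longrightarrow> subspace (supp_fun I S)"
  by (rule subspaceI)
     (auto simp: supp_fun_def scaleR_fun_def subspace_0 subspace_add subspace_scale split: if_splits)

lemma fin_dim_supp_fun:
  assumes "finite I" "fin_dim S"
  shows "fin_dim (supp_fun I S)"
  using assms(1)
proof induction
  case empty
  have "supp_fun {} S = span {}" by (auto simp: supp_fun_def)
  then show ?case unfolding fin_dim_def by blast
next
  case (insert i I)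
  have sub: "subspace S" using assms(2) by (rule fin_dim_imp_subspace)
  let ?f = "\<lambda>x :: 'a \<Rightarrow> 'b. (x i, x(i := 0))"
  have "lin_map (supp_fun (insert i I) S) (S \<times> supp_fun I S) ?f"
    by (rule lin_mapI) (use insert.hyps in \<open>auto simp: supp_fun_def scaleR_fun_def fun_eq_iff split: if_splits\<close>)
  moreover have "inj_on ?f (supp_fun (insert i I) S)"
    by (rule inj_onI) (auto simp: fun_eq_iff split: if_splits)
  ultimately show ?case
    using fin_dim_inj[OF _ _ subspace_supp_fun[OF sub] fin_dim_Times[OF assms(2) insert.IH]] by blast
qed

lemma subspace_dual_space: "subspace (dual_space S)"
  by (rule subspaceI) (auto simp: dual_space_def lin_map_def scaleR_fun_def algebra_simps)

text \<open>
  A functional is determined by its values on a finite spanning set, so the dual space embeds into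
  the functions on that set.
\<close>
lemma fin_dim_dual_space:
  assumes "fin_dim S"
  shows "fin_dim (dual_space S)"
proof -
  obtain B where B: "finite B" "S = span B" using assms by (auto simp: fin_dim_def)
  have sub: "subspace S" using assms by (rule fin_dim_imp_subspace)
  let ?f = "\<lambda>\<xi> :: 'a \<Rightarrow> real. \<lambda>b. if b \<in> B then \<xi> b else 0"
  have fd: "fin_dim (UNIV :: real set)"
    unfolding fin_dim_def
    by (rule exI[of _ "{1}"]) (auto simp: span_singleton)
  have "lin_map (dual_space S) (supp_fun B UNIV) ?f"
    by (rule lin_mapI) (auto simp: supp_fun_def scaleR_fun_def fun_eq_iff)
  moreover have "inj_on ?f (dual_space S)"
  proof (rule inj_onI)
    fix \<xi> \<eta> assume *: "\<xi> \<in> dual_space S" "\<eta> \<in> dual_space S" "?f \<xi> = ?f \<eta>"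
    have l: "lin_map S UNIV \<xi>" "lin_map S UNIV \<eta>" using * by (auto simp: dual_space_def)
    have eqB: "\<xi> b = \<eta> b" if "b \<in> B" for b using fun_cong[OF *(3), of b] that by simp
    have "\<xi> v = \<eta> v" if "v \<in> S" for v
    proof -
      have "v \<in> span B" using that B by simp
      then have "v \<in> S \<and> \<xi> v = \<eta> v"
      proof (induction rule: span_induct)
        case base
        show ?case
          by (rule subspaceI)
             (auto simp: subspace_0[OF sub] subspace_add[OF sub] subspace_scale[OF sub]
               lin_map_zero[OF l(1) sub] lin_map_zero[OF l(2) sub] lin_map_add[OF l(1)]
               lin_map_add[OF l(2)] lin_map_scale[OF l(1)] lin_map_scale[OF l(2)])
      next
        case (step x) then show ?case using eqB B by (auto simp: span_base)
      qed
      then show ?thesis ..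
    qed
    moreover have "\<xi> v = \<eta> v" if "v \<notin> S" for v using that *(1,2) by (simp add: dual_space_def)
    ultimately show "\<xi> = \<eta>" by (intro ext) blast
  qed
  ultimately show ?thesis
    using fin_dim_inj[OF _ _ subspace_dual_space fin_dim_supp_fun[OF B(1) fd]] by blast
qed

lemma fin_dim_Ann:
  assumes "fin_dim S"
  shows "fin_dim (Ann S T)"
proof (rule fin_dim_subset[OF fin_dim_dual_space[OF assms]])
  show "subspace (Ann S T)"
    using subspace_dual_space[of S]
    by (auto simp: Ann_def subspace_def scaleR_fun_def)
qed (auto simp: Ann_def)

section \<open>Simplicial vector spaces and their horns\<close>

lemma
  assumes "simplicial_vs X"
  shows sv_fin_dim: "fin_dim (sp X m)"
    and sv_face_lin: "i \<le> Suc m \<Longrightarrow> lin_map (sp X (Suc m)) (sp X m) (face X (Suc m) i)"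
    and sv_degen_lin: "j \<le> m \<Longrightarrow> lin_map (sp X m) (sp X (Suc m)) (degen X m j)"
    and sv_face_face: "i < j \<Longrightarrow> j \<le> Suc (Suc m) \<Longrightarrow> x \<in> sp X (Suc (Suc m)) \<Longrightarrow>
        face X (Suc m) i (face X (Suc (Suc m)) j x)
          = face X (Suc m) (j - 1) (face X (Suc (Suc m)) i x)"
    and sv_face_degen_less: "i < j \<Longrightarrow> j \<le> Suc m \<Longrightarrow> x \<in> sp X (Suc m) \<Longrightarrow>
        face X (Suc (Suc m)) i (degen X (Suc m) j x) = degen X m (j - 1) (face X (Suc m) i x)"
    and sv_face_degen_same: "j \<le> m \<Longrightarrow> x \<in> sp X m \<Longrightarrow> face X (Suc m) j (degen X m j x) = x"
    and sv_face_degen_Suc: "j \<le> m \<Longrightarrow> x \<in> sp X m \<Longrightarrow> face X (Suc m) (Suc j) (degen X m j x) = x"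
    and sv_face_degen_greater: "Suc j < i \<Longrightarrow> i \<le> Suc (Suc m) \<Longrightarrow> x \<in> sp X (Suc m) \<Longrightarrow>
        face X (Suc (Suc m)) i (degen X (Suc m) j x) = degen X m j (face X (Suc m) (i - 1) x)"
    and sv_degen_degen: "i \<le> j \<Longrightarrow> j \<le> m \<Longrightarrow> x \<in> sp X m \<Longrightarrow>
        degen X (Suc m) i (degen X m j x) = degen X (Suc m) (Suc j) (degen X m i x)"
proof -
  note 1 = assms[unfolded simplicial_vs_def]
  note 2 = conjunct2[OF 1]
  note 3 = conjunct2[OF 2]
  note 4 = conjunct2[OF 3]
  note 5 = conjunct2[OF 4]
  note 6 = conjunct2[OF 5]
  note 7 = conjunct2[OF 6]
  note 8 = conjunct2[OF 7]
  show "fin_dim (sp X m)"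
    by (rule conjunct1[OF 1, rule_format])
  show "lin_map (sp X (Suc m)) (sp X m) (face X (Suc m) i)" if "i \<le> Suc m"
    by (rule conjunct1[OF 2, rule_format, OF that])
  show "lin_map (sp X m) (sp X (Suc m)) (degen X m j)" if "j \<le> m"
    by (rule conjunct1[OF 3, rule_format, OF that])
  show "face X (Suc m) i (face X (Suc (Suc m)) j x)
      = face X (Suc m) (j - 1) (face X (Suc (Suc m)) i x)"
    if "i < j" "j \<le> Suc (Suc m)" "x \<in> sp X (Suc (Suc m))"
    by (rule conjunct1[OF 4, rule_format, OF conjI, OF that])
  show "face X (Suc (Suc m)) i (degen X (Suc m) j x) = degen X m (j - 1) (face X (Suc m) i x)"
    if "i < j" "j \<le> Suc m" "x \<in> sp X (Suc m)"
    by (rule conjunct1[OF 5, rule_format, OF conjI, OF that])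
  show "face X (Suc m) j (degen X m j x) = x" if "j \<le> m" "x \<in> sp X m"
    by (rule conjunct1[OF 6, rule_format, OF that, THEN conjunct1])
  show "face X (Suc m) (Suc j) (degen X m j x) = x" if "j \<le> m" "x \<in> sp X m"
    by (rule conjunct1[OF 6, rule_format, OF that, THEN conjunct2])
  show "face X (Suc (Suc m)) i (degen X (Suc m) j x) = degen X m j (face X (Suc m) (i - 1) x)"
    if "Suc j < i" "i \<le> Suc (Suc m)" "x \<in> sp X (Suc m)"
    by (rule conjunct1[OF 7, rule_format, OF conjI, OF that])
  show "degen X (Suc m) i (degen X m j x) = degen X (Suc m) (Suc j) (degen X m i x)"
    if "i \<le> j" "j \<le> m" "x \<in> sp X m"
    by (rule 8[rule_format, OF conjI, OF that])
qed

lemma sv_subspace: "simplicial_vs X \<Longrightarrow> subspace (sp X m)"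
  by (rule fin_dim_imp_subspace[OF sv_fin_dim])

lemma sv_face_in: "simplicial_vs X \<Longrightarrow> i \<le> Suc m \<Longrightarrow> x \<in> sp X (Suc m) \<Longrightarrow> face X (Suc m) i x \<in> sp X m"
  and sv_degen_in: "simplicial_vs X \<Longrightarrow> j \<le> m \<Longrightarrow> y \<in> sp X m \<Longrightarrow> degen X m j y \<in> sp X (Suc m)"
  by (rule lin_map_in[OF sv_face_lin]; assumption) (rule lin_map_in[OF sv_degen_lin]; assumption)

lemma
  assumes "x \<in> horn X m k"
  shows horn_in: "i \<le> m \<Longrightarrow> i \<noteq> k \<Longrightarrow> x i \<in> sp X (m - 1)"
    and horn_0: "\<not> (i \<le> m \<and> i \<noteq> k) \<Longrightarrow> x i = 0"
    and horn_face: "i < j \<Longrightarrow> j \<le> m \<Longrightarrow> i \<noteq> k \<Longrightarrow> j \<noteq> k \<Longrightarrow>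
      face X (m - 1) i (x j) = face X (m - 1) (j - 1) (x i)"
proof -
  have "if i \<le> m \<and> i \<noteq> k then x i \<in> sp X (m - 1) else x i = 0"
    using assms unfolding horn_def by blast
  then show "i \<le> m \<Longrightarrow> i \<noteq> k \<Longrightarrow> x i \<in> sp X (m - 1)" "\<not> (i \<le> m \<and> i \<noteq> k) \<Longrightarrow> x i = 0"
    by (auto split: if_splits)
qed (use assms in \<open>simp add: horn_def\<close>)

lemma horn_proj_in_horn:
  assumes "simplicial_vs X" "1 \<le> m" "k \<le> m" "x \<in> sp X m"
  shows "horn_proj X m k x \<in> horn X m k"
proof -
  obtain n where n: "m = Suc n" using assms(2) by (cases m) auto
  have "face X n i (face X m j x) = face X n (j - 1) (face X m i x)"
    if "i < j" "j \<le> m" "i \<noteq> k" "j \<noteq> k" for i j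
  proof -
    from that assms(3) n obtain l where "n = Suc l" by (cases n) auto
    then show ?thesis using that assms n sv_face_face by simp
  qed
  then show ?thesis
    using assms n sv_face_in[OF assms(1)] by (auto simp: horn_def horn_proj_def)
qed

text \<open>
  A \<open>1\<close>-dimensional horn is a single \<open>0\<close>-simplex, which its degeneracy fills.
\<close>
lemma horn_proj_image_1:
  assumes "simplicial_vs X" "k \<le> 1"
  shows "horn_proj X 1 k ` sp X 1 = horn X 1 k"
proof
  show "horn_proj X 1 k ` sp X 1 \<subseteq> horn X 1 k"
    using assms horn_proj_in_horn by blast
  show "horn X 1 k \<subseteq> horn_proj X 1 k ` sp X 1"
  proof
    fix y assume y: "y \<in> horn X 1 k"
    have y0: "y i = 0" if "\<not> (i \<le> 1 \<and> i \<noteq> k)" for i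
      using horn_0[OF y that] .
    have k: "k = 0 \<or> k = 1" using assms(2) by auto
    have yk: "y (1 - k) \<in> sp X 0"
      using horn_in[OF y, of "1 - k"] k by auto
    let ?x = "degen X 0 0 (y (1 - k))"
    have "horn_proj X 1 k ?x = y"
    proof
      fix i
      show "horn_proj X 1 k ?x i = y i"
      proof (cases "i \<le> 1 \<and> i \<noteq> k")
        case True
        then have "i = 1 - k" using k by auto
        then show ?thesis using k True
          sv_face_degen_same[OF assms(1) _ yk, of 0] sv_face_degen_Suc[OF assms(1) _ yk, of 0]
          by (auto simp: horn_proj_def)
      qed (use y0 in \<open>auto simp: horn_proj_def\<close>)
    qed
    moreover have "?x \<in> sp X 1" using sv_degen_in[OF assms(1) _ yk, of 0] by simp
    ultimately show "y \<in> horn_proj X 1 k ` sp X 1" by (metis imageI)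
  qed
qed

section \<open>Transport along levelwise isomorphisms\<close>

text \<open>
  Linearity of the structure maps and the simplicial identities hold in \<open>X\<close> because they hold after
  applying the maps \<open>f m\<close>, which are natural and injective.
\<close>
lemma simplicial_vs_transport:
  assumes Y: "simplicial_vs Y"
    and sub: "\<And>m. subspace (sp X m)"
    and iso: "\<And>m. lin_iso (sp X m) (sp Y m) (f m)"
    and face_in: "\<And>m i x. i \<le> Suc m \<Longrightarrow> x \<in> sp X (Suc m) \<Longrightarrow> face X (Suc m) i x \<in> sp X m"
    and degen_in: "\<And>m j x. j \<le> m \<Longrightarrow> x \<in> sp X m \<Longrightarrow> degen X m j x \<in> sp X (Suc m)"
    and face_nat: "\<And>m i x. i \<le> Suc m \<Longrightarrow> x \<in> sp X (Suc m) \<Longrightarrow>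
        f m (face X (Suc m) i x) = face Y (Suc m) i (f (Suc m) x)"
    and degen_nat: "\<And>m j x. j \<le> m \<Longrightarrow> x \<in> sp X m \<Longrightarrow>
        f (Suc m) (degen X m j x) = degen Y m j (f m x)"
  shows "simplicial_vs X"
proof -
  have lin: "lin_map (sp X m) (sp Y m) (f m)" for m using iso by (simp add: lin_iso_def)
  have inj: "x = y" if "f m x = f m y" "x \<in> sp X m" "y \<in> sp X m" for m x y
    using iso[of m] that by (auto simp: lin_iso_def bij_betw_def inj_on_def)
  note in' = lin_map_in[OF lin] subspace_add[OF sub] subspace_scale[OF sub]
  note faceY = sv_face_lin[OF Y] and degenY = sv_degen_lin[OF Y]
  have 1: "fin_dim (sp X m)" for m
    using fin_dim_inj[OF lin _ sub sv_fin_dim[OF Y]] iso by (auto simp: lin_iso_def bij_betw_def)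
  have 2: "lin_map (sp X (Suc m)) (sp X m) (face X (Suc m) i)" if "i \<le> Suc m" for m i
    by (rule lin_mapI; (rule inj[of m])?)
       (simp_all add: that face_in face_nat in' lin_map_add[OF lin] lin_map_scale[OF lin]
          lin_map_add[OF faceY] lin_map_scale[OF faceY])
  have 3: "lin_map (sp X m) (sp X (Suc m)) (degen X m j)" if "j \<le> m" for m j
    by (rule lin_mapI; (rule inj[of "Suc m"])?)
       (simp_all add: that degen_in degen_nat in' lin_map_add[OF lin] lin_map_scale[OF lin]
          lin_map_add[OF degenY] lin_map_scale[OF degenY])
  show ?thesis
    unfolding simplicial_vs_def
  proof (intro conjI allI impI ballI; (elim conjE)?)
    fix m i j x assume *: "i < j" "j \<le> Suc (Suc m)" "x \<in> sp X (Suc (Suc m))"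
    show "face X (Suc m) i (face X (Suc (Suc m)) j x)
          = face X (Suc m) (j - 1) (face X (Suc (Suc m)) i x)"
      by (rule inj[of m]) (use * sv_face_face[OF Y *(1,2)] in \<open>simp_all add: face_in face_nat in'\<close>)
  next
    fix m i j x assume *: "i < j" "j \<le> Suc m" "x \<in> sp X (Suc m)"
    show "face X (Suc (Suc m)) i (degen X (Suc m) j x) = degen X m (j - 1) (face X (Suc m) i x)"
      by (rule inj[of "Suc m"])
         (use * sv_face_degen_less[OF Y *(1,2)] in \<open>simp_all add: face_in face_nat degen_in degen_nat in'\<close>)
  next
    fix m j x assume *: "j \<le> m" "x \<in> sp X m"
    show "face X (Suc m) j (degen X m j x) = x"
      by (rule inj[of m])
         (use * sv_face_degen_same[OF Y *(1)] in \<open>simp_all add: face_in face_nat degen_in degen_nat in'\<close>)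
    show "face X (Suc m) (Suc j) (degen X m j x) = x"
      by (rule inj[of m])
         (use * sv_face_degen_Suc[OF Y *(1)] in \<open>simp_all add: face_in face_nat degen_in degen_nat in'\<close>)
  next
    fix m i j x assume *: "Suc j < i" "i \<le> Suc (Suc m)" "x \<in> sp X (Suc m)"
    show "face X (Suc (Suc m)) i (degen X (Suc m) j x) = degen X m j (face X (Suc m) (i - 1) x)"
      by (rule inj[of "Suc m"])
         (use * sv_face_degen_greater[OF Y *(1,2)] in \<open>simp_all add: face_in face_nat degen_in degen_nat in'\<close>)
  next
    fix m i j x assume *: "i \<le> j" "j \<le> m" "x \<in> sp X m"
    show "degen X (Suc m) i (degen X m j x) = degen X (Suc m) (Suc j) (degen X m i x)"
      by (rule inj[of "Suc (Suc m)"])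
         (use * sv_degen_degen[OF Y *(1,2)] in \<open>simp_all add: degen_in degen_nat in'\<close>)
  qed (use 1 2 3 in auto)
qed

text \<open>
  The isomorphism acts on horns componentwise and commutes with the horn projections, so fillers in
  \<open>Y\<close> pull back to fillers in \<open>X\<close>.
\<close>
lemma vs_groupoid_transport:
  assumes X: "simplicial_vs X" and Y: "vs_groupoid n Y" and f: "svec_iso f X Y"
  shows "vs_groupoid n X"
proof -
  have iso: "lin_iso (sp X m) (sp Y m) (f m)" for m using f by (simp add: svec_iso_def)
  have lin: "lin_map (sp X m) (sp Y m) (f m)" for m using iso by (simp add: lin_iso_def)
  have f0: "f m 0 = 0" for m using lin_map_zero[OF lin sv_subspace[OF X]] .
  have inj: "x = y" if "f m x = f m y" "x \<in> sp X m" "y \<in> sp X m" for m x y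
    using iso[of m] that by (auto simp: lin_iso_def bij_betw_def inj_on_def)
  have nat: "f m (face X (Suc m) i x) = face Y (Suc m) i (f (Suc m) x)"
    if "i \<le> Suc m" "x \<in> sp X (Suc m)" for m i x
    using f that by (auto simp: svec_iso_def SVec_def)
  have proj: "horn_proj Y m k (f m x) = (\<lambda>i. f (m - 1) (horn_proj X m k x i))"
    if "1 \<le> m" "x \<in> sp X m" for m k x
    using that by (cases m) (auto simp: horn_proj_def f0 nat)
  have horn_f: "(\<lambda>i. f (m - 1) (x i)) \<in> horn Y m k" if "1 \<le> m" "k \<le> m" "x \<in> horn X m k" for m k x
  proof -
    have xi: "x i \<in> sp X (m - 1)" if "i \<le> m" "i \<noteq> k" for i
      using horn_in[OF \<open>x \<in> horn X m k\<close> that] .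
    have x0: "x i = 0" if "\<not> (i \<le> m \<and> i \<noteq> k)" for i
      using horn_0[OF \<open>x \<in> horn X m k\<close> that] .
    have "face Y (m - 1) i (f (m - 1) (x j)) = face Y (m - 1) (j - 1) (f (m - 1) (x i))"
      if ij: "i < j" "j \<le> m" "i \<noteq> k" "j \<noteq> k" for i j
    proof -
      from ij \<open>k \<le> m\<close> have "2 \<le> m" by auto
      then obtain l where l: "m = Suc (Suc l)" by (metis Suc_le_D numeral_2_eq_2 Suc_le_mono)
      have "face X (m - 1) i (x j) = face X (m - 1) (j - 1) (x i)"
        using horn_face[OF \<open>x \<in> horn X m k\<close> ij] .
      moreover have "i \<le> Suc l" "j - 1 \<le> Suc l" using ij l by auto
      ultimately show ?thesis using nat[of i l "x j"] nat[of "j - 1" l "x i"] xi[of i] xi[of j] ij l by simp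
    qed
    then show ?thesis using xi x0 lin_map_in[OF lin] by (auto simp: horn_def f0)
  qed
  have surj: "horn_proj X m k ` sp X m = horn X m k" if mk: "1 \<le> m" "k \<le> m" for m k
  proof
    show "horn_proj X m k ` sp X m \<subseteq> horn X m k" using horn_proj_in_horn[OF X mk] by blast
    show "horn X m k \<subseteq> horn_proj X m k ` sp X m"
    proof
      fix x assume x: "x \<in> horn X m k"
      have "horn_proj Y m k ` sp Y m = horn Y m k" using Y mk by (simp add: vs_groupoid_def)
      moreover have "sp Y m = f m ` sp X m" using iso[of m] by (simp add: lin_iso_def bij_betw_def)
      ultimately have "(\<lambda>i. f (m - 1) (x i)) \<in> horn_proj Y m k ` f m ` sp X m"
        using horn_f[OF mk x] by simp
      then obtain z where z: "z \<in> sp X m" "(\<lambda>i. f (m - 1) (x i)) = horn_proj Y m k (f m z)"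
        by (elim imageE) simp
      have hz: "horn_proj X m k z \<in> horn X m k" using horn_proj_in_horn[OF X mk z(1)] .
      have "x i = horn_proj X m k z i" for i
      proof (cases "i \<le> m \<and> i \<noteq> k")
        case True
        have "f (m - 1) (x i) = f (m - 1) (horn_proj X m k z i)"
          using fun_cong[OF z(2), of i] proj[OF mk(1) z(1)] by simp
        moreover have "x i \<in> sp X (m - 1)" "horn_proj X m k z i \<in> sp X (m - 1)"
          using horn_in[OF x] horn_in[OF hz] True by auto
        ultimately show ?thesis by (rule inj)
      next
        case False
        then have "x i = 0" by (rule horn_0[OF x])
        moreover have "horn_proj X m k z i = 0" using False by (auto simp: horn_proj_def)
        ultimately show ?thesis by simp
      qed
      then have "x = horn_proj X m k z" by (rule ext)
      then show "x \<in> horn_proj X m k ` sp X m" using z(1) by blast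
    qed
  qed
  have inj_proj: "inj_on (horn_proj X m k) (sp X m)" if mk: "n + 1 \<le> m" "k \<le> m" for m k
  proof (rule inj_onI)
    fix x y assume xy: "x \<in> sp X m" "y \<in> sp X m" "horn_proj X m k x = horn_proj X m k y"
    then have "horn_proj Y m k (f m x) = horn_proj Y m k (f m y)" using proj mk by simp
    moreover have "inj_on (horn_proj Y m k) (sp Y m)"
      using Y mk unfolding vs_groupoid_def by (meson bij_betw_imp_inj_on)
    ultimately have "f m x = f m y"
      using xy(1,2) lin_map_in[OF lin] by (meson inj_onD)
    then show "x = y" using xy(1,2) by (rule inj)
  qed
  have "bij_betw (horn_proj X m k) (sp X m) (horn X m k)" if "n + 1 \<le> m" "k \<le> m" for m k
  proof -
    have "1 \<le> m" using that by simp
    then show ?thesis unfolding bij_betw_def by (intro conjI inj_proj surj that)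
  qed
  note bij = this
  show ?thesis unfolding vs_groupoid_def
  proof (intro conjI allI impI X)
    show "horn_proj X m k ` sp X m = horn X m k" if "1 \<le> m \<and> k \<le> m" for m k
      using that by (elim conjE) (rule surj)
    show "bij_betw (horn_proj X m k) (sp X m) (horn X m k)" if "n + 1 \<le> m \<and> k \<le> m" for m k
      using that by (elim conjE) (rule bij)
  qed
qed

section \<open>Order-preserving maps and groupoid objects\<close>

text \<open>
  Order-preserving maps \<open>{0..n} \<rightarrow> {0..m}\<close> are represented by functions on all of \<open>nat\<close>, because
  \<open>coface\<close> and \<open>codegen\<close> are given by one formula in all dimensions.
\<close>
definition ord_map :: "nat \<Rightarrow> nat \<Rightarrow> (nat \<Rightarrow> nat) \<Rightarrow> bool" where
  "ord_map n m \<theta> \<longleftrightarrow> (\<forall>p\<le>n. \<theta> p \<le> m) \<and> (\<forall>p q. p \<le> q \<and> q \<le> n \<longrightarrow> \<theta> p \<le> \<theta> q)"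

lemma ord_map_coface: "ord_map m (Suc m) (coface i)"
  by (auto simp: ord_map_def coface_def)

lemma ord_map_codegen: "j \<le> m \<Longrightarrow> ord_map (Suc m) m (codegen j)"
  by (auto simp: ord_map_def codegen_def)

lemma coface_codegen: "p \<noteq> i \<Longrightarrow> coface i (codegen i p) = p"
  by (auto simp: coface_def codegen_def)

lemma codegen_coface: "codegen i (coface i p) = p"
  by (auto simp: coface_def codegen_def)

lemma fst_nerve_reindex: "fst (nerve_reindex n \<theta> z) p = (if p \<le> n then fst z (\<theta> p) else 0)"
  and snd_nerve_reindex:
    "snd (nerve_reindex n \<theta> z) p q = (if p \<le> q \<and> q \<le> n then snd z (\<theta> p) (\<theta> q) else 0)"
  by (simp_all add: nerve_reindex_def case_prod_beta)

lemma nerve_eqI: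
  "(\<And>p. fst z p = fst w p) \<Longrightarrow> (\<And>p q. snd z p q = snd w p q) \<Longrightarrow> z = w"
  for z w :: "(nat \<Rightarrow> 'a) \<times> (nat \<Rightarrow> nat \<Rightarrow> 'a)"
  by (auto simp: prod_eq_iff fun_eq_iff)

lemma nerve_reindex_lin: "lin_map S UNIV (nerve_reindex n \<theta>)"
  for S :: "((nat \<Rightarrow> 'a::real_vector) \<times> (nat \<Rightarrow> nat \<Rightarrow> 'a)) set"
  by (rule lin_mapI) (auto intro!: nerve_eqI simp: fst_nerve_reindex snd_nerve_reindex scaleR_fun_def)

lemma nerve_reindex_cong:
  fixes z :: "(nat \<Rightarrow> 'a::zero) \<times> (nat \<Rightarrow> nat \<Rightarrow> 'a)"
  assumes "ord_map n m \<theta>" "ord_map n' m \<theta>'" "\<And>p. p \<le> l \<Longrightarrow> \<theta> (\<phi> p) = \<theta>' (\<phi>' p)"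
    "ord_map l n \<phi>" "ord_map l n' \<phi>'"
  shows "nerve_reindex l \<phi> (nerve_reindex n \<theta> z) = nerve_reindex l \<phi>' (nerve_reindex n' \<theta>' z)"
  using assms by (intro nerve_eqI) (auto simp: fst_nerve_reindex snd_nerve_reindex ord_map_def)

lemma face_nerve: "face (nerve G) m i = nerve_reindex (m - 1) (coface i)"
  and degen_nerve: "degen (nerve G) m j = nerve_reindex (Suc m) (codegen j)"
  by (simp_all add: nerve_def)

context
  fixes G :: "'a::real_vector vs_gpd"
  assumes G: "groupoid_object G"
begin

lemma gpd_lin:
  shows gpd_tgt_lin: "lin_map (Ar G) (Ob G) (tgt G)"
    and gpd_src_lin: "lin_map (Ar G) (Ob G) (src G)"
    and gpd_unt_lin: "lin_map (Ob G) (Ar G) (unt G)"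
  using G by (auto simp: groupoid_object_def)

lemma gpd_fin_dim: "fin_dim (Ob G)" "fin_dim (Ar G)"
  using G by (auto simp: groupoid_object_def)

lemmas gpd_subspace = gpd_fin_dim[THEN fin_dim_imp_subspace]

lemmas gpd_closed =
  lin_map_in[OF gpd_tgt_lin] lin_map_in[OF gpd_src_lin] lin_map_in[OF gpd_unt_lin]
  gpd_subspace[THEN subspace_0] gpd_subspace[THEN subspace_add]
  gpd_subspace[THEN subspace_diff] gpd_subspace[THEN subspace_scale]

lemmas gpd_linear =
  gpd_lin[THEN lin_map_add] gpd_lin[THEN lin_map_scale]
  lin_map_diff[OF gpd_tgt_lin gpd_subspace(2)] lin_map_diff[OF gpd_src_lin gpd_subspace(2)]
  lin_map_diff[OF gpd_unt_lin gpd_subspace(1)]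
  lin_map_zero[OF gpd_tgt_lin gpd_subspace(2)] lin_map_zero[OF gpd_src_lin gpd_subspace(2)]
  lin_map_zero[OF gpd_unt_lin gpd_subspace(1)]

lemma gpd_unit:
  "x \<in> Ob G \<Longrightarrow> tgt G (unt G x) = x" "x \<in> Ob G \<Longrightarrow> src G (unt G x) = x"
  using G by (auto simp: groupoid_object_def)

text \<open>
  Composition is additive on composable pairs, and the pair \<open>(v, w)\<close> is a sum of two pairs that the
  unit laws evaluate.
\<close>
lemma gpd_cmp:
  assumes "v \<in> Ar G" "w \<in> Ar G" "src G v = tgt G w"
  shows "cmp G v w = v + w - unt G (src G v)"
proof -
  let ?e = "unt G (src G v)"
  have mem: "(v, ?e) \<in> composable G" "(0, w - ?e) \<in> composable G"
    using assms by (auto simp: composable_def gpd_closed gpd_unit gpd_linear)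
  have "lin_map (composable G) (Ar G) (\<lambda>(v, w). cmp G v w)"
    using G by (auto simp: groupoid_object_def)
  from lin_map_add[OF this mem] have "cmp G v w = cmp G v ?e + cmp G 0 (w - ?e)" by simp
  also have "cmp G v ?e = v" using G assms by (auto simp: groupoid_object_def)
  also have "cmp G 0 (w - ?e) = w - ?e"
  proof -
    have "w - ?e \<in> Ar G" using assms by (simp add: gpd_closed)
    then have "cmp G (unt G (tgt G (w - ?e))) (w - ?e) = w - ?e"
      using G by (auto simp: groupoid_object_def)
    moreover have "unt G (tgt G (w - ?e)) = 0"
      using assms by (simp add: gpd_closed gpd_linear gpd_unit)
    ultimately show ?thesis by simp
  qed
  finally show ?thesis by simp
qed

section \<open>The nerve of a groupoid object\<close>

text \<open>
  With the explicit formula for the composition, membership in the nerve is a system of linear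
  equations, so that the simplices of each dimension form a subspace.
\<close>
lemma nerve_mem_iff:
  "z \<in> sp (nerve G) m \<longleftrightarrow>
     (\<forall>i\<le>m. fst z i \<in> Ob G) \<and> (\<forall>i>m. fst z i = 0)
   \<and> (\<forall>i j. i \<le> j \<and> j \<le> m \<longrightarrow>
        snd z i j \<in> Ar G \<and> src G (snd z i j) = fst z i \<and> tgt G (snd z i j) = fst z j)
   \<and> (\<forall>i j. \<not> (i \<le> j \<and> j \<le> m) \<longrightarrow> snd z i j = 0)
   \<and> (\<forall>i\<le>m. snd z i i = unt G (fst z i))
   \<and> (\<forall>i j k. i \<le> j \<and> j \<le> k \<and> k \<le> m \<longrightarrow>
        snd z i k = snd z j k + snd z i j - unt G (fst z j))"
  (is "_ \<longleftrightarrow> ?A1 \<and> ?A2 \<and> ?B1 \<and> ?B2 \<and> ?C \<and> ?D")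
proof -
  have "z \<in> sp (nerve G) m \<longleftrightarrow> (?A1 \<and> ?A2) \<and> (?B1 \<and> ?B2) \<and> ?C \<and>
     (\<forall>i j k. i \<le> j \<and> j \<le> k \<and> k \<le> m \<longrightarrow> snd z i k = cmp G (snd z j k) (snd z i j))"
    by (simp add: nerve_def case_prod_beta not_le[symmetric]) (smt (verit))
  moreover have "cmp G (snd z j k) (snd z i j) = snd z j k + snd z i j - unt G (fst z j)"
    if ?B1 "i \<le> j \<and> j \<le> k \<and> k \<le> m" for i j k
    using that gpd_cmp[of "snd z j k" "snd z i j"] by (smt (verit) order_trans)
  ultimately show ?thesis by (smt (verit))
qed

lemma
  assumes "z \<in> sp (nerve G) m"
  shows nerve_ob: "i \<le> m \<Longrightarrow> fst z i \<in> Ob G"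
    and nerve_ob_0: "\<not> i \<le> m \<Longrightarrow> fst z i = 0"
    and nerve_ar: "i \<le> j \<Longrightarrow> j \<le> m \<Longrightarrow> snd z i j \<in> Ar G"
    and nerve_src: "i \<le> j \<Longrightarrow> j \<le> m \<Longrightarrow> src G (snd z i j) = fst z i"
    and nerve_tgt: "i \<le> j \<Longrightarrow> j \<le> m \<Longrightarrow> tgt G (snd z i j) = fst z j"
    and nerve_ar_0: "\<not> (i \<le> j \<and> j \<le> m) \<Longrightarrow> snd z i j = 0"
    and nerve_unit: "i \<le> m \<Longrightarrow> snd z i i = unt G (fst z i)"
    and nerve_cmp: "i \<le> j \<Longrightarrow> j \<le> k \<Longrightarrow> k \<le> m \<Longrightarrow>
        snd z i k = snd z j k + snd z i j - unt G (fst z j)"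
  using assms unfolding nerve_mem_iff by (auto simp: not_le)

lemma nerve_subspace: "subspace (sp (nerve G) m)"
proof (rule subspaceI, goal_cases)
  case 1
  show ?case by (auto simp: nerve_mem_iff gpd_closed gpd_linear)
next
  case (2 z w)
  note z = nerve_ob[OF 2(1)] nerve_ob_0[OF 2(1)] nerve_ar[OF 2(1)] nerve_src[OF 2(1)]
    nerve_tgt[OF 2(1)] nerve_ar_0[OF 2(1)] nerve_unit[OF 2(1)] nerve_cmp[OF 2(1)]
  note w = nerve_ob[OF 2(2)] nerve_ob_0[OF 2(2)] nerve_ar[OF 2(2)] nerve_src[OF 2(2)]
    nerve_tgt[OF 2(2)] nerve_ar_0[OF 2(2)] nerve_unit[OF 2(2)] nerve_cmp[OF 2(2)]
  have "snd (z + w) i k = snd (z + w) j k + snd (z + w) i j - unt G (fst (z + w) j)"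
    if "i \<le> j" "j \<le> k" "k \<le> m" for i j k
    using z(8)[OF that] w(8)[OF that] z(1)[of j] w(1)[of j] that by (simp add: gpd_linear)
  then show ?case
    unfolding nerve_mem_iff by (auto simp: gpd_closed gpd_linear z(1-7) w(1-7))
next
  case (3 c z)
  note z = nerve_ob[OF 3] nerve_ob_0[OF 3] nerve_ar[OF 3] nerve_src[OF 3]
    nerve_tgt[OF 3] nerve_ar_0[OF 3] nerve_unit[OF 3] nerve_cmp[OF 3]
  have "snd (c *\<^sub>R z) i k = snd (c *\<^sub>R z) j k + snd (c *\<^sub>R z) i j - unt G (fst (c *\<^sub>R z) j)"
    if "i \<le> j" "j \<le> k" "k \<le> m" for i j k
    using arg_cong[OF z(8)[OF that], of "(*\<^sub>R) c"] z(1)[of j] that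
    by (simp add: gpd_linear scaleR_fun_def scaleR_add_right scaleR_diff_right)
  then show ?case
    unfolding nerve_mem_iff by (auto simp: gpd_closed gpd_linear scaleR_fun_def z(1-7))
qed

lemma nerve_fin_dim: "fin_dim (sp (nerve G) m)"
proof (rule fin_dim_subset[OF _ nerve_subspace])
  show "fin_dim (supp_fun {..m} (Ob G) \<times> supp_fun {..m} (supp_fun {..m} (Ar G)))"
    by (intro fin_dim_Times fin_dim_supp_fun gpd_fin_dim finite_atMost)
  show "sp (nerve G) m \<subseteq> supp_fun {..m} (Ob G) \<times> supp_fun {..m} (supp_fun {..m} (Ar G))"
  proof
    fix z assume z: "z \<in> sp (nerve G) m"
    have "fst z \<in> supp_fun {..m} (Ob G)"
      using nerve_ob[OF z] nerve_ob_0[OF z] by (auto simp: supp_fun_def)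
    moreover have "snd z i j \<in> Ar G" for i j
      using nerve_ar[OF z] nerve_ar_0[OF z] gpd_closed by (cases "i \<le> j \<and> j \<le> m") auto
    then have "snd z \<in> supp_fun {..m} (supp_fun {..m} (Ar G))"
      using nerve_ar_0[OF z] by (auto simp: supp_fun_def fun_eq_iff)
    ultimately show "z \<in> supp_fun {..m} (Ob G) \<times> supp_fun {..m} (supp_fun {..m} (Ar G))"
      by (simp add: mem_Times_iff)
  qed
qed

lemma nerve_reindex_in:
  assumes "z \<in> sp (nerve G) m" "ord_map n m \<theta>"
  shows "nerve_reindex n \<theta> z \<in> sp (nerve G) n"
proof -
  have \<theta>: "\<theta> p \<le> m" if "p \<le> n" for p using assms(2) that by (simp add: ord_map_def)
  have mono: "\<theta> p \<le> \<theta> q" if "p \<le> q" "q \<le> n" for p q using assms(2) that by (simp add: ord_map_def)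
  note z = nerve_ob[OF assms(1)] nerve_ar[OF assms(1)] nerve_src[OF assms(1)]
    nerve_tgt[OF assms(1)] nerve_unit[OF assms(1)]
  show ?thesis
    unfolding nerve_mem_iff fst_nerve_reindex snd_nerve_reindex
    using nerve_cmp[OF assms(1) mono mono \<theta>] by (auto simp: z \<theta> mono)
qed

lemma nerve_reindex_id:
  assumes "z \<in> sp (nerve G) m" "ord_map n m \<theta>" "ord_map m n \<phi>" "\<And>p. p \<le> m \<Longrightarrow> \<theta> (\<phi> p) = p"
  shows "nerve_reindex m \<phi> (nerve_reindex n \<theta> z) = z"
  using assms nerve_ob_0[OF assms(1)] nerve_ar_0[OF assms(1)]
  by (intro nerve_eqI) (auto simp: fst_nerve_reindex snd_nerve_reindex ord_map_def)

lemma simplicial_vs_nerve: "simplicial_vs (nerve G)"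
  unfolding simplicial_vs_def
proof (intro conjI allI impI ballI; (elim conjE)?)
  fix m i assume "i \<le> Suc m"
  show "lin_map (sp (nerve G) (Suc m)) (sp (nerve G) m) (face (nerve G) (Suc m) i)"
    using nerve_reindex_lin[of "sp (nerve G) (Suc m)" m "coface i"]
      nerve_reindex_in[OF _ ord_map_coface] by (auto simp: lin_map_def face_nerve)
next
  fix m j :: nat assume "j \<le> m"
  then show "lin_map (sp (nerve G) m) (sp (nerve G) (Suc m)) (degen (nerve G) m j)"
    using nerve_reindex_lin[of "sp (nerve G) m" "Suc m" "codegen j"]
      nerve_reindex_in[OF _ ord_map_codegen] by (auto simp: lin_map_def degen_nerve)
qed (auto simp: face_nerve degen_nerve nerve_fin_dim coface_def codegen_def
      intro!: nerve_reindex_cong nerve_reindex_id ord_map_coface ord_map_codegen)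

section \<open>Horn fillers in the nerve\<close>

text \<open>
  The arrow from vertex \<open>p\<close> to vertex \<open>q\<close> minus the unit at its source, extended to \<open>q < p\<close> by
  antisymmetry. It is an element of the kernel of the source map, and by the formula for the composition
  it is additive along arbitrary paths of vertices, as a potential difference is.
\<close>
definition arrow_diff :: "(nat \<Rightarrow> 'a) \<times> (nat \<Rightarrow> nat \<Rightarrow> 'a) \<Rightarrow> nat \<Rightarrow> nat \<Rightarrow> 'a" where
  "arrow_diff z p q = (if p \<le> q then snd z p q - unt G (fst z p) else unt G (fst z q) - snd z q p)"

lemma arrow_diff_self: "z \<in> sp (nerve G) m \<Longrightarrow> p \<le> m \<Longrightarrow> arrow_diff z p p = 0"
  by (simp add: arrow_diff_def nerve_unit)

lemma arrow_diff_swap: "z \<in> sp (nerve G) m \<Longrightarrow> p \<le> m \<Longrightarrow> arrow_diff z q p = - arrow_diff z p q"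
  by (cases p q rule: linorder_cases) (auto simp: arrow_diff_def nerve_unit)

lemma arrow_diff_trans:
  assumes "z \<in> sp (nerve G) m" "p \<le> m" "q \<le> m" "r \<le> m"
  shows "arrow_diff z p r = arrow_diff z p q + arrow_diff z q r"
proof -
  have *: "arrow_diff z p r = arrow_diff z p q + arrow_diff z q r"
    if "p \<le> q" "q \<le> r" "r \<le> m" for p q r
    using nerve_cmp[OF assms(1) that] that by (simp add: arrow_diff_def)
  have swap: "arrow_diff z q p = - arrow_diff z p q" "arrow_diff z r q = - arrow_diff z q r"
    "arrow_diff z r p = - arrow_diff z p r"
    using arrow_diff_swap[OF assms(1)] assms(2-4) by blast+
  consider "p \<le> q" "q \<le> r" | "p \<le> r" "r \<le> q" | "q \<le> p" "p \<le> r"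
    | "q \<le> r" "r \<le> p" | "r \<le> p" "p \<le> q" | "r \<le> q" "q \<le> p" by linarith
  then show ?thesis
  proof cases
    case 1 then show ?thesis using * assms(4) by blast
  next
    case 2 show ?thesis using *[OF 2 assms(3)] swap by (simp add: algebra_simps)
  next
    case 3 show ?thesis using *[OF 3 assms(4)] swap by (simp add: algebra_simps)
  next
    case 4 show ?thesis using *[OF 4 assms(2)] swap by (simp add: algebra_simps)
  next
    case 5 show ?thesis using *[OF 5 assms(3)] swap by (simp add: algebra_simps)
  next
    case 6 show ?thesis using *[OF 6 assms(2)] swap by (simp add: algebra_simps)
  qed
qed

lemma arrow_diff_src_tgt:
  assumes "z \<in> sp (nerve G) m" "p \<le> m" "q \<le> m"
  shows "arrow_diff z p q \<in> Ar G" "src G (arrow_diff z p q) = 0"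
    "tgt G (arrow_diff z p q) = fst z q - fst z p"
  using assms(2,3)
  by (auto simp: arrow_diff_def gpd_closed gpd_linear gpd_unit nerve_ob[OF assms(1)]
      nerve_ar[OF assms(1)] nerve_src[OF assms(1)] nerve_tgt[OF assms(1)])

text \<open>
  By additivity, a simplex is determined by one vertex \<open>k\<close> and the arrows between \<open>k\<close> and the
  other vertices.
\<close>
lemma nerve_eq_of_star:
  assumes z: "z \<in> sp (nerve G) m" and w: "w \<in> sp (nerve G) m" and k: "k \<le> m"
    and ob: "fst z k = fst w k"
    and ar: "\<And>p. p \<le> m \<Longrightarrow> arrow_diff z k p = arrow_diff w k p"
  shows "z = w"
proof -
  have x: "fst z p = fst w p" if "p \<le> m" for p
    using arrow_diff_src_tgt(3)[OF z k that] arrow_diff_src_tgt(3)[OF w k that] ar[OF that] ob by simp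
  have d: "arrow_diff z p q = arrow_diff w p q" if "p \<le> m" "q \<le> m" for p q
    using arrow_diff_trans[OF z k that] arrow_diff_trans[OF w k that] ar that by simp
  show ?thesis
  proof (rule nerve_eqI)
    show "fst z p = fst w p" for p
      using x nerve_ob_0[OF z] nerve_ob_0[OF w] by (cases "p \<le> m") auto
    show "snd z p q = snd w p q" for p q
      using d[of p q] x[of p] nerve_ar_0[OF z] nerve_ar_0[OF w]
      by (cases "p \<le> q \<and> q \<le> m") (auto simp: arrow_diff_def)
  qed
qed

text \<open>
  Conversely, the vertex \<open>k\<close> and the arrows at \<open>k\<close>, translated to the kernel of the source map, can
  be prescribed freely.
\<close>
lemma nerve_of_star:
  assumes k: "k \<le> m" and x0: "x0 \<in> Ob G"
    and c: "\<And>p. p \<le> m \<Longrightarrow> c p \<in> Ar G" "\<And>p. p \<le> m \<Longrightarrow> src G (c p) = 0" "c k = 0"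
  obtains z where "z \<in> sp (nerve G) m" "fst z k = x0" "\<And>p. p \<le> m \<Longrightarrow> arrow_diff z k p = c p"
proof -
  define x where "x p = (if p \<le> m then x0 + tgt G (c p) else 0)" for p
  define a where "a p q = (if p \<le> q \<and> q \<le> m then c q - c p + unt G (x p) else 0)" for p q
  have x: "x p \<in> Ob G" if "p \<le> m" for p
    using that by (simp add: x_def x0 c gpd_closed)
  have *: "(x, a) \<in> sp (nerve G) m"
    unfolding nerve_mem_iff fst_conv snd_conv
    by (auto simp: a_def gpd_closed gpd_linear gpd_unit c x) (auto simp: x_def)
  show ?thesis
    by (rule that[OF *]) (use k c in \<open>auto simp: x_def gpd_linear arrow_diff_def a_def\<close>)
qed

lemma arrow_diff_reindex:
  assumes z: "z \<in> sp (nerve G) m" and \<theta>: "ord_map n m \<theta>" and "p \<le> n" "q \<le> n"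
  shows "arrow_diff (nerve_reindex n \<theta> z) p q = arrow_diff z (\<theta> p) (\<theta> q)"
proof (cases "p \<le> q \<or> \<theta> p \<noteq> \<theta> q")
  case True
  then show ?thesis
    using assms(2-) unfolding ord_map_def
    by (cases "p \<le> q") (auto simp: arrow_diff_def fst_nerve_reindex snd_nerve_reindex not_le
        dest: order.antisym less_imp_le)
next
  case False
  then show ?thesis
    using assms(2-) by (auto simp: arrow_diff_def fst_nerve_reindex snd_nerve_reindex ord_map_def
        nerve_unit[OF z])
qed

text \<open>
  The common face of two faces \<open>x i\<close> and \<open>x j\<close> of a horn contains every vertex other than \<open>i\<close> and \<open>j\<close>.
  A vertex \<open>p \<noteq> i\<close> of the big simplex has index \<open>codegen i p\<close> in the face opposite to \<open>i\<close>.
\<close>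
lemma horn_vertex_arrow_agree:
  assumes x: "x \<in> horn (nerve G) m k" and "2 \<le> m" "i < j" "j \<le> m" "i \<noteq> k" "j \<noteq> k"
    and p: "p \<le> m" "p \<noteq> i" "p \<noteq> j" and q: "q \<le> m" "q \<noteq> i" "q \<noteq> j"
  shows "fst (x i) (codegen i p) = fst (x j) (codegen j p)"
    and "arrow_diff (x i) (codegen i p) (codegen i q) = arrow_diff (x j) (codegen j p) (codegen j q)"
proof -
  obtain n where m: "m = Suc (Suc n)" using assms(2) by (metis Suc_le_D numeral_2_eq_2 Suc_le_mono)
  have mem: "x l \<in> sp (nerve G) (Suc n)" if "l \<le> m" "l \<noteq> k" for l
    using horn_in[OF x that] m by simp
  define r where "r p = codegen i (codegen j p)" for p
  have r: "r p \<le> n" "coface i (r p) = codegen j p" "coface (j - 1) (r p) = codegen i p"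
    if "p \<le> m" "p \<noteq> i" "p \<noteq> j" for p
    using that assms(3,4) m by (auto simp: r_def coface_def codegen_def)
  have eq: "nerve_reindex n (coface i) (x j) = nerve_reindex n (coface (j - 1)) (x i)"
    using horn_face[OF x assms(3-6)] m by (simp add: face_nerve)
  show "fst (x i) (codegen i p) = fst (x j) (codegen j p)"
    using arg_cong[OF eq, of "\<lambda>z. fst z (r p)"] r[OF p] by (simp add: fst_nerve_reindex)
  show "arrow_diff (x i) (codegen i p) (codegen i q) = arrow_diff (x j) (codegen j p) (codegen j q)"
    using arg_cong[OF eq, of "\<lambda>z. arrow_diff z (r p) (r q)"] r[OF p] r[OF q]
      arrow_diff_reindex[OF mem ord_map_coface] assms(3-6) by simp
qed

text \<open>
  Every face of the horn contains the vertex \<open>k\<close>, and since \<open>m \<ge> 2\<close> every arrow at \<open>k\<close> lies in one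
  of the faces. So the horn prescribes the data at the vertex \<open>k\<close> that determine a simplex, and
  different faces prescribe the same data by compatibility.
\<close>
lemma bij_betw_horn_proj_nerve:
  assumes "2 \<le> m" "k \<le> m"
  shows "bij_betw (horn_proj (nerve G) m k) (sp (nerve G) m) (horn (nerve G) m k)"
proof -
  obtain n where m: "m = Suc n" "1 \<le> n" using assms(1) by (cases m) auto
  have other: "\<exists>i\<le>m. i \<noteq> k \<and> i \<noteq> p" for p
  proof -
    have "card {k, p} < card {..m}" using assms(1) by (auto simp: card_insert_if)
    then have "\<not> {..m} \<subseteq> {k, p}" by (meson card_mono finite.emptyI finite_insert leD)
    then show ?thesis by auto
  qed
  (* om p is a face of the horn that contains both k and p. *)
  then obtain om where om: "om p \<le> m" "om p \<noteq> k" "om p \<noteq> p" for p by metis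
  have k': "codegen i k \<le> n" "coface i (codegen i k) = k" if "i \<noteq> k" "i \<le> m" for i
    using that assms(2) m by (auto simp: coface_def codegen_def)
  have inj: "inj_on (horn_proj (nerve G) m k) (sp (nerve G) m)"
  proof (rule inj_onI)
    fix z w assume zw: "z \<in> sp (nerve G) m" "w \<in> sp (nerve G) m"
      "horn_proj (nerve G) m k z = horn_proj (nerve G) m k w"
    have eq: "nerve_reindex n (coface i) z = nerve_reindex n (coface i) w" if "i \<le> m" "i \<noteq> k" for i
      using fun_cong[OF zw(3), of i] that m by (simp add: horn_proj_def face_nerve)
    show "z = w"
    proof (rule nerve_eq_of_star[OF zw(1,2) assms(2)])
      show "fst z k = fst w k"
        using arg_cong[OF eq[of "om k"], of "\<lambda>z. fst z (codegen (om k) k)"] om[of k] k'[of "om k"]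
        by (simp add: fst_nerve_reindex)
      fix p assume p: "p \<le> m"
      let ?i = "om p"
      have p': "codegen ?i p \<le> n" "coface ?i (codegen ?i p) = p"
        using p om[of p] m by (auto simp: coface_def codegen_def)
      show "arrow_diff z k p = arrow_diff w k p"
        using arg_cong[OF eq[of ?i], of "\<lambda>z. arrow_diff z (codegen ?i k) (codegen ?i p)"]
          om[of p] k'[of ?i] p' arrow_diff_reindex[OF _ ord_map_coface, of _ n] zw(1,2) m by simp
    qed
  qed
  have "x \<in> horn_proj (nerve G) m k ` sp (nerve G) m" if x: "x \<in> horn (nerve G) m k" for x
  proof -
    have mem: "x i \<in> sp (nerve G) n" if "i \<le> m" "i \<noteq> k" for i
      using horn_in[OF x that] m by simp
    have agree: "fst (x i) (codegen i p) = fst (x j) (codegen j p) \<and>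
        arrow_diff (x i) (codegen i p) (codegen i q) = arrow_diff (x j) (codegen j p) (codegen j q)"
      if "i \<le> m" "j \<le> m" "i \<noteq> k" "j \<noteq> k" "p \<le> m" "p \<noteq> i" "p \<noteq> j" "q \<le> m" "q \<noteq> i" "q \<noteq> j"
      for i j p q
    proof (cases i j rule: linorder_cases)
      case less
      show ?thesis
        by (intro conjI horn_vertex_arrow_agree[OF x assms(1) less that(2-10)])
    next
      case equal
      then show ?thesis by simp
    next
      case greater
      show ?thesis
        by (intro conjI horn_vertex_arrow_agree[symmetric, OF x assms(1) greater
              that(1,4,3,5,7,6,8,10,9)])
    qed
    define x0 where "x0 = fst (x (om k)) (codegen (om k) k)"
    define c where "c p = arrow_diff (x (om p)) (codegen (om p) k) (codegen (om p) p)" for p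
    have x0_eq: "fst (x i) (codegen i k) = x0" if "i \<le> m" "i \<noteq> k" for i
      using agree[of i "om k" k k] om[of k] that assms(2) by (simp add: x0_def)
    have c_eq: "arrow_diff (x i) (codegen i k) (codegen i p) = c p"
      if "i \<le> m" "i \<noteq> k" "p \<le> m" "p \<noteq> i" for i p
      using agree[of i "om p" k p] om[of p] that assms(2) by (simp add: c_def)
    have p': "codegen (om p) p \<le> n" if "p \<le> m" for p
      using that om[of p] m by (auto simp: codegen_def)
    obtain z where z: "z \<in> sp (nerve G) m" "fst z k = x0" "\<And>p. p \<le> m \<Longrightarrow> arrow_diff z k p = c p"
    proof (rule nerve_of_star[OF assms(2), of x0 c])
      show "x0 \<in> Ob G" using nerve_ob[OF mem k'(1)] om[of k] by (simp add: x0_def)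
      show "c p \<in> Ar G" "src G (c p) = 0" if "p \<le> m" for p
        using arrow_diff_src_tgt[OF mem k'(1) p'[OF that]] om[of p] by (simp_all add: c_def)
      show "c k = 0" using arrow_diff_self[OF mem k'(1)] om[of k] by (simp add: c_def)
    qed (use that in blast)
    have "nerve_reindex n (coface i) z = x i" if i: "i \<le> m" "i \<noteq> k" for i
    proof (rule nerve_eq_of_star[OF _ mem[OF i] k'(1)])
      show "nerve_reindex n (coface i) z \<in> sp (nerve G) n"
        using nerve_reindex_in[OF _ ord_map_coface] z(1) m by blast
      show "fst (nerve_reindex n (coface i) z) (codegen i k) = fst (x i) (codegen i k)"
        using k' i x0_eq z(2) by (simp add: fst_nerve_reindex)
      fix p assume p: "p \<le> n"
      have cp: "coface i p \<le> m" "coface i p \<noteq> i" using p m by (auto simp: coface_def)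
      show "arrow_diff (nerve_reindex n (coface i) z) (codegen i k) p
          = arrow_diff (x i) (codegen i k) p"
        using arrow_diff_reindex[OF _ ord_map_coface, of z n] z(1) z(3)[OF cp(1)] c_eq[OF i cp]
          k'[OF i(2,1)] p m by (simp add: codegen_coface)
    qed (use i in auto)
    then have "horn_proj (nerve G) m k z i = x i" for i
      using horn_0[OF x, of i] m by (cases "i \<le> m \<and> i \<noteq> k") (auto simp: horn_proj_def face_nerve)
    then have "horn_proj (nerve G) m k z = x" by (rule ext)
    then show ?thesis using z(1) by blast
  qed
  then have "horn (nerve G) m k \<subseteq> horn_proj (nerve G) m k ` sp (nerve G) m" by (rule subsetI)
  moreover have "horn_proj (nerve G) m k ` sp (nerve G) m \<subseteq> horn (nerve G) m k"
    using horn_proj_in_horn[OF simplicial_vs_nerve _ assms(2)] assms(1) by (intro image_subsetI) simp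
  ultimately show ?thesis unfolding bij_betw_def using inj by (intro conjI subset_antisym)
qed

lemma vs_groupoid_nerve: "vs_groupoid 1 (nerve G)"
proof -
  have "horn_proj (nerve G) m k ` sp (nerve G) m = horn (nerve G) m k" if "1 \<le> m" "k \<le> m" for m k
  proof (cases "m = 1")
    case True
    then show ?thesis using horn_proj_image_1[OF simplicial_vs_nerve] that by simp
  next
    case False
    then show ?thesis using bij_betw_imp_surj_on[OF bij_betw_horn_proj_nerve[of m k]] that by simp
  qed
  then show ?thesis
    unfolding vs_groupoid_def using simplicial_vs_nerve bij_betw_horn_proj_nerve
    by (intro conjI allI impI; (elim conjE)?) simp_all
qed

lemma lin_iso_nerve_0: "lin_iso (sp (nerve G) 0) (Ob G) (\<lambda>z. fst z 0)"
  unfolding lin_iso_def bij_betw_def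
proof (intro conjI)
  show "lin_map (sp (nerve G) 0) (Ob G) (\<lambda>z. fst z 0)"
    by (rule lin_mapI) (auto simp: scaleR_fun_def intro: nerve_ob)
  show "inj_on (\<lambda>z. fst z 0) (sp (nerve G) 0)"
    by (rule inj_onI, rule nerve_eq_of_star[of _ 0 _ 0]) (auto simp: arrow_diff_self)
  have "x \<in> (\<lambda>z. fst z 0) ` sp (nerve G) 0" if "x \<in> Ob G" for x
    using nerve_of_star[of 0 0 x "\<lambda>_. 0"] that by (auto simp: gpd_closed gpd_linear)
  then show "(\<lambda>z. fst z 0) ` sp (nerve G) 0 = Ob G" by (auto intro: nerve_ob)
qed

text \<open>
  The simplex with arrow \<open>v\<close> is found from its star at the vertex 0: the source of \<open>v\<close>, and \<open>v\<close>
  minus the unit at that source.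
\<close>
lemma lin_iso_nerve_1: "lin_iso (sp (nerve G) 1) (Ar G) (\<lambda>z. snd z 0 1)"
  unfolding lin_iso_def bij_betw_def
proof (intro conjI)
  show "lin_map (sp (nerve G) 1) (Ar G) (\<lambda>z. snd z 0 1)"
    by (rule lin_mapI) (auto simp: scaleR_fun_def intro: nerve_ar)
  show "inj_on (\<lambda>z. snd z 0 1) (sp (nerve G) 1)"
  proof (rule inj_onI)
    fix z w assume zw: "z \<in> sp (nerve G) 1" "w \<in> sp (nerve G) 1" "snd z 0 1 = snd w 0 1"
    then have *: "fst z 0 = fst w 0"
      using nerve_src[OF zw(1), of 0 1] nerve_src[OF zw(2), of 0 1] by simp
    show "z = w"
    proof (rule nerve_eq_of_star[OF zw(1,2) _ *])
      fix p :: nat assume "p \<le> 1"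
      then have "p = 0 \<or> p = 1" by auto
      then show "arrow_diff z 0 p = arrow_diff w 0 p"
        using zw * arrow_diff_self[OF zw(1)] arrow_diff_self[OF zw(2)] by (auto simp: arrow_diff_def)
    qed simp
  qed
  have "v \<in> (\<lambda>z. snd z 0 1) ` sp (nerve G) 1" if v: "v \<in> Ar G" for v
  proof -
    let ?c = "\<lambda>p::nat. if p = 0 then 0 else v - unt G (src G v)"
    obtain z where z: "z \<in> sp (nerve G) 1" "fst z 0 = src G v"
      "\<And>p. p \<le> 1 \<Longrightarrow> arrow_diff z 0 p = ?c p"
      by (rule nerve_of_star[of 0 1 "src G v" ?c]) (auto simp: v gpd_closed gpd_linear gpd_unit)
    have "snd z 0 1 = v" using z(3)[of 1] z(2) by (simp add: arrow_diff_def)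
    then show ?thesis using z(1) by blast
  qed
  then show "(\<lambda>z. snd z 0 1) ` sp (nerve G) 1 = Ar G" by (auto intro: nerve_ar)
qed

end

section \<open>Low-dimensional simplices\<close>

definition edge :: "nat \<Rightarrow> nat \<Rightarrow> nat \<Rightarrow> nat" where
  "edge i j = (\<lambda>p\<in>{..1}. if p = 0 then i else j)"

definition triangle :: "nat \<Rightarrow> nat \<Rightarrow> nat \<Rightarrow> nat \<Rightarrow> nat" where
  "triangle i j k = (\<lambda>p\<in>{..2}. if p = 0 then i else if p = 1 then j else k)"

lemma finite_simplices: "finite (\<Delta> m l)"
  unfolding \<Delta>_def by (rule finite_subset[OF _ finite_PiE[of "{..l}" "\<lambda>_. {..m}"]]) auto

lemma simplex_iff:
  "u \<in> \<Delta> m l \<longleftrightarrow> (\<forall>p\<le>l. u p \<le> m) \<and> (\<forall>p. \<not> p \<le> l \<longrightarrow> u p = undefined)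
     \<and> (\<forall>p q. p \<le> q \<and> q \<le> l \<longrightarrow> u p \<le> u q)"
  by (auto simp: \<Delta>_def PiE_iff extensional_def monotone_on_def)

lemma edge_in: "i \<le> j \<Longrightarrow> j \<le> m \<Longrightarrow> edge i j \<in> \<Delta> m 1"
  by (auto simp: simplex_iff edge_def)

lemma triangle_in: "i \<le> j \<Longrightarrow> j \<le> k \<Longrightarrow> k \<le> m \<Longrightarrow> triangle i j k \<in> \<Delta> m 2"
  by (auto simp: simplex_iff triangle_def)

lemma edge_0: "edge i j 0 = i" and edge_1: "edge i j 1 = j"
  by (simp_all add: edge_def)

lemma one_simplex_edge:
  assumes "u \<in> \<Delta> m 1"
  obtains i j where "u = edge i j" "i \<le> j" "j \<le> m" "u 0 = i" "u 1 = j"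
proof
  show "u = edge (u 0) (u 1)"
  proof
    fix p :: nat
    consider "p = 0" | "p = 1" | "\<not> p \<le> 1" by linarith
    then show "u p = edge (u 0) (u 1) p"
      using assms by cases (auto simp: edge_def simplex_iff)
  qed
qed (use assms in \<open>auto simp: simplex_iff\<close>)

lemma s00_edge: "s00 = edge 0 0" and s01_edge: "s01 = edge 0 1"
  by (auto simp: s00_def s01_def edge_def fun_eq_iff)

lemma sface_triangle:
  "sface 2 0 (triangle i j k) = edge j k" "sface 2 1 (triangle i j k) = edge i k"
  "sface 2 2 (triangle i j k) = edge i j"
  by (auto simp: sface_def triangle_def edge_def compose_def fun_eq_iff coface_def)

lemma two_simplex_triangle:
  assumes "u \<in> \<Delta> m 2"
  obtains i j k where "u = triangle i j k" "i \<le> j" "j \<le> k" "k \<le> m"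
proof
  show "u = triangle (u 0) (u 1) (u 2)"
  proof
    fix p :: nat
    consider "p = 0" | "p = 1" | "p = 2" | "\<not> p \<le> 2" by linarith
    then show "u p = triangle (u 0) (u 1) (u 2) p"
      using assms by cases (auto simp: triangle_def simplex_iff)
  qed
qed (use assms in \<open>auto simp: simplex_iff\<close>)

lemma zero_simplex_degen:
  assumes "u \<in> \<Delta> m 0"
  shows "sdegen 0 0 u = edge (u 0) (u 0)" "u 0 \<le> m"
  using assms by (auto simp: sdegen_def edge_def compose_def fun_eq_iff simplex_iff codegen_def)

text \<open>
  Every edge of a simplex of dimension at least 2 misses one of the vertices 0, 1, 2, and therefore lies in
  the corresponding face. This drives all inductions over the dimension that concern edges.
\<close>
definition omitted_vertex :: "nat \<Rightarrow> nat \<Rightarrow> nat" where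
  "omitted_vertex i j = (if i \<noteq> 0 \<and> j \<noteq> 0 then 0 else if i \<noteq> 1 \<and> j \<noteq> 1 then 1 else 2)"

lemma omitted_vertex:
  "omitted_vertex i j \<noteq> i" "omitted_vertex i j \<noteq> j"
  and omitted_vertex_le: "omitted_vertex i j \<le> Suc (Suc l)"
  by (auto simp: omitted_vertex_def)

lemma codegen_bounds:
  "i \<le> j \<Longrightarrow> j \<le> Suc l \<Longrightarrow> q \<le> Suc l \<Longrightarrow> q \<noteq> i \<Longrightarrow> q \<noteq> j \<Longrightarrow> codegen q i \<le> codegen q j \<and> codegen q j \<le> l"
  by (auto simp: codegen_def)

definition vertex :: "nat \<Rightarrow> nat \<Rightarrow> nat" where
  "vertex i = (\<lambda>p\<in>{..0}. i)"

lemma vertex_in: "i \<le> m \<Longrightarrow> vertex i \<in> \<Delta> m 0"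
  and sdegen_vertex: "sdegen 0 0 (vertex i) = edge i i"
  by (auto simp: vertex_def simplex_iff sdegen_def edge_def compose_def fun_eq_iff codegen_def)

lemma compose_edge: "compose {..1} \<theta> (edge i j) = edge (\<theta> i) (\<theta> j)"
  by (auto simp: edge_def compose_def fun_eq_iff)

lemma compose_in: "ord_map n m \<theta> \<Longrightarrow> u \<in> \<Delta> n l \<Longrightarrow> compose {..l} \<theta> u \<in> \<Delta> m l"
  by (auto simp: simplex_iff compose_def ord_map_def)

lemma precompose_in: "ord_map l' l \<theta> \<Longrightarrow> u \<in> \<Delta> m l \<Longrightarrow> compose {..l'} u \<theta> \<in> \<Delta> m l'"
  by (auto simp: simplex_iff compose_def ord_map_def)

lemma sface_in: "u \<in> \<Delta> m (Suc l) \<Longrightarrow> sface (Suc l) i u \<in> \<Delta> m l"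
  unfolding sface_def using precompose_in[OF ord_map_coface] by simp

lemma sdegen_in: "u \<in> \<Delta> m l \<Longrightarrow> j \<le> l \<Longrightarrow> sdegen l j u \<in> \<Delta> m (Suc l)"
  unfolding sdegen_def using precompose_in[OF ord_map_codegen] by simp

lemma sface_apply: "p \<le> l \<Longrightarrow> sface (Suc l) i u p = u (coface i p)"
  and sdegen_apply: "p \<le> Suc l \<Longrightarrow> sdegen l j u p = u (codegen j p)"
  by (simp_all add: sface_def sdegen_def compose_def)

lemma compose_sface: "compose {..l} \<theta> (sface (Suc l) i u) = sface (Suc l) i (compose {..Suc l} \<theta> u)"
  by (auto simp: sface_def compose_def coface_def fun_eq_iff)

lemma compose_sdegen:
  "j \<le> l \<Longrightarrow> compose {..Suc l} \<theta> (sdegen l j u) = sdegen l j (compose {..l} \<theta> u)"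
  by (auto simp: sdegen_def compose_def codegen_def fun_eq_iff)

section \<open>Normalised cocycles\<close>

text \<open>
  The normalisation \<open>c(i, i) = 0\<close> is the cocycle condition for the triangle \<open>(i, i, i)\<close>.
\<close>
lemma B1R_I:
  assumes "\<And>\<sigma>. \<sigma> \<notin> \<Delta> m 1 \<Longrightarrow> c \<sigma> = 0"
    and cyc: "\<And>i j k. i \<le> j \<Longrightarrow> j \<le> k \<Longrightarrow> k \<le> m \<Longrightarrow> c (edge i k) = c (edge j k) + c (edge i j)"
  shows "c \<in> sp B1R m"
proof -
  have "c (sdegen 0 0 \<tau>) = 0" if "\<tau> \<in> \<Delta> m 0" for \<tau>
    using cyc[of "\<tau> 0" "\<tau> 0" "\<tau> 0"] zero_simplex_degen[OF that] by simp
  moreover have "c (sface 2 0 \<sigma>) - c (sface 2 1 \<sigma>) + c (sface 2 2 \<sigma>) = 0" if \<sigma>: "\<sigma> \<in> \<Delta> m 2" for \<sigma>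
  proof -
    obtain i j k where "\<sigma> = triangle i j k" "i \<le> j" "j \<le> k" "k \<le> m"
      using two_simplex_triangle[OF \<sigma>] .
    then show ?thesis using cyc[of i j k] by (simp add: sface_triangle del: One_nat_def)
  qed
  ultimately show ?thesis using assms(1) by (simp add: B1R_def)
qed

lemma
  assumes "c \<in> sp B1R m"
  shows B1R_outside: "\<sigma> \<notin> \<Delta> m 1 \<Longrightarrow> c \<sigma> = 0"
    and B1R_cocycle: "i \<le> j \<Longrightarrow> j \<le> k \<Longrightarrow> k \<le> m \<Longrightarrow> c (edge i k) = c (edge j k) + c (edge i j)"
    and B1R_normalised: "i \<le> m \<Longrightarrow> c (edge i i) = 0"
proof -
  show "\<sigma> \<notin> \<Delta> m 1 \<Longrightarrow> c \<sigma> = 0" using assms by (simp add: B1R_def)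
  show cyc: "c (edge i k) = c (edge j k) + c (edge i j)" if "i \<le> j" "j \<le> k" "k \<le> m" for i j k
  proof -
    have "\<forall>\<sigma>\<in>\<Delta> m 2. c (sface 2 0 \<sigma>) - c (sface 2 1 \<sigma>) + c (sface 2 2 \<sigma>) = 0"
      using assms by (simp add: B1R_def)
    from this[rule_format, OF triangle_in[OF that]] show ?thesis unfolding sface_triangle by simp
  qed
  show "i \<le> m \<Longrightarrow> c (edge i i) = 0" using cyc[of i i i] by simp
qed

lemma B1R_subspace: "subspace (sp B1R m)"
proof (rule subspaceI, goal_cases)
  case 1 show ?case by (rule B1R_I) auto
next
  case (2 c d)
  show ?case
  proof (rule B1R_I)
    show "(c + d) (edge i k) = (c + d) (edge j k) + (c + d) (edge i j)"
      if "i \<le> j" "j \<le> k" "k \<le> m" for i j k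
      using B1R_cocycle[OF 2(1) that] B1R_cocycle[OF 2(2) that] by simp
  qed (simp add: B1R_outside[OF 2(1)] B1R_outside[OF 2(2)] del: One_nat_def)
next
  case (3 r c)
  show ?case
  proof (rule B1R_I)
    show "(r *\<^sub>R c) (edge i k) = (r *\<^sub>R c) (edge j k) + (r *\<^sub>R c) (edge i j)"
      if "i \<le> j" "j \<le> k" "k \<le> m" for i j k
      using B1R_cocycle[OF 3 that] by (simp add: scaleR_fun_def distrib_left)
  qed (simp add: scaleR_fun_def B1R_outside[OF 3] del: One_nat_def)
qed

lemma face_B1R_edge:
  "i \<le> j \<Longrightarrow> j \<le> l \<Longrightarrow> face B1R (Suc l) p c (edge i j) = c (edge (coface p i) (coface p j))"
  using edge_in[of i j l] compose_edge[of "coface p" i j] by (simp add: B1R_def B1R_pull_def)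

lemma degen_B1R_edge:
  "i \<le> j \<Longrightarrow> j \<le> Suc l \<Longrightarrow> degen B1R l p c (edge i j) = c (edge (codegen p i) (codegen p j))"
  using edge_in[of i j "Suc l"] compose_edge[of "codegen p" i j] by (simp add: B1R_def B1R_pull_def)

lemma face_B1R_outside: "\<sigma> \<notin> \<Delta> l 1 \<Longrightarrow> face B1R (Suc l) p c \<sigma> = 0"
  and degen_B1R_outside: "\<sigma> \<notin> \<Delta> (Suc l) 1 \<Longrightarrow> degen B1R l p c \<sigma> = 0"
  by (simp_all add: B1R_def B1R_pull_def)

lemma face_B1R_lin: "face B1R l p (c + d) = face B1R l p c + face B1R l p d"
    "face B1R l p (r *\<^sub>R c) = r *\<^sub>R face B1R l p c"
  and degen_B1R_lin: "degen B1R l p (c + d) = degen B1R l p c + degen B1R l p d"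
    "degen B1R l p (r *\<^sub>R c) = r *\<^sub>R degen B1R l p c"
  by (auto simp: B1R_def B1R_pull_def scaleR_fun_def fun_eq_iff)

lemma face_B1R_0: "face B1R l p 0 = 0" and degen_B1R_0: "degen B1R l p 0 = 0"
  by (auto simp: B1R_def B1R_pull_def fun_eq_iff)

section \<open>Sums of vectors placed at simplices\<close>

lemma at_simplex_add: "at_simplex u (v + w) = at_simplex u v + at_simplex u w"
  and at_simplex_scale: "at_simplex u (r *\<^sub>R v) = r *\<^sub>R at_simplex u v"
  by (auto simp: at_simplex_def scaleR_fun_def fun_eq_iff)

lemma at_simplex_lin: "lin_map S UNIV (at_simplex u)"
  by (rule lin_mapI) (simp_all add: at_simplex_add at_simplex_scale)

lemma at_simplex_0: "at_simplex u 0 = 0"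
  by (auto simp: at_simplex_def)

lemma at_simplex_in: "subspace S \<Longrightarrow> u \<in> A \<Longrightarrow> v \<in> S \<Longrightarrow> at_simplex u v \<in> supp_fun A S"
  by (auto simp: at_simplex_def supp_fun_def subspace_0)

lemma at_simplex_in_iff: "subspace S \<Longrightarrow> u \<in> A \<Longrightarrow> at_simplex u v \<in> supp_fun A S \<longleftrightarrow> v \<in> S"
  by (auto simp: at_simplex_def supp_fun_def subspace_0 split: if_splits)

lemma sum_at_simplex_in:
  assumes "subspace S" "\<And>u. u \<in> A \<Longrightarrow> \<phi> u \<in> B" "\<And>u. u \<in> A \<Longrightarrow> g u \<in> S"
  shows "(\<Sum>u\<in>A. at_simplex (\<phi> u) (g u)) \<in> supp_fun B S"
  using assms by (intro subspace_sum[OF subspace_supp_fun] at_simplex_in) auto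

lemma supp_fun_decompose:
  assumes "finite A" "y \<in> supp_fun A S"
  shows "y = (\<Sum>u\<in>A. at_simplex u (y u))"
proof
  fix w
  have "(\<Sum>u\<in>A. at_simplex u (y u) w) = (\<Sum>u\<in>A. if u = w then y w else 0)"
    by (rule sum.cong) (auto simp: at_simplex_def)
  also have "\<dots> = y w" using assms by (auto simp: supp_fun_def)
  finally show "y w = (\<Sum>u\<in>A. at_simplex u (y u)) w" by (simp add: sum_fun_apply)
qed

text \<open>
  Faces, degeneracies and the maps induced by \<open>\<Delta>[n] \<rightarrow> \<Delta>[m]\<close> all send \<open>v\<^sup>u\<close> to a vector at
  another simplex \<open>\<phi> u\<close>. What follows such a map can be evaluated term by term: several \<open>u\<close> may be
  sent to the same \<open>w\<close>, but \<open>h w\<close> is additive.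
\<close>
lemma sum_over_at_simplex_sum:
  fixes h :: "(nat \<Rightarrow> nat) \<Rightarrow> 'b::real_vector \<Rightarrow> 'c::real_vector"
  assumes A: "finite A" and B: "finite B" and \<phi>: "\<And>u. u \<in> A \<Longrightarrow> \<phi> u \<in> B"
    and S: "subspace S" and g: "\<And>u. u \<in> A \<Longrightarrow> g u \<in> S"
    and h: "\<And>w. w \<in> B \<Longrightarrow> lin_map S UNIV (h w)"
  shows "(\<Sum>w\<in>B. h w ((\<Sum>u\<in>A. at_simplex (\<phi> u) (g u)) w)) = (\<Sum>u\<in>A. h (\<phi> u) (g u))"
proof -
  have "(\<Sum>w\<in>B. h w ((\<Sum>u\<in>A. at_simplex (\<phi> u) (g u)) w))
      = (\<Sum>w\<in>B. \<Sum>u\<in>A. if \<phi> u = w then h (\<phi> u) (g u) else 0)"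
  proof (rule sum.cong)
    fix w assume w: "w \<in> B"
    have "h w ((\<Sum>u\<in>A. at_simplex (\<phi> u) (g u)) w) = h w (\<Sum>u\<in>A. at_simplex (\<phi> u) (g u) w)"
      by (simp add: sum_fun_apply)
    also have "\<dots> = (\<Sum>u\<in>A. h w (at_simplex (\<phi> u) (g u) w))"
      by (rule lin_map_sum[OF h[OF w] S]) (auto simp: at_simplex_def g subspace_0[OF S])
    also have "\<dots> = (\<Sum>u\<in>A. if \<phi> u = w then h (\<phi> u) (g u) else 0)"
      by (rule sum.cong) (auto simp: at_simplex_def lin_map_zero[OF h[OF w] S])
    finally show "h w ((\<Sum>u\<in>A. at_simplex (\<phi> u) (g u)) w)
      = (\<Sum>u\<in>A. if \<phi> u = w then h (\<phi> u) (g u) else 0)" .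
  qed simp
  also have "\<dots> = (\<Sum>u\<in>A. \<Sum>w\<in>B. if \<phi> u = w then h (\<phi> u) (g u) else 0)" by (rule sum.swap)
  also have "\<dots> = (\<Sum>u\<in>A. h (\<phi> u) (g u))" using B \<phi> by (intro sum.cong) auto
  finally show ?thesis .
qed

lemma sum_at_simplex_single:
  assumes "finite A" "u \<in> A" "h 0 = 0"
  shows "(\<Sum>w\<in>A. at_simplex (\<phi> w) (h (at_simplex u v w))) = at_simplex (\<phi> u) (h v)"
proof -
  have "(\<Sum>w\<in>A. at_simplex (\<phi> w) (h (at_simplex u v w)))
      = (\<Sum>w\<in>A. if w = u then at_simplex (\<phi> u) (h v) else 0)"
  proof (rule sum.cong)
    show "at_simplex (\<phi> w) (h (at_simplex u v w)) = (if w = u then at_simplex (\<phi> u) (h v) else 0)" for w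
      by (cases "w = u") (simp_all add: at_simplex_def[of u v] assms(3) at_simplex_0)
  qed simp
  then show ?thesis using assms(1,2) by simp
qed

section \<open>The tensor product with a standard simplex\<close>

lemma sp_tensor: "sp (tensor V m) l = supp_fun (\<Delta> m l) (sp V l)"
  by (simp add: tensor_def supp_fun_def)

lemma face_tensor:
    "face (tensor V m) l i y = (\<Sum>u\<in>\<Delta> m l. at_simplex (sface l i u) (face V l i (y u)))"
  and degen_tensor:
    "degen (tensor V m) l j y = (\<Sum>u\<in>\<Delta> m l. at_simplex (sdegen l j u) (degen V l j (y u)))"
  by (simp_all add: tensor_def)

lemma tensor_push_lin:
  "tensor_push n \<theta> l (y + z) = tensor_push n \<theta> l y + tensor_push n \<theta> l z"
  "tensor_push n \<theta> l (r *\<^sub>R y) = r *\<^sub>R tensor_push n \<theta> l y"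
  for y z :: "(nat \<Rightarrow> nat) \<Rightarrow> 'a::real_vector"
  by (simp_all add: tensor_push_def at_simplex_add sum.distrib
      at_simplex_scale scaleR_fun_def[of r y] scaleR_sum_right)

lemma sp_dual1: "sp (dual1 V) m = SVec (tensor V m) B1R"
  and face_dual1: "face (dual1 V) m i = dual_pull V (m - 1) (coface i)"
  and degen_dual1: "degen (dual1 V) m j = dual_pull V (Suc m) (codegen j)"
  by (simp_all add: dual1_def)

lemma dual1_I:
  assumes "\<And>l. lin_map (sp (tensor V m) l) (sp B1R l) (f l)"
    and "\<And>l x. x \<notin> sp (tensor V m) l \<Longrightarrow> f l x = 0"
    and "\<And>l i x. i \<le> Suc l \<Longrightarrow> x \<in> sp (tensor V m) (Suc l) \<Longrightarrow>
      f l (face (tensor V m) (Suc l) i x) = face B1R (Suc l) i (f (Suc l) x)"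
    and "\<And>l j x. j \<le> l \<Longrightarrow> x \<in> sp (tensor V m) l \<Longrightarrow>
      f (Suc l) (degen (tensor V m) l j x) = degen B1R l j (f l x)"
  shows "f \<in> sp (dual1 V) m"
  unfolding sp_dual1 SVec_def using assms by (intro CollectI conjI allI impI ballI)

lemma
  assumes "f \<in> sp (dual1 V) m"
  shows dual1_lin: "lin_map (sp (tensor V m) l) (sp B1R l) (f l)"
    and dual1_outside: "x \<notin> sp (tensor V m) l \<Longrightarrow> f l x = 0"
    and dual1_face: "i \<le> Suc l \<Longrightarrow> x \<in> sp (tensor V m) (Suc l) \<Longrightarrow>
      f l (face (tensor V m) (Suc l) i x) = face B1R (Suc l) i (f (Suc l) x)"
    and dual1_degen: "j \<le> l \<Longrightarrow> x \<in> sp (tensor V m) l \<Longrightarrow>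
      f (Suc l) (degen (tensor V m) l j x) = degen B1R l j (f l x)"
proof -
  note 1 = assms[unfolded sp_dual1 SVec_def mem_Collect_eq]
  note 2 = conjunct2[OF 1]
  show "lin_map (sp (tensor V m) l) (sp B1R l) (f l)"
    by (rule conjunct1[OF 1, rule_format, THEN conjunct1])
  show "f l x = 0" if "x \<notin> sp (tensor V m) l"
    by (rule conjunct1[OF 1, rule_format, THEN conjunct2, rule_format, OF that])
  show "f l (face (tensor V m) (Suc l) i x) = face B1R (Suc l) i (f (Suc l) x)"
    if "i \<le> Suc l" "x \<in> sp (tensor V m) (Suc l)"
    by (rule conjunct1[OF 2, rule_format, OF that])
  show "f (Suc l) (degen (tensor V m) l j x) = degen B1R l j (f l x)"
    if "j \<le> l" "x \<in> sp (tensor V m) l"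
    by (rule conjunct2[OF 2, rule_format, OF that])
qed

definition edge_value :: "'a::real_vector dual_simplex \<Rightarrow> nat \<Rightarrow> nat \<Rightarrow> 'a \<Rightarrow> real" where
  "edge_value f i j = (\<lambda>v. f 1 (at_simplex (edge i j) v) (edge 0 1))"

lemma ident0_edge_value: "ident0 f = edge_value f 0 0"
  and ident1_edge_value: "ident1 f = edge_value f 0 1"
  by (simp_all add: ident0_def ident1_def edge_value_def s00_edge s01_edge)

context
  fixes V :: "'a::real_vector svec"
  assumes V: "simplicial_vs V"
begin

lemmas V_subspace = sv_subspace[OF V]

lemma tensor_subspace: "subspace (sp (tensor V m) l)"
  unfolding sp_tensor by (rule subspace_supp_fun[OF V_subspace])

lemma face_V_0: "i \<le> Suc l \<Longrightarrow> face V (Suc l) i 0 = 0"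
  by (rule lin_map_zero[OF sv_face_lin[OF V] V_subspace])

lemma degen_V_0: "j \<le> l \<Longrightarrow> degen V l j 0 = 0"
  by (rule lin_map_zero[OF sv_degen_lin[OF V] V_subspace])

lemma tensor_apply_in: "y \<in> sp (tensor V m) l \<Longrightarrow> y u \<in> sp V l"
  using subspace_0[OF V_subspace] by (cases "u \<in> \<Delta> m l") (auto simp: sp_tensor supp_fun_def)

lemma face_tensor_in:
  "i \<le> Suc l \<Longrightarrow> y \<in> sp (tensor V m) (Suc l) \<Longrightarrow> face (tensor V m) (Suc l) i y \<in> sp (tensor V m) l"
  unfolding face_tensor sp_tensor[of V m l]
  by (intro sum_at_simplex_in V_subspace sface_in sv_face_in[OF V] tensor_apply_in)

lemma degen_tensor_in:
  "j \<le> l \<Longrightarrow> y \<in> sp (tensor V m) l \<Longrightarrow> degen (tensor V m) l j y \<in> sp (tensor V m) (Suc l)"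
  unfolding degen_tensor sp_tensor[of V m "Suc l"]
  by (intro sum_at_simplex_in V_subspace sdegen_in sv_degen_in[OF V] tensor_apply_in)

lemma tensor_push_in:
  "ord_map n m \<theta> \<Longrightarrow> y \<in> sp (tensor V n) l \<Longrightarrow> tensor_push n \<theta> l y \<in> sp (tensor V m) l"
  unfolding tensor_push_def sp_tensor[of V m l]
  by (intro sum_at_simplex_in V_subspace compose_in tensor_apply_in)

lemma face_at_simplex:
  "i \<le> Suc l \<Longrightarrow> u \<in> \<Delta> m (Suc l) \<Longrightarrow>
    face (tensor V m) (Suc l) i (at_simplex u v) = at_simplex (sface (Suc l) i u) (face V (Suc l) i v)"
  unfolding face_tensor by (rule sum_at_simplex_single[where h = "face V (Suc l) i"]) (auto simp: finite_simplices face_V_0)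

lemma degen_at_simplex:
  "j \<le> l \<Longrightarrow> u \<in> \<Delta> m l \<Longrightarrow>
    degen (tensor V m) l j (at_simplex u v) = at_simplex (sdegen l j u) (degen V l j v)"
  unfolding degen_tensor by (rule sum_at_simplex_single[where h = "degen V l j"]) (auto simp: finite_simplices degen_V_0)

lemma tensor_push_at_simplex:
  "u \<in> \<Delta> n l \<Longrightarrow> tensor_push n \<theta> l (at_simplex u v) = at_simplex (compose {..l} \<theta> u) v"
  unfolding tensor_push_def by (rule sum_at_simplex_single[where h = "\<lambda>v. v"]) (auto simp: finite_simplices)

lemma tensor_push_face:
  assumes "ord_map n m \<theta>" "i \<le> Suc l" "y \<in> sp (tensor V n) (Suc l)"
  shows "tensor_push n \<theta> l (face (tensor V n) (Suc l) i y)
      = face (tensor V m) (Suc l) i (tensor_push n \<theta> (Suc l) y)"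
proof -
  note y = tensor_apply_in[OF assms(3)]
  have "tensor_push n \<theta> l (face (tensor V n) (Suc l) i y)
      = (\<Sum>u\<in>\<Delta> n (Suc l). at_simplex (compose {..l} \<theta> (sface (Suc l) i u)) (face V (Suc l) i (y u)))"
    unfolding tensor_push_def face_tensor
    by (rule sum_over_at_simplex_sum[OF finite_simplices finite_simplices sface_in V_subspace
          sv_face_in[OF V assms(2) y] at_simplex_lin])
  also have "\<dots> = (\<Sum>u\<in>\<Delta> n (Suc l).
      at_simplex (sface (Suc l) i (compose {..Suc l} \<theta> u)) (face V (Suc l) i (y u)))"
    by (simp only: compose_sface)
  also have "\<dots> = face (tensor V m) (Suc l) i (tensor_push n \<theta> (Suc l) y)"
    unfolding tensor_push_def face_tensor
  proof (rule sum_over_at_simplex_sum[OF finite_simplices finite_simplices compose_in[OF assms(1)]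
        V_subspace y, symmetric])
    show "lin_map (sp V (Suc l)) UNIV (\<lambda>v. at_simplex (sface (Suc l) i w) (face V (Suc l) i v))" for w
      by (rule lin_mapI)
         (simp_all add: lin_map_add[OF sv_face_lin[OF V assms(2)]] at_simplex_add
            lin_map_scale[OF sv_face_lin[OF V assms(2)]] at_simplex_scale)
  qed
  finally show ?thesis .
qed

lemma tensor_push_degen:
  assumes "ord_map n m \<theta>" "j \<le> l" "y \<in> sp (tensor V n) l"
  shows "tensor_push n \<theta> (Suc l) (degen (tensor V n) l j y)
      = degen (tensor V m) l j (tensor_push n \<theta> l y)"
proof -
  note y = tensor_apply_in[OF assms(3)]
  have "tensor_push n \<theta> (Suc l) (degen (tensor V n) l j y)
      = (\<Sum>u\<in>\<Delta> n l. at_simplex (compose {..Suc l} \<theta> (sdegen l j u)) (degen V l j (y u)))"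
    unfolding tensor_push_def degen_tensor
    by (rule sum_over_at_simplex_sum[OF finite_simplices finite_simplices sdegen_in[OF _ assms(2)] V_subspace
          sv_degen_in[OF V assms(2) y] at_simplex_lin])
  also have "\<dots> = (\<Sum>u\<in>\<Delta> n l. at_simplex (sdegen l j (compose {..l} \<theta> u)) (degen V l j (y u)))"
    by (simp only: compose_sdegen[OF assms(2)])
  also have "\<dots> = degen (tensor V m) l j (tensor_push n \<theta> l y)"
    unfolding tensor_push_def degen_tensor
  proof (rule sum_over_at_simplex_sum[OF finite_simplices finite_simplices compose_in[OF assms(1)]
        V_subspace y, symmetric])
    show "lin_map (sp V l) UNIV (\<lambda>v. at_simplex (sdegen l j w) (degen V l j v))" for w
      by (rule lin_mapI)
         (simp_all add: lin_map_add[OF sv_degen_lin[OF V assms(2)]] at_simplex_add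
            lin_map_scale[OF sv_degen_lin[OF V assms(2)]] at_simplex_scale)
  qed
  finally show ?thesis .
qed

section \<open>Simplices of the dual and their values on edges\<close>

lemma dual1_subspace: "subspace (sp (dual1 V) m)"
proof (rule subspaceI, goal_cases)
  case 1
  show ?case
    by (rule dual1_I) (auto simp: face_B1R_0 degen_B1R_0 intro!: lin_mapI subspace_0[OF B1R_subspace])
next
  case (2 f g)
  note f = dual1_lin[OF 2(1)] and g = dual1_lin[OF 2(2)]
  show ?case
  proof (rule dual1_I)
    show "lin_map (sp (tensor V m) l) (sp B1R l) ((f + g) l)" for l
      by (rule lin_mapI)
         (simp_all add: lin_map_add[OF f] lin_map_add[OF g] lin_map_scale[OF f] lin_map_scale[OF g]
           scaleR_add_right subspace_add[OF B1R_subspace] lin_map_in[OF f] lin_map_in[OF g])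
  qed (simp_all add: dual1_outside[OF 2(1)] dual1_outside[OF 2(2)] dual1_face[OF 2(1)]
        dual1_face[OF 2(2)] dual1_degen[OF 2(1)] dual1_degen[OF 2(2)] face_B1R_lin degen_B1R_lin)
next
  case (3 r f)
  note f = dual1_lin[OF 3]
  have r: "(r *\<^sub>R f) l x = r *\<^sub>R f l x" for l x by (simp add: scaleR_fun_def)
  show ?case
  proof (rule dual1_I)
    show "lin_map (sp (tensor V m) l) (sp B1R l) ((r *\<^sub>R f) l)" for l
      by (rule lin_mapI)
         (simp_all add: r lin_map_add[OF f] lin_map_scale[OF f]
           scaleR_add_right subspace_scale[OF B1R_subspace] lin_map_in[OF f])
  qed (simp_all add: r dual1_outside[OF 3] dual1_face[OF 3] dual1_degen[OF 3] face_B1R_lin degen_B1R_lin)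
qed

lemma dual_pull_in:
  assumes f: "f \<in> sp (dual1 V) m" and \<theta>: "ord_map n m \<theta>"
  shows "dual_pull V n \<theta> f \<in> sp (dual1 V) n"
proof (rule dual1_I)
  note push = tensor_push_in[OF \<theta>] and lin = dual1_lin[OF f]
  show "lin_map (sp (tensor V n) l) (sp B1R l) (dual_pull V n \<theta> f l)" for l
    by (rule lin_mapI)
       (simp_all add: dual_pull_def lin_map_in[OF lin] push tensor_push_lin lin_map_add[OF lin]
          lin_map_scale[OF lin] subspace_add[OF tensor_subspace] subspace_scale[OF tensor_subspace])
  show "dual_pull V n \<theta> f l x = 0" if "x \<notin> sp (tensor V n) l" for l x
    using that by (simp add: dual_pull_def)
  show "dual_pull V n \<theta> f l (face (tensor V n) (Suc l) i x)
      = face B1R (Suc l) i (dual_pull V n \<theta> f (Suc l) x)"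
    if "i \<le> Suc l" "x \<in> sp (tensor V n) (Suc l)" for l i x
    using that by (simp add: dual_pull_def face_tensor_in tensor_push_face[OF \<theta>] push dual1_face[OF f])
  show "dual_pull V n \<theta> f (Suc l) (degen (tensor V n) l j x)
      = degen B1R l j (dual_pull V n \<theta> f l x)"
    if "j \<le> l" "x \<in> sp (tensor V n) l" for l j x
    using that by (simp add: dual_pull_def degen_tensor_in tensor_push_degen[OF \<theta>] push dual1_degen[OF f])
qed

lemma edge_value_dual_space:
  assumes f: "f \<in> sp (dual1 V) m" and ij: "i \<le> j" "j \<le> m"
  shows "edge_value f i j \<in> dual_space (sp V 1)"
proof -
  note e = edge_in[OF ij]
  have "edge_value f i j v = 0" if "v \<notin> sp V 1" for v
    using that dual1_outside[OF f] at_simplex_in_iff[OF V_subspace e, of v]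
    by (simp add: edge_value_def sp_tensor)
  moreover have "lin_map (sp V 1) UNIV (edge_value f i j)"
    unfolding edge_value_def
    by (rule lin_mapI)
       (simp_all add: at_simplex_add at_simplex_scale
          lin_map_add[OF dual1_lin[OF f]] lin_map_scale[OF dual1_lin[OF f]] sp_tensor
          at_simplex_in[OF V_subspace e] scaleR_fun_apply del: One_nat_def)
  ultimately show ?thesis by (simp add: dual_space_def)
qed

text \<open>
  The cocycle condition of \<open>f 2 (z\<^sup>u)\<close> for the triangle \<open>u\<close> with vertices \<open>i, j, k\<close>, evaluated at the
  fundamental triangle.
\<close>
lemma edge_value_cocycle:
  assumes f: "f \<in> sp (dual1 V) m" and ijk: "i \<le> j" "j \<le> k" "k \<le> m" and z: "z \<in> sp V 2"
  shows "edge_value f i k (face V 2 1 z) = edge_value f j k (face V 2 0 z) + edge_value f i j (face V 2 2 z)"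
proof -
  let ?y = "at_simplex (triangle i j k) z"
  have 2: "2 = Suc 1" by simp
  have y: "?y \<in> sp (tensor V m) 2"
    unfolding sp_tensor by (rule at_simplex_in[OF V_subspace triangle_in[OF ijk] z])
  have face: "f 1 (at_simplex (sface 2 p (triangle i j k)) (face V 2 p z)) (edge 0 1)
      = f 2 ?y (edge (coface p 0) (coface p 1))" if "p \<le> 2" for p
    using dual1_face[OF f, of p 1 ?y] face_at_simplex[of p 1 "triangle i j k" m z]
      triangle_in[OF ijk] face_B1R_edge[of 0 1 1 p "f 2 ?y"] y that unfolding 2 by simp
  have "f 2 ?y \<in> sp B1R 2" by (rule lin_map_in[OF dual1_lin[OF f] y])
  from B1R_cocycle[OF this, of 0 1 2] face[of 0] face[of 1] face[of 2]
  show ?thesis unfolding edge_value_def sface_triangle by (simp add: coface_def numeral_2_eq_2)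
qed

lemma edge_value_degenerate:
  assumes f: "f \<in> sp (dual1 V) m" and i: "i \<le> m" and x: "x \<in> sp V 0"
  shows "edge_value f i i (degen V 0 0 x) = 0"
proof -
  let ?y = "at_simplex (vertex i) x"
  have y: "?y \<in> sp (tensor V m) 0"
    unfolding sp_tensor by (rule at_simplex_in[OF V_subspace vertex_in[OF i] x])
  have "f 1 (at_simplex (edge i i) (degen V 0 0 x)) = degen B1R 0 0 (f 0 ?y)"
    using dual1_degen[OF f _ y, of 0] degen_at_simplex[OF _ vertex_in[OF i], of 0 x] sdegen_vertex by simp
  moreover have "degen B1R 0 0 (f 0 ?y) (edge 0 1) = f 0 ?y (edge 0 0)"
    using degen_B1R_edge[of 0 1 0 0] by (simp add: codegen_def)
  moreover have "f 0 ?y (edge 0 0) = 0"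
    using B1R_normalised[OF lin_map_in[OF dual1_lin[OF f] y], of 0] by simp
  ultimately show ?thesis by (simp add: edge_value_def)
qed

lemma edge_value_dual_pull:
  assumes f: "f \<in> sp (dual1 V) m" and \<theta>: "ord_map n m \<theta>" and ij: "i \<le> j" "j \<le> n"
  shows "edge_value (dual_pull V n \<theta> f) i j = edge_value f (\<theta> i) (\<theta> j)"
proof
  fix v
  have ij': "\<theta> i \<le> \<theta> j" "\<theta> j \<le> m" using \<theta> ij by (auto simp: ord_map_def)
  show "edge_value (dual_pull V n \<theta> f) i j v = edge_value f (\<theta> i) (\<theta> j) v"
  proof (cases "v \<in> sp V 1")
    case True
    then have "at_simplex (edge i j) v \<in> sp (tensor V n) 1"
      unfolding sp_tensor by (rule at_simplex_in[OF V_subspace edge_in[OF ij]])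
    then show ?thesis
      unfolding edge_value_def dual_pull_def
      by (simp add: tensor_push_at_simplex[OF edge_in[OF ij]] compose_edge del: One_nat_def)
  next
    case False
    then show ?thesis
      using edge_value_dual_space[OF f ij'] edge_value_dual_space[OF dual_pull_in[OF f \<theta>] ij]
      by (simp add: dual_space_def)
  qed
qed

text \<open>
  A cocycle is determined by its values on edges. An edge of a simplex of dimension at least 2 lies in a face, so by
  naturality the values of \<open>f l\<close> are values of \<open>f (l - 1)\<close>; the induction ends at the edge \<open>01\<close> of
  \<open>\<Delta>[1]\<close>.
\<close>
lemma dual1_eqI:
  assumes f: "f \<in> sp (dual1 V) m" and g: "g \<in> sp (dual1 V) m"
    and eq: "\<And>i j. i \<le> j \<Longrightarrow> j \<le> m \<Longrightarrow> edge_value f i j = edge_value g i j"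
  shows "f = g"
proof -
  have base: "f 1 y (edge 0 1) = g 1 y (edge 0 1)" if y: "y \<in> sp (tensor V m) 1" for y
  proof -
    have at: "at_simplex u (y u) \<in> sp (tensor V m) 1" if "u \<in> \<Delta> m 1" for u
      unfolding sp_tensor by (rule at_simplex_in[OF V_subspace that tensor_apply_in[OF y]])
    have dec: "y = (\<Sum>u\<in>\<Delta> m 1. at_simplex u (y u))"
      using y unfolding sp_tensor by (rule supp_fun_decompose[OF finite_simplices])
    have sum: "h 1 y (edge 0 1) = (\<Sum>u\<in>\<Delta> m 1. h 1 (at_simplex u (y u)) (edge 0 1))"
      if "h \<in> sp (dual1 V) m" for h
    proof -
      have "h 1 y (edge 0 1) = h 1 (\<Sum>u\<in>\<Delta> m 1. at_simplex u (y u)) (edge 0 1)"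
        using dec by simp
      also have "h 1 (\<Sum>u\<in>\<Delta> m 1. at_simplex u (y u)) = (\<Sum>u\<in>\<Delta> m 1. h 1 (at_simplex u (y u)))"
        by (rule lin_map_sum[OF dual1_lin[OF that] tensor_subspace at])
      finally show ?thesis by (simp add: sum_fun_apply)
    qed
    have "f 1 (at_simplex u (y u)) (edge 0 1) = g 1 (at_simplex u (y u)) (edge 0 1)"
      if u: "u \<in> \<Delta> m 1" for u
    proof -
      obtain i j where "u = edge i j" "i \<le> j" "j \<le> m" using one_simplex_edge[OF u] by metis
      then show ?thesis using fun_cong[OF eq[of i j], of "y u"] by (simp add: edge_value_def)
    qed
    then show ?thesis unfolding sum[OF f] sum[OF g] by (rule sum.cong[OF refl])
  qed
  have edges: "f l y (edge i j) = g l y (edge i j)"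
    if "i \<le> j" "j \<le> l" "y \<in> sp (tensor V m) l" for l y i j
    using that
  proof (induction l arbitrary: y i j)
    case 0
    then show ?case
      using B1R_normalised[OF lin_map_in[OF dual1_lin[OF f] 0(3)], of 0]
        B1R_normalised[OF lin_map_in[OF dual1_lin[OF g] 0(3)], of 0] by simp
  next
    case (Suc l)
    show ?case
    proof (cases "i = j")
      case True
      then show ?thesis
        using B1R_normalised[OF lin_map_in[OF dual1_lin[OF f] Suc(4)]]
          B1R_normalised[OF lin_map_in[OF dual1_lin[OF g] Suc(4)]] Suc(2,3) by simp
    next
      case False
      show ?thesis
      proof (cases "l = 0")
        case True
        then have "i = 0" "j = 1" using False Suc(2,3) by auto
        then show ?thesis using base Suc(4) True by simp
      next
        case l: False
        define q where "q = omitted_vertex i j"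
        have q: "q \<le> Suc l" "q \<noteq> i" "q \<noteq> j"
          using l omitted_vertex[of i j] omitted_vertex_le[of i j "l - 1"] by (auto simp: q_def)
        have ij': "codegen q i \<le> codegen q j" "codegen q j \<le> l"
          using codegen_bounds[OF Suc(2,3) q] by auto
        have step: "h (Suc l) y (edge i j)
            = h l (face (tensor V m) (Suc l) q y) (edge (codegen q i) (codegen q j))"
          if "h \<in> sp (dual1 V) m" for h
          using dual1_face[OF that q(1) Suc(4)] face_B1R_edge[OF ij', of q "h (Suc l) y"]
            coface_codegen[of i q] coface_codegen[of j q] q by simp
        show ?thesis
          using step[OF f] step[OF g] Suc.IH[OF ij' face_tensor_in[OF q(1) Suc(4)]] by simp
      qed
    qed
  qed
  have "f l y \<sigma> = g l y \<sigma>" for l y \<sigma>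
  proof (cases "y \<in> sp (tensor V m) l")
    case y: True
    show ?thesis
    proof (cases "\<sigma> \<in> \<Delta> l 1")
      case True
      then show ?thesis using edges[OF _ _ y] by (metis one_simplex_edge)
    next
      case False
      then show ?thesis
        using B1R_outside[OF lin_map_in[OF dual1_lin[OF f] y]]
          B1R_outside[OF lin_map_in[OF dual1_lin[OF g] y]] by simp
    qed
  next
    case False
    then show ?thesis using dual1_outside[OF f] dual1_outside[OF g] by simp
  qed
  then show ?thesis by (intro ext)
qed

end

section \<open>Restriction of simplices to edges\<close>

text \<open>
  The operator \<open>\<V>\<^sub>l \<rightarrow> \<V>\<^sub>1\<close> of the simplex category given by the map \<open>0 \<mapsto> i\<close>, \<open>1 \<mapsto> j\<close>. It is
  computed by taking faces opposite to vertices not on the edge, in a fixed order, until dimension 1 is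
  reached. In dimension 1 the vertex \<open>i\<close> is the face opposite to \<open>1 - i\<close>.
\<close>
fun edge_op :: "'a::real_vector svec \<Rightarrow> nat \<Rightarrow> nat \<Rightarrow> nat \<Rightarrow> 'a \<Rightarrow> 'a" where
  "edge_op V 0 i j x = degen V 0 0 x"
| "edge_op V (Suc 0) i j x = (if i = j then degen V 0 0 (face V 1 (1 - i) x) else x)"
| "edge_op V (Suc (Suc l)) i j x =
     edge_op V (Suc l) (codegen (omitted_vertex i j) i) (codegen (omitted_vertex i j) j)
       (face V (Suc (Suc l)) (omitted_vertex i j) x)"

context
  fixes V :: "'a::real_vector svec"
  assumes V: "simplicial_vs V"
begin

lemma edge_op_lin:
  assumes "i \<le> j" "j \<le> l"
  shows "lin_map (sp V l) (sp V 1) (edge_op V l i j)"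
  using assms
proof (induction l arbitrary: i j)
  case 0
  then show ?case using sv_degen_lin[OF V, of 0 0] by (simp add: lin_map_def)
next
  case (Suc l)
  show ?case
  proof (cases l)
    case 0
    have "lin_map (sp V (Suc 0)) (sp V (Suc 0)) (\<lambda>x. degen V 0 0 (face V (Suc 0) (Suc 0 - i) x))"
      by (rule lin_map_compose[OF sv_face_lin[OF V] sv_degen_lin[OF V]]) auto
    then show ?thesis unfolding 0 by (cases "i = j") (simp_all add: lin_map_def Pi_iff)
  next
    case (Suc l')
    let ?q = "omitted_vertex i j"
    have q: "?q \<le> Suc l" using omitted_vertex_le Suc by simp
    have "codegen ?q i \<le> codegen ?q j" "codegen ?q j \<le> l"
      using codegen_bounds[OF Suc.prems q omitted_vertex(1,2)] by auto
    from lin_map_compose[OF sv_face_lin[OF V q] Suc.IH[OF this]]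
    show ?thesis unfolding Suc edge_op.simps .
  qed
qed

text \<open>
  Independence of the order in which vertices are removed: two vertices \<open>a < b\<close> off the edge can be
  removed in either order by the relation \<open>d\<^sub>a d\<^sub>b = d\<^bsub>b-1\<^esub> d\<^sub>a\<close>.
\<close>
lemma edge_op_omit:
  assumes "i \<le> j" "j \<le> Suc l" "q \<le> Suc l" "q \<noteq> i" "q \<noteq> j" "x \<in> sp V (Suc l)"
  shows "edge_op V (Suc l) i j x = edge_op V l (codegen q i) (codegen q j) (face V (Suc l) q x)"
  using assms
proof (induction l arbitrary: i j q x)
  case 0
  then have "i = j" "q = 1 - i" by auto
  then show ?case by simp
next
  case (Suc l)
  have *: "edge_op V (Suc l) (codegen a i) (codegen a j) (face V (Suc (Suc l)) a x)
      = edge_op V (Suc l) (codegen b i) (codegen b j) (face V (Suc (Suc l)) b x)"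
    if ab: "a < b" "b \<le> Suc (Suc l)" "a \<noteq> i" "a \<noteq> j" "b \<noteq> i" "b \<noteq> j" for a b
  proof -
    have a: "a \<le> Suc (Suc l)" using ab by simp
    have swap: "codegen (b - 1) (codegen a p) = codegen a (codegen b p)"
      "b - 1 \<noteq> codegen a p" "a \<noteq> codegen b p" if "a \<noteq> p" "b \<noteq> p" for p
      using that ab(1) by (auto simp: codegen_def)
    have bd: "codegen a i \<le> codegen a j" "codegen a j \<le> Suc l"
      "codegen b i \<le> codegen b j" "codegen b j \<le> Suc l"
      using codegen_bounds[OF Suc.prems(1,2) a ab(3,4)] codegen_bounds[OF Suc.prems(1,2) ab(2,5,6)]
      by auto
    have "edge_op V (Suc l) (codegen a i) (codegen a j) (face V (Suc (Suc l)) a x)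
        = edge_op V l (codegen (b - 1) (codegen a i)) (codegen (b - 1) (codegen a j))
            (face V (Suc l) (b - 1) (face V (Suc (Suc l)) a x))"
      by (rule Suc.IH[OF bd(1,2) _ swap(2)[OF ab(3,5)] swap(2)[OF ab(4,6)]
            sv_face_in[OF V a Suc.prems(6)]]) (use ab(2) in simp)
    also have "\<dots> = edge_op V l (codegen a (codegen b i)) (codegen a (codegen b j))
            (face V (Suc l) a (face V (Suc (Suc l)) b x))"
      by (simp only: swap(1)[OF ab(3,5)] swap(1)[OF ab(4,6)] sv_face_face[OF V ab(1,2) Suc.prems(6)])
    also have "\<dots> = edge_op V (Suc l) (codegen b i) (codegen b j) (face V (Suc (Suc l)) b x)"
      by (rule Suc.IH[symmetric, OF bd(3,4) _ swap(3)[OF ab(3,5)] swap(3)[OF ab(4,6)]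
            sv_face_in[OF V ab(2) Suc.prems(6)]]) (use ab(1,2) in simp)
    finally show ?thesis .
  qed
  let ?r = "omitted_vertex i j"
  have "edge_op V (Suc (Suc l)) i j x
      = edge_op V (Suc l) (codegen ?r i) (codegen ?r j) (face V (Suc (Suc l)) ?r x)" by simp
  also have "\<dots> = edge_op V (Suc l) (codegen q i) (codegen q j) (face V (Suc (Suc l)) q x)"
  proof (cases ?r q rule: linorder_cases)
    case less
    then show ?thesis by (rule *[OF _ Suc.prems(3) omitted_vertex Suc.prems(4,5)])
  next
    case greater
    then show ?thesis by (rule *[symmetric, OF _ omitted_vertex_le Suc.prems(4,5) omitted_vertex])
  qed simp
  finally show ?case .
qed

lemma edge_op_face:
  assumes "i \<le> j" "j \<le> l" "p \<le> Suc l" "x \<in> sp V (Suc l)"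
  shows "edge_op V l i j (face V (Suc l) p x) = edge_op V (Suc l) (coface p i) (coface p j) x"
  using edge_op_omit[of "coface p i" "coface p j" l p x] assms
  by (simp add: codegen_coface) (auto simp: coface_def)

text \<open>
  A face opposite to a vertex off the edge either cancels the degeneracy or commutes past it, which lowers the
  dimension.
\<close>
lemma edge_op_degen:
  assumes "i \<le> j" "j \<le> Suc l" "p \<le> l" "x \<in> sp V l"
  shows "edge_op V (Suc l) i j (degen V l p x) = edge_op V l (codegen p i) (codegen p j) x"
  using assms
proof (induction l arbitrary: i j p x)
  case 0
  then have "i \<le> 1" by simp
  then have "i = 0 \<or> i = 1" by auto
  then show ?case
    using 0 sv_face_degen_same[OF V _ 0(4), of 0] sv_face_degen_Suc[OF V _ 0(4), of 0] by auto
next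
  case (Suc l)
  let ?r = "omitted_vertex i j"
  note r = omitted_vertex_le[of i j l] omitted_vertex(1,2)[of i j]
  have bd: "codegen ?r i \<le> codegen ?r j" "codegen ?r j \<le> Suc l"
    using codegen_bounds[OF Suc.prems(1,2) r] by auto
  have bp: "codegen p i \<le> codegen p j" "codegen p j \<le> Suc l"
    using Suc.prems by (auto simp: codegen_def)
  have unfold: "edge_op V (Suc (Suc l)) i j (degen V (Suc l) p x)
      = edge_op V (Suc l) (codegen ?r i) (codegen ?r j) (face V (Suc (Suc l)) ?r (degen V (Suc l) p x))"
    by simp
  consider "?r < p" | "?r = p" | "?r = Suc p" | "Suc p < ?r" by linarith
  then show ?case
  proof cases
    case 1
    have r': "?r \<le> Suc l" using 1 Suc.prems(3) by simp
    have swap: "codegen (p - 1) (codegen ?r s) = codegen ?r (codegen p s)" "?r \<noteq> codegen p s"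
      if "?r \<noteq> s" for s using that 1 by (auto simp: codegen_def)
    have "edge_op V (Suc (Suc l)) i j (degen V (Suc l) p x)
        = edge_op V (Suc l) (codegen ?r i) (codegen ?r j) (degen V l (p - 1) (face V (Suc l) ?r x))"
      unfolding unfold using sv_face_degen_less[OF V 1 Suc.prems(3,4)] by simp
    also have "\<dots> = edge_op V l (codegen (p - 1) (codegen ?r i)) (codegen (p - 1) (codegen ?r j))
        (face V (Suc l) ?r x)"
      by (rule Suc.IH[OF bd]) (use 1 Suc.prems(3) sv_face_in[OF V r' Suc.prems(4)] in auto)
    also have "\<dots> = edge_op V (Suc l) (codegen p i) (codegen p j) x"
      using edge_op_omit[OF bp r' swap(2) swap(2) Suc.prems(4)] r(2,3) swap(1) by simp
    finally show ?thesis .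
  next
    case 2
    then show ?thesis
      unfolding unfold using sv_face_degen_same[OF V Suc.prems(3,4)] by simp
  next
    case 3
    have "codegen ?r s = codegen p s" if "?r \<noteq> s" for s
      using that 3 by (auto simp: codegen_def)
    then show ?thesis
      unfolding unfold using sv_face_degen_Suc[OF V Suc.prems(3,4)] r(2,3) 3 by simp
  next
    case 4
    have r': "?r - 1 \<le> Suc l" using r(1) by simp
    have swap: "codegen p (codegen ?r s) = codegen (?r - 1) (codegen p s)" "?r - 1 \<noteq> codegen p s"
      if "?r \<noteq> s" for s using that 4 by (auto simp: codegen_def)
    have "edge_op V (Suc (Suc l)) i j (degen V (Suc l) p x)
        = edge_op V (Suc l) (codegen ?r i) (codegen ?r j) (degen V l p (face V (Suc l) (?r - 1) x))"
      unfolding unfold using sv_face_degen_greater[OF V 4 r(1) Suc.prems(4)] by simp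
    also have "\<dots> = edge_op V l (codegen p (codegen ?r i)) (codegen p (codegen ?r j))
        (face V (Suc l) (?r - 1) x)"
      by (rule Suc.IH[OF bd]) (use 4 r(1) sv_face_in[OF V r' Suc.prems(4)] in auto)
    also have "\<dots> = edge_op V (Suc l) (codegen p i) (codegen p j) x"
      using edge_op_omit[OF bp r' swap(2) swap(2) Suc.prems(4)] r(2,3) swap(1) by simp
    finally show ?thesis .
  qed
qed

section \<open>Composition in a simplicial vector space\<close>

text \<open>
  The filler is \<open>s\<^sub>0 v + s\<^sub>1 w - s\<^sub>1 s\<^sub>0 d\<^sub>1 v\<close>. It exists in every simplicial vector space and shows which
  value linearity forces on the composition.
\<close>
lemma linear_filler:
  assumes v: "v \<in> sp V 1" and w: "w \<in> sp V 1" and vw: "face V 1 1 v = face V 1 0 w"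
  obtains z where "z \<in> sp V 2" "face V 2 0 z = v" "face V 2 2 z = w"
    "face V 2 1 z = v + w - degen V 0 0 (face V 1 1 v)"
proof -
  have v': "v \<in> sp V (Suc 0)" and w': "w \<in> sp V (Suc 0)" using v w by auto
  define x where "x = face V (Suc 0) (Suc 0) v"
  have x: "x \<in> sp V 0" unfolding x_def by (rule sv_face_in[OF V _ v']) simp
  have xw: "face V (Suc 0) 0 w = x" using vw by (simp add: x_def)
  define e where "e = degen V 0 0 x"
  have e: "e \<in> sp V (Suc 0)" unfolding e_def by (rule sv_degen_in[OF V _ x]) simp
  have de: "face V (Suc 0) 0 e = x" "face V (Suc 0) (Suc 0) e = x"
    unfolding e_def using sv_face_degen_same[OF V _ x, of 0] sv_face_degen_Suc[OF V _ x, of 0] by auto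
  define a b c where "a = degen V (Suc 0) 0 v" and "b = degen V (Suc 0) (Suc 0) w"
    and "c = degen V (Suc 0) (Suc 0) e"
  have abc: "a \<in> sp V (Suc (Suc 0))" "b \<in> sp V (Suc (Suc 0))" "c \<in> sp V (Suc (Suc 0))"
    unfolding a_def b_def c_def by (auto intro!: sv_degen_in[OF V] v' w' e)
  have fa: "face V (Suc (Suc 0)) 0 a = v" "face V (Suc (Suc 0)) (Suc 0) a = v"
    "face V (Suc (Suc 0)) (Suc (Suc 0)) a = e"
    unfolding a_def e_def x_def
    using sv_face_degen_same[OF V _ v', of 0] sv_face_degen_Suc[OF V _ v', of 0]
      sv_face_degen_greater[OF V _ _ v', of 0 "Suc (Suc 0)"] by auto
  have f1: "face V (Suc (Suc 0)) 0 (degen V (Suc 0) (Suc 0) y) = degen V 0 0 (face V (Suc 0) 0 y)"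
    "face V (Suc (Suc 0)) (Suc 0) (degen V (Suc 0) (Suc 0) y) = y"
    "face V (Suc (Suc 0)) (Suc (Suc 0)) (degen V (Suc 0) (Suc 0) y) = y" if "y \<in> sp V (Suc 0)" for y
    using sv_face_degen_same[OF V _ that, of "Suc 0"] sv_face_degen_Suc[OF V _ that, of "Suc 0"]
      sv_face_degen_less[OF V _ _ that, of 0 "Suc 0"] by auto
  have fb: "face V (Suc (Suc 0)) 0 b = e" "face V (Suc (Suc 0)) (Suc 0) b = w"
    "face V (Suc (Suc 0)) (Suc (Suc 0)) b = w"
    unfolding b_def f1[OF w'] by (simp_all add: xw e_def)
  have fc: "face V (Suc (Suc 0)) 0 c = e" "face V (Suc (Suc 0)) (Suc 0) c = e"
    "face V (Suc (Suc 0)) (Suc (Suc 0)) c = e"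
    unfolding c_def f1[OF e] by (simp_all add: de flip: e_def)
  note sub = sv_subspace[OF V, of "Suc (Suc 0)"]
  have lin: "face V (Suc (Suc 0)) i (a + b - c)
      = face V (Suc (Suc 0)) i a + face V (Suc (Suc 0)) i b - face V (Suc (Suc 0)) i c"
    if "i \<le> Suc (Suc 0)" for i
    using lin_map_diff[OF sv_face_lin[OF V that] sub subspace_add[OF sub abc(1,2)] abc(3)]
      lin_map_add[OF sv_face_lin[OF V that] abc(1,2)] by simp
  show ?thesis
  proof (rule that)
    show "a + b - c \<in> sp V 2"
      using subspace_diff[OF sub subspace_add[OF sub abc(1,2)] abc(3)] by (simp add: numeral_2_eq_2)
  qed (simp_all add: numeral_2_eq_2 lin fa fb fc flip: x_def e_def)
qed

end

lemma pair21_in_horn: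
  assumes "pair21 v w \<in> horn X 2 1"
  shows "v \<in> sp X 1" "w \<in> sp X 1" "face X 1 1 v = face X 1 0 w"
  using horn_in[OF assms, of 0] horn_in[OF assms, of 2] horn_face[OF assms, of 0 2]
  by (simp_all add: pair21_def)

context
  fixes V :: "'a::real_vector svec"
  assumes V: "vs_groupoid 1 V"
begin

lemma V_simplicial: "simplicial_vs V"
  using V by (simp add: vs_groupoid_def)

lemma inj_on_horn_proj_2: "inj_on (horn_proj V 2 1) (sp V 2)"
proof (rule bij_betw_imp_inj_on)
  show "bij_betw (horn_proj V 2 1) (sp V 2) (horn V 2 1)"
    using V[unfolded vs_groupoid_def, THEN conjunct2, THEN conjunct2, rule_format, of 2 1] by simp
qed

lemma eq_2_simplexI:
  assumes "y \<in> sp V 2" "z \<in> sp V 2" "face V 2 0 y = face V 2 0 z" "face V 2 2 y = face V 2 2 z"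
  shows "y = z"
proof (rule inj_onD[OF inj_on_horn_proj_2 _ assms(1,2)])
  have "i = 0 \<or> i = 2" if "i \<le> 2" "i \<noteq> 1" for i :: nat using that by auto
  then show "horn_proj V 2 1 y = horn_proj V 2 1 z"
    using assms(3,4) by (auto simp: horn_proj_def fun_eq_iff)
qed

lemma faces_face_2:
  assumes "z \<in> sp V 2"
  shows "face V 2 0 z \<in> sp V 1" "face V 2 2 z \<in> sp V 1"
    "face V 1 1 (face V 2 0 z) = face V 1 0 (face V 2 2 z)"
  using assms sv_face_in[OF V_simplicial, of _ "Suc 0" z] sv_face_face[OF V_simplicial, of 0 2 0 z]
  by (simp_all add: numeral_2_eq_2)

lemma face_2_1:
  assumes z: "z \<in> sp V 2"
  shows "face V 2 1 z = face V 2 0 z + face V 2 2 z - degen V 0 0 (face V 1 1 (face V 2 0 z))"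
  by (rule linear_filler[OF V_simplicial faces_face_2[OF z]]) (use eq_2_simplexI z in metis)

lemma face_mult_eq:
  assumes "pair21 v w \<in> horn V 2 1"
  shows "face_mult V v w = v + w - degen V 0 0 (face V 1 1 v)"
proof -
  obtain z where z: "z \<in> sp V 2" "face V 2 0 z = v" "face V 2 2 z = w"
    "face V 2 1 z = v + w - degen V 0 0 (face V 1 1 v)"
    by (rule linear_filler[OF V_simplicial pair21_in_horn[OF assms]])
  have "horn_proj V 2 1 z = pair21 v w"
  proof
    fix i :: nat
    consider "i = 0" | "i = 1" | "i = 2" | "\<not> i \<le> 2" by linarith
    then show "horn_proj V 2 1 z i = pair21 v w i"
      by cases (auto simp: horn_proj_def pair21_def z)
  qed
  then have "inv_into (sp V 2) (horn_proj V 2 1) (pair21 v w) = z"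
    using inv_into_f_f[OF inj_on_horn_proj_2 z(1)] by simp
  then show ?thesis using z(4) by (simp add: face_mult_def)
qed

text \<open>
  Only three vertices matter, so faces opposite to other vertices reduce the claim to the fundamental triangle,
  where it is the formula for \<open>d\<^sub>1\<close>, or to dimension at most 1, where it follows from the relations
  between \<open>d\<^sub>0\<close>, \<open>d\<^sub>1\<close> and \<open>s\<^sub>0\<close>.
\<close>
lemma edge_op_triangle:
  assumes "i \<le> j" "j \<le> k" "k \<le> l" "x \<in> sp V l"
  shows "face V 1 1 (edge_op V l j k x) = face V 1 0 (edge_op V l i j x)
    \<and> edge_op V l i k x = edge_op V l j k x + edge_op V l i j x
        - degen V 0 0 (face V 1 1 (edge_op V l j k x))"
  using assms
proof (induction l arbitrary: i j k x)
  case 0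
  then show ?case
    using sv_face_degen_same[OF V_simplicial _ 0(4), of 0] sv_face_degen_Suc[OF V_simplicial _ 0(4), of 0]
    by simp
next
  case (Suc l)
  note omit = edge_op_omit[OF V_simplicial _ _ _ _ _ Suc.prems(4)]
  have reduce: ?case if q: "q \<le> Suc l" "q \<noteq> i" "q \<noteq> j" "q \<noteq> k" for q
  proof -
    have "codegen q i \<le> codegen q j" "codegen q j \<le> codegen q k" "codegen q k \<le> l"
      using Suc.prems q by (auto simp: codegen_def)
    then show ?thesis
      using Suc.IH[of "codegen q i" "codegen q j" "codegen q k" "face V (Suc l) q x"]
        omit[of i j q] omit[of j k q] omit[of i k q] Suc.prems q
        sv_face_in[OF V_simplicial q(1) Suc.prems(4)] by simp
  qed
  show ?case
  proof (cases "l = 0")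
    case True
    have x: "x \<in> sp V (Suc 0)" using Suc.prems(4) True by simp
    have dx: "face V (Suc 0) p x \<in> sp V 0" if "p \<le> Suc 0" for p
      using sv_face_in[OF V_simplicial that x] .
    have s: "face V (Suc 0) 0 (degen V 0 0 (face V (Suc 0) p x)) = face V (Suc 0) p x"
      "face V (Suc 0) (Suc 0) (degen V 0 0 (face V (Suc 0) p x)) = face V (Suc 0) p x"
      if "p \<le> Suc 0" for p
      using sv_face_degen_same[OF V_simplicial _ dx[OF that], of 0]
        sv_face_degen_Suc[OF V_simplicial _ dx[OF that], of 0] by auto
    have "i = 0 \<or> i = 1" "j = 0 \<or> j = 1" "k = 0 \<or> k = 1" using Suc.prems True by auto
    then show ?thesis using Suc.prems(1,2) True by (elim disjE) (simp_all add: s)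
  next
    case False
    show ?thesis
    proof (cases "l = 1 \<and> i = 0 \<and> j = 1 \<and> k = 2")
      case True
      have x: "x \<in> sp V 2" using Suc.prems(4) True by (simp add: numeral_2_eq_2)
      have "edge_op V (Suc l) 0 1 x = face V 2 2 x" "edge_op V (Suc l) 1 2 x = face V 2 0 x"
        "edge_op V (Suc l) 0 2 x = face V 2 1 x"
        using omit[of 0 1 2] omit[of 1 2 0] omit[of 0 2 1] True
        by (simp_all add: codegen_def numeral_2_eq_2)
      then show ?thesis using face_2_1[OF x] faces_face_2(3)[OF x] True by simp
    next
      case not_012: False
      (* Three vertices cannot cover 0, 1, 2, 3, and they cover 0, 1, 2 only as the triangle just treated. *)
      have "\<exists>q\<le>Suc l. q \<noteq> i \<and> q \<noteq> j \<and> q \<noteq> k"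
      proof -
        consider "i \<noteq> 0" | "i = 0" "j \<noteq> 1" "k \<noteq> 1" | "i = 0" "k = 1"
          | "i = 0" "j = 1" "k \<noteq> 2" | "i = 0" "j = 1" "k = 2" by blast
        then show ?thesis
        proof cases
          case 1 then show ?thesis using Suc.prems by (intro exI[of _ 0]) auto
        next
          case 2 then show ?thesis by (intro exI[of _ 1]) auto
        next
          case 3 then show ?thesis using Suc.prems False by (intro exI[of _ 2]) auto
        next
          case 4 then show ?thesis using Suc.prems False by (intro exI[of _ 2]) auto
        next
          case 5
          then have "2 \<le> l" using not_012 False by auto
          then show ?thesis using 5 by (intro exI[of _ 3]) auto
        qed
      qed
      then show ?thesis using reduce by blast
    qed
  qed
qed

end

text \<open>
  Level 1 of a simplicial object is written with the numeral 1 below; rewriting 1 to a successor would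
  take it out of that form.
\<close>
declare One_nat_def [simp del]

lemma edge_value_lin:
  "edge_value (f + g) i j = edge_value f i j + edge_value g i j"
  "edge_value (f - g) i j = edge_value f i j - edge_value g i j"
  "edge_value (r *\<^sub>R f) i j = r *\<^sub>R edge_value f i j" for f g :: "'a::real_vector dual_simplex"
  by (auto simp: edge_value_def scaleR_fun_def fun_eq_iff)

section \<open>The dual groupoid object\<close>

text \<open>
  All groupoid axioms are linear identities in the structure maps; the inverse of \<open>v\<close> is the sum of the units at
  its two ends minus \<open>v\<close>.
\<close>
lemma groupoid_object_of_reflexive_graph:
  assumes fd: "fin_dim (Ob G)" "fin_dim (Ar G)"
    and t: "lin_map (Ar G) (Ob G) (tgt G)" and s: "lin_map (Ar G) (Ob G) (src G)"
    and u: "lin_map (Ob G) (Ar G) (unt G)"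
    and tu: "\<And>x. x \<in> Ob G \<Longrightarrow> tgt G (unt G x) = x"
    and su: "\<And>x. x \<in> Ob G \<Longrightarrow> src G (unt G x) = x"
    and cmp: "\<And>v w. cmp G v w = v + w - unt G (src G v)"
  shows "groupoid_object G"
proof -
  note sub = fd[THEN fin_dim_imp_subspace]
  note closed = lin_map_in[OF t] lin_map_in[OF s] lin_map_in[OF u]
    sub[THEN subspace_add] sub[THEN subspace_diff] sub[THEN subspace_scale]
  note linear = lin_map_add[OF t] lin_map_add[OF s] lin_map_add[OF u]
    lin_map_scale[OF t] lin_map_scale[OF s] lin_map_scale[OF u]
    lin_map_diff[OF t sub(2)] lin_map_diff[OF s sub(2)] lin_map_diff[OF u sub(1)]
  have lin_cmp: "lin_map (composable G) (Ar G) (\<lambda>(v, w). cmp G v w)"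
    by (rule lin_mapI) (auto simp: composable_def cmp closed linear scaleR_add_right scaleR_diff_right)
  have inverse: "\<exists>\<iota>. lin_map (Ar G) (Ar G) \<iota> \<and> (\<forall>v\<in>Ar G.
        tgt G (\<iota> v) = src G v \<and> src G (\<iota> v) = tgt G v
      \<and> cmp G v (\<iota> v) = unt G (tgt G v) \<and> cmp G (\<iota> v) v = unt G (src G v))"
  proof (intro exI conjI ballI)
    let ?i = "\<lambda>v. unt G (tgt G v) + unt G (src G v) - v"
    show "lin_map (Ar G) (Ar G) ?i"
      by (rule lin_mapI) (simp_all add: closed linear scaleR_add_right scaleR_diff_right)
  qed (simp_all add: closed linear tu su cmp)
  show ?thesis
    unfolding groupoid_object_def
    by (intro conjI fd t s u lin_cmp inverse) (auto simp: composable_def tu su cmp closed linear)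
qed

context
  fixes V :: "'a::real_vector svec"
  assumes V: "simplicial_vs V"
begin

text \<open>
  The value 0 off \<open>\<V>\<^sub>1\<close> keeps these functions in the normalised dual space.
\<close>
definition dual_tgt :: "('a \<Rightarrow> real) \<Rightarrow> 'a \<Rightarrow> real" where
  "dual_tgt \<xi> = (\<lambda>v. if v \<in> sp V 1 then \<xi> (v - degen V 0 0 (face V 1 1 v)) else 0)"

definition dual_src :: "('a \<Rightarrow> real) \<Rightarrow> 'a \<Rightarrow> real" where
  "dual_src \<xi> = (\<lambda>v. if v \<in> sp V 1 then \<xi> (v - degen V 0 0 (face V 1 0 v)) else 0)"

definition dual_gpd :: "('a \<Rightarrow> real) vs_gpd" where
  "dual_gpd = \<lparr> Ob = Ann (sp V 1) (degen V 0 0 ` sp V 0), Ar = dual_space (sp V 1),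
     tgt = dual_tgt, src = dual_src, unt = (\<lambda>\<xi>. \<xi>), cmp = (\<lambda>\<eta> \<xi>. \<eta> + \<xi> - dual_src \<eta>) \<rparr>"

lemma dual_gpd_simps:
  "Ob dual_gpd = Ann (sp V 1) (degen V 0 0 ` sp V 0)" "Ar dual_gpd = dual_space (sp V 1)"
  "tgt dual_gpd = dual_tgt" "src dual_gpd = dual_src" "unt dual_gpd \<xi> = \<xi>"
  "cmp dual_gpd \<eta> \<xi> = \<eta> + \<xi> - dual_src \<eta>"
  by (simp_all add: dual_gpd_def)

lemma
  shows d0_lin: "lin_map (sp V 1) (sp V 0) (face V 1 0)"
    and d1_lin: "lin_map (sp V 1) (sp V 0) (face V 1 1)"
    and s0_lin: "lin_map (sp V 0) (sp V 1) (degen V 0 0)"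
    and d0_s0: "x \<in> sp V 0 \<Longrightarrow> face V 1 0 (degen V 0 0 x) = x"
    and d1_s0: "x \<in> sp V 0 \<Longrightarrow> face V 1 1 (degen V 0 0 x) = x"
  using sv_face_lin[OF V, of _ 0] sv_degen_lin[OF V, of 0 0] sv_face_degen_same[OF V, of 0 0]
    sv_face_degen_Suc[OF V, of 0 0] by (simp_all add: One_nat_def)

lemmas sub_V = sv_subspace[OF V]

lemmas V_closed = lin_map_in[OF d0_lin] lin_map_in[OF d1_lin] lin_map_in[OF s0_lin]
  subspace_add[OF sub_V] subspace_diff[OF sub_V] subspace_scale[OF sub_V]

lemmas V_linear = lin_map_add[OF d0_lin] lin_map_add[OF d1_lin] lin_map_add[OF s0_lin]
  lin_map_diff[OF d0_lin sub_V] lin_map_diff[OF d1_lin sub_V] lin_map_diff[OF s0_lin sub_V]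
  lin_map_scale[OF d0_lin] lin_map_scale[OF d1_lin] lin_map_scale[OF s0_lin]

lemma dual_space_linear:
  assumes "\<xi> \<in> dual_space (sp V 1)"
  shows "v \<in> sp V 1 \<Longrightarrow> w \<in> sp V 1 \<Longrightarrow> \<xi> (v + w) = \<xi> v + \<xi> w"
    "v \<in> sp V 1 \<Longrightarrow> w \<in> sp V 1 \<Longrightarrow> \<xi> (v - w) = \<xi> v - \<xi> w"
    "v \<in> sp V 1 \<Longrightarrow> \<xi> (r *\<^sub>R v) = r * \<xi> v"
    "v \<notin> sp V 1 \<Longrightarrow> \<xi> v = 0" "\<xi> 0 = 0"
proof -
  have l: "lin_map (sp V 1) UNIV \<xi>" using assms by (simp add: dual_space_def)
  show "v \<in> sp V 1 \<Longrightarrow> w \<in> sp V 1 \<Longrightarrow> \<xi> (v + w) = \<xi> v + \<xi> w" by (rule lin_map_add[OF l])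
  show "v \<in> sp V 1 \<Longrightarrow> w \<in> sp V 1 \<Longrightarrow> \<xi> (v - w) = \<xi> v - \<xi> w" by (rule lin_map_diff[OF l sub_V])
  show "v \<in> sp V 1 \<Longrightarrow> \<xi> (r *\<^sub>R v) = r * \<xi> v" using lin_map_scale[OF l] by simp
  show "v \<notin> sp V 1 \<Longrightarrow> \<xi> v = 0" using assms by (simp add: dual_space_def)
  show "\<xi> 0 = 0" by (rule lin_map_zero[OF l sub_V])
qed

lemma Ann_iff:
  "\<xi> \<in> Ann (sp V 1) (degen V 0 0 ` sp V 0) \<longleftrightarrow>
     \<xi> \<in> dual_space (sp V 1) \<and> (\<forall>x\<in>sp V 0. \<xi> (degen V 0 0 x) = 0)"
  by (auto simp: Ann_def)

lemma dual_tgt_in: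
  assumes "\<xi> \<in> dual_space (sp V 1)"
  shows "dual_tgt \<xi> \<in> Ann (sp V 1) (degen V 0 0 ` sp V 0)"
    and "dual_src \<xi> \<in> Ann (sp V 1) (degen V 0 0 ` sp V 0)"
  unfolding Ann_iff dual_space_def lin_map_def dual_tgt_def dual_src_def
  by (auto simp: V_closed V_linear d0_s0 d1_s0 dual_space_linear[OF assms] algebra_simps)

lemma groupoid_object_dual_gpd: "groupoid_object dual_gpd"
proof (rule groupoid_object_of_reflexive_graph, goal_cases)
  case 1 show ?case unfolding dual_gpd_simps by (rule fin_dim_Ann[OF sv_fin_dim[OF V]])
next
  case 2 show ?case unfolding dual_gpd_simps by (rule fin_dim_dual_space[OF sv_fin_dim[OF V]])
next
  case 3
  show ?case unfolding dual_gpd_simps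
    by (rule lin_mapI) (auto simp: dual_tgt_in, auto simp: dual_tgt_def scaleR_fun_def)
next
  case 4
  show ?case unfolding dual_gpd_simps
    by (rule lin_mapI) (auto simp: dual_tgt_in, auto simp: dual_src_def scaleR_fun_def)
next
  case 5
  show ?case unfolding dual_gpd_simps by (rule lin_mapI) (auto simp: Ann_iff)
next
  case (6 \<xi>)
  then have "\<xi> \<in> dual_space (sp V 1)" "\<And>x. x \<in> sp V 0 \<Longrightarrow> \<xi> (degen V 0 0 x) = 0"
    by (auto simp: dual_gpd_simps Ann_iff)
  then show ?case
    by (auto simp: dual_gpd_simps dual_tgt_def V_closed dual_space_linear)
next
  case (7 \<xi>)
  then have "\<xi> \<in> dual_space (sp V 1)" "\<And>x. x \<in> sp V 0 \<Longrightarrow> \<xi> (degen V 0 0 x) = 0"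
    by (auto simp: dual_gpd_simps Ann_iff)
  then show ?case
    by (auto simp: dual_gpd_simps dual_src_def V_closed dual_space_linear)
qed (simp add: dual_gpd_simps)

text \<open>
  Write \<open>u = w \<cdot> v\<close>. Since \<open>u\<close> and \<open>v\<close> have the same target, \<open>\<eta> u - src \<eta> u = \<eta> (s\<^sub>0 d\<^sub>0 v)\<close>,
  and \<open>\<xi> u = \<xi> w + tgt \<xi> v = \<xi> w + src \<eta> v\<close>; the two contributions add up to \<open>\<eta> v + \<xi> w\<close>.
\<close>
lemma dual_cmp_eval:
  assumes \<eta>: "\<eta> \<in> dual_space (sp V 1)" and \<xi>: "\<xi> \<in> dual_space (sp V 1)"
    and \<eta>\<xi>: "dual_src \<eta> = dual_tgt \<xi>"
    and v: "v \<in> sp V 1" and w: "w \<in> sp V 1" and vw: "face V 1 1 v = face V 1 0 w"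
  shows "(\<eta> + \<xi> - dual_src \<eta>) (v + w - degen V 0 0 (face V 1 1 v)) = \<eta> v + \<xi> w"
proof -
  let ?s = "degen V 0 0" and ?u = "v + w - degen V 0 0 (face V 1 1 v)"
  have u: "?u \<in> sp V 1" using v w by (simp add: V_closed)
  have "?s (face V 1 0 ?u) = ?s (face V 1 0 v)"
    using v w vw by (simp add: V_closed V_linear d0_s0)
  then have 1: "dual_src \<eta> ?u = \<eta> ?u - \<eta> (?s (face V 1 0 v))"
    using u v by (simp add: dual_src_def dual_space_linear[OF \<eta>] V_closed)
  have "?u = (v - ?s (face V 1 1 v)) + w" by simp
  then have "\<xi> ?u = \<xi> (v - ?s (face V 1 1 v)) + \<xi> w"
    using v w by (simp only: dual_space_linear(1)[OF \<xi>] V_closed)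
  also have "\<xi> (v - ?s (face V 1 1 v)) = dual_src \<eta> v"
    using v \<eta>\<xi> by (simp add: dual_tgt_def)
  also have "dual_src \<eta> v = \<eta> v - \<eta> (?s (face V 1 0 v))"
    using v by (simp add: dual_src_def dual_space_linear[OF \<eta>] V_closed)
  finally show ?thesis using 1 by simp
qed

section \<open>The dual as a nerve\<close>

text \<open>
  The value 0 outside the level is the normalisation that maps of simplicial vector spaces carry here.
\<close>
definition to_nerve ::
  "nat \<Rightarrow> 'a dual_simplex \<Rightarrow> (nat \<Rightarrow> 'a \<Rightarrow> real) \<times> (nat \<Rightarrow> nat \<Rightarrow> 'a \<Rightarrow> real)" where
  "to_nerve m f = (if f \<in> sp (dual1 V) m then
     (\<lambda>i. if i \<le> m then edge_value f i i else 0,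
      \<lambda>i j. if i \<le> j \<and> j \<le> m then edge_value f i j else 0) else 0)"

lemma fst_to_nerve: "f \<in> sp (dual1 V) m \<Longrightarrow> fst (to_nerve m f) i = (if i \<le> m then edge_value f i i else 0)"
  and snd_to_nerve: "f \<in> sp (dual1 V) m \<Longrightarrow>
    snd (to_nerve m f) i j = (if i \<le> j \<and> j \<le> m then edge_value f i j else 0)"
  by (simp_all add: to_nerve_def)

text \<open>
  The cocycle condition at the triangles \<open>s\<^sub>0 v\<close>, with faces \<open>v, v, s\<^sub>0 d\<^sub>1 v\<close>, and \<open>s\<^sub>1 v\<close>, with faces
  \<open>s\<^sub>0 d\<^sub>0 v, v, v\<close>.
\<close>
lemma edge_value_of_degenerate_triangles:
  assumes f: "f \<in> sp (dual1 V) m" and ijk: "i \<le> j" "j \<le> k" "k \<le> m" and v: "v \<in> sp V 1"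
  shows "edge_value f i k v = edge_value f j k v + edge_value f i j (degen V 0 0 (face V 1 1 v))"
    and "edge_value f i k v = edge_value f j k (degen V 0 0 (face V 1 0 v)) + edge_value f i j v"
proof -
  have v': "v \<in> sp V (Suc 0)" using v by (simp add: One_nat_def)
  have s: "degen V 1 0 v \<in> sp V 2" "degen V 1 1 v \<in> sp V 2"
    using sv_degen_in[OF V _ v'] by (simp_all add: numeral_2_eq_2 One_nat_def)
  have "face V 2 0 (degen V 1 0 v) = v" "face V 2 1 (degen V 1 0 v) = v"
    "face V 2 2 (degen V 1 0 v) = degen V 0 0 (face V 1 1 v)"
    using sv_face_degen_same[OF V _ v', of 0] sv_face_degen_Suc[OF V _ v', of 0]
      sv_face_degen_greater[OF V _ _ v', of 0 2] by (simp_all add: numeral_2_eq_2 One_nat_def)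
  with edge_value_cocycle[OF V f ijk s(1)]
  show "edge_value f i k v = edge_value f j k v + edge_value f i j (degen V 0 0 (face V 1 1 v))"
    by simp
  have "face V 2 0 (degen V 1 1 v) = degen V 0 0 (face V 1 0 v)" "face V 2 1 (degen V 1 1 v) = v"
    "face V 2 2 (degen V 1 1 v) = v"
    using sv_face_degen_same[OF V _ v', of 1] sv_face_degen_Suc[OF V _ v', of 1]
      sv_face_degen_less[OF V _ _ v', of 0 1] by (simp_all add: numeral_2_eq_2 One_nat_def)
  with edge_value_cocycle[OF V f ijk s(2)]
  show "edge_value f i k v = edge_value f j k (degen V 0 0 (face V 1 0 v)) + edge_value f i j v"
    by simp
qed

text \<open>
  These are the triangles above with vertices \<open>i, j, j\<close> and \<open>i, i, j\<close>.
\<close>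
lemma dual_tgt_edge_value:
  assumes f: "f \<in> sp (dual1 V) m" and ij: "i \<le> j" "j \<le> m"
  shows "dual_tgt (edge_value f i j) = edge_value f j j"
    and "dual_src (edge_value f i j) = edge_value f i i"
proof -
  note e = dual_space_linear[OF edge_value_dual_space[OF V f ij]]
  have i: "i \<le> m" using ij by simp
  note o = dual_space_linear(4)[OF edge_value_dual_space[OF V f order_refl i]]
    dual_space_linear(4)[OF edge_value_dual_space[OF V f order_refl ij(2)]]
  have "dual_tgt (edge_value f i j) v = edge_value f j j v
      \<and> dual_src (edge_value f i j) v = edge_value f i i v" for v
  proof (cases "v \<in> sp V 1")
    case True
    then show ?thesis
      using edge_value_of_degenerate_triangles(1)[OF f ij(1) order_refl ij(2) True]
        edge_value_of_degenerate_triangles(2)[OF f order_refl ij True]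
      by (simp add: dual_tgt_def dual_src_def e V_closed)
  qed (simp add: dual_tgt_def dual_src_def o)
  then show "dual_tgt (edge_value f i j) = edge_value f j j"
    "dual_src (edge_value f i j) = edge_value f i i" by (simp_all add: fun_eq_iff)
qed

lemma edge_value_cmp:
  assumes f: "f \<in> sp (dual1 V) m" and ijk: "i \<le> j" "j \<le> k" "k \<le> m"
  shows "edge_value f i k = edge_value f j k + edge_value f i j - edge_value f j j"
proof
  fix v
  have b: "i \<le> k" "j \<le> m" using ijk by auto
  note e = edge_value_dual_space[OF V f ijk(1) b(2)] edge_value_dual_space[OF V f ijk(2,3)]
    edge_value_dual_space[OF V f b(1) ijk(3)] edge_value_dual_space[OF V f order_refl b(2)]
  show "edge_value f i k v = (edge_value f j k + edge_value f i j - edge_value f j j) v"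
  proof (cases "v \<in> sp V 1")
    case True
    show ?thesis
      using edge_value_of_degenerate_triangles(1)[OF f ijk True]
        edge_value_of_degenerate_triangles(1)[OF f ijk(1) order_refl b(2) True] by simp
  next
    case False
    then show ?thesis by (simp add: e[THEN dual_space_linear(4)])
  qed
qed

lemma to_nerve_in:
  assumes f: "f \<in> sp (dual1 V) m"
  shows "to_nerve m f \<in> sp (nerve dual_gpd) m"
  unfolding nerve_mem_iff[OF groupoid_object_dual_gpd] fst_to_nerve[OF f] snd_to_nerve[OF f]
    dual_gpd_simps
proof (intro conjI)
  show "\<forall>i j k. i \<le> j \<and> j \<le> k \<and> k \<le> m \<longrightarrow>
      (if i \<le> k \<and> k \<le> m then edge_value f i k else 0)
        = (if j \<le> k \<and> k \<le> m then edge_value f j k else 0)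
          + (if i \<le> j \<and> j \<le> m then edge_value f i j else 0)
          - (if j \<le> m then edge_value f j j else 0)"
  proof (intro allI impI, elim conjE)
    fix i j k assume ijk: "i \<le> j" "j \<le> k" "k \<le> m"
    then have "i \<le> k" "j \<le> m" by auto
    with ijk edge_value_cmp[OF f ijk] show "(if i \<le> k \<and> k \<le> m then edge_value f i k else 0)
        = (if j \<le> k \<and> k \<le> m then edge_value f j k else 0)
          + (if i \<le> j \<and> j \<le> m then edge_value f i j else 0)
          - (if j \<le> m then edge_value f j j else 0)" by simp
  qed
qed (auto simp: Ann_iff edge_value_dual_space[OF V f] edge_value_degenerate[OF V f]
      dual_tgt_edge_value[OF f])

lemma to_nerve_lin: "lin_map (sp (dual1 V) m) (sp (nerve dual_gpd) m) (to_nerve m)"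
proof (rule lin_mapI)
  note sub = dual1_subspace[OF V]
  show "to_nerve m (f + g) = to_nerve m f + to_nerve m g"
    if f: "f \<in> sp (dual1 V) m" and g: "g \<in> sp (dual1 V) m" for f g
    by (rule nerve_eqI)
       (simp_all add: fst_to_nerve[OF f] fst_to_nerve[OF g] fst_to_nerve[OF subspace_add[OF sub f g]]
         snd_to_nerve[OF f] snd_to_nerve[OF g] snd_to_nerve[OF subspace_add[OF sub f g]] edge_value_lin)
  show "to_nerve m (r *\<^sub>R f) = r *\<^sub>R to_nerve m f" if f: "f \<in> sp (dual1 V) m" for r f
    by (rule nerve_eqI)
       (simp_all add: fst_to_nerve[OF f] fst_to_nerve[OF subspace_scale[OF sub f]]
         snd_to_nerve[OF f] snd_to_nerve[OF subspace_scale[OF sub f]] edge_value_lin scaleR_fun_apply)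
qed (rule to_nerve_in)

lemma inj_on_to_nerve: "inj_on (to_nerve m) (sp (dual1 V) m)"
proof (rule inj_onI)
  fix f g assume fg: "f \<in> sp (dual1 V) m" "g \<in> sp (dual1 V) m" "to_nerve m f = to_nerve m g"
  show "f = g"
  proof (rule dual1_eqI[OF V fg(1,2)])
    fix i j assume "i \<le> j" "j \<le> m"
    then show "edge_value f i j = edge_value g i j"
      using arg_cong[OF fg(3), of "\<lambda>z. snd z i j"] by (simp add: snd_to_nerve[OF fg(1)] snd_to_nerve[OF fg(2)])
  qed
qed

lemma to_nerve_dual_pull:
  assumes f: "f \<in> sp (dual1 V) m" and \<theta>: "ord_map n m \<theta>"
  shows "to_nerve n (dual_pull V n \<theta> f) = nerve_reindex n \<theta> (to_nerve m f)"
  using \<theta> unfolding ord_map_def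
  by (intro nerve_eqI)
     (auto simp: fst_nerve_reindex snd_nerve_reindex fst_to_nerve[OF f] snd_to_nerve[OF f]
       fst_to_nerve[OF dual_pull_in[OF V f \<theta>]] snd_to_nerve[OF dual_pull_in[OF V f \<theta>]]
       edge_value_dual_pull[OF V f \<theta>])

lemma face_dual1_in: "f \<in> sp (dual1 V) (Suc m) \<Longrightarrow> face (dual1 V) (Suc m) i f \<in> sp (dual1 V) m"
  unfolding face_dual1 using dual_pull_in[OF V _ ord_map_coface] by simp

lemma degen_dual1_in: "j \<le> m \<Longrightarrow> f \<in> sp (dual1 V) m \<Longrightarrow> degen (dual1 V) m j f \<in> sp (dual1 V) (Suc m)"
  unfolding degen_dual1 using dual_pull_in[OF V _ ord_map_codegen] by simp

lemma to_nerve_face: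
  "f \<in> sp (dual1 V) (Suc m) \<Longrightarrow>
    to_nerve m (face (dual1 V) (Suc m) i f) = face (nerve dual_gpd) (Suc m) i (to_nerve (Suc m) f)"
  unfolding face_dual1 face_nerve
  using to_nerve_dual_pull[OF _ ord_map_coface] by simp

lemma to_nerve_degen:
  "j \<le> m \<Longrightarrow> f \<in> sp (dual1 V) m \<Longrightarrow>
    to_nerve (Suc m) (degen (dual1 V) m j f) = degen (nerve dual_gpd) m j (to_nerve m f)"
  unfolding degen_dual1 degen_nerve
  using to_nerve_dual_pull[OF _ ord_map_codegen] by simp

end

section \<open>Every simplex of the nerve comes from the dual\<close>

context
  fixes V :: "'a::real_vector svec"
  assumes V: "vs_groupoid 1 V"
begin

lemmas svV = V_simplicial[OF V]

text \<open>
  The cocycle that \<open>v\<^sup>u\<close> is sent to takes on the edge \<open>\<sigma>\<close> the value of the functional on the edge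
  \<open>u \<circ> \<sigma>\<close> at the restriction of \<open>v\<close> to \<open>\<sigma>\<close>; naturality leaves no other choice.
\<close>
definition of_nerve ::
  "nat \<Rightarrow> (nat \<Rightarrow> 'a \<Rightarrow> real) \<times> (nat \<Rightarrow> nat \<Rightarrow> 'a \<Rightarrow> real) \<Rightarrow> 'a dual_simplex" where
  "of_nerve m z = (\<lambda>l y. if y \<in> sp (tensor V m) l then
     \<lambda>\<sigma>. if \<sigma> \<in> \<Delta> l 1 then
       \<Sum>u\<in>\<Delta> m l. snd z (u (\<sigma> 0)) (u (\<sigma> 1)) (edge_op V l (\<sigma> 0) (\<sigma> 1) (y u)) else 0
     else 0)"

lemma edge_op_1: "edge_op V 1 0 1 x = x"
  by (simp add: One_nat_def)

lemma of_nerve_edge: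
  "y \<in> sp (tensor V m) l \<Longrightarrow> i \<le> j \<Longrightarrow> j \<le> l \<Longrightarrow>
    of_nerve m z l y (edge i j) = (\<Sum>u\<in>\<Delta> m l. snd z (u i) (u j) (edge_op V l i j (y u)))"
  using edge_in[of i j l] by (simp add: of_nerve_def edge_0 edge_1)

lemma of_nerve_outside: "\<sigma> \<notin> \<Delta> l 1 \<Longrightarrow> of_nerve m z l y \<sigma> = 0"
  by (simp add: of_nerve_def)

lemma eq_on_edgesI:
  assumes "\<And>\<sigma>. \<sigma> \<notin> \<Delta> l 1 \<Longrightarrow> c \<sigma> = d \<sigma>" "\<And>i j. i \<le> j \<Longrightarrow> j \<le> l \<Longrightarrow> c (edge i j) = d (edge i j)"
  shows "c = d"
proof
  fix \<sigma> show "c \<sigma> = d \<sigma>" using assms by (cases "\<sigma> \<in> \<Delta> l 1") (metis one_simplex_edge)+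
qed

lemma of_nerve_summand_lin:
  assumes z: "z \<in> sp (nerve (dual_gpd V)) m" and u: "u \<in> \<Delta> m l" and ij: "i \<le> j" "j \<le> l"
  shows "lin_map (sp V l) UNIV (\<lambda>v. snd z (u i) (u j) (edge_op V l i j v))"
proof (rule lin_map_compose[OF edge_op_lin[OF svV ij]])
  have "u i \<le> u j" "u j \<le> m" using u ij by (auto simp: simplex_iff)
  then show "lin_map (sp V 1) UNIV (snd z (u i) (u j))"
    using nerve_ar[OF groupoid_object_dual_gpd[OF svV] z, of "u i" "u j"]
    by (simp add: dual_gpd_simps[OF svV] dual_space_def)
qed

text \<open>
  The cocycle condition holds summand by summand: the edges of a triangle in \<open>\<V>\<close> are composable with composite
  the third edge, and so are the corresponding functionals, so the evaluation formula for composites applies. Naturality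
  is the compatibility of the restriction to edges with faces and degeneracies.
\<close>
lemma of_nerve_in:
  assumes z: "z \<in> sp (nerve (dual_gpd V)) m"
  shows "of_nerve m z \<in> sp (dual1 V) m"
proof (rule dual1_I)
  note G = groupoid_object_dual_gpd[OF svV]
  note tsub = tensor_subspace[OF svV] and yin = tensor_apply_in[OF svV]
  note summand = of_nerve_summand_lin[OF z]
  fix l
  show "lin_map (sp (tensor V m) l) (sp B1R l) (of_nerve m z l)"
  proof (rule lin_mapI)
    fix y assume y: "y \<in> sp (tensor V m) l"
    show "of_nerve m z l y \<in> sp B1R l"
    proof (rule B1R_I)
      fix i j k assume ijk: "i \<le> j" "j \<le> k" "k \<le> l"
      then have b: "i \<le> k" "j \<le> l" by auto
      have "snd z (u i) (u k) (edge_op V l i k (y u))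
          = snd z (u j) (u k) (edge_op V l j k (y u)) + snd z (u i) (u j) (edge_op V l i j (y u))"
        if u: "u \<in> \<Delta> m l" for u
      proof -
        have uu: "u i \<le> u j" "u j \<le> u k" "u k \<le> m" "u j \<le> m" using u ijk by (auto simp: simplex_iff)
        note tri = edge_op_triangle[OF V ijk yin[OF y, of u]]
        have "snd z (u i) (u k) = snd z (u j) (u k) + snd z (u i) (u j) - dual_src V (snd z (u j) (u k))"
          using nerve_cmp[OF G z uu(1-3)] nerve_src[OF G z uu(2,3)] by (simp add: dual_gpd_simps[OF svV])
        then show ?thesis
          using dual_cmp_eval[OF svV, of "snd z (u j) (u k)" "snd z (u i) (u j)"
              "edge_op V l j k (y u)" "edge_op V l i j (y u)"]
            nerve_ar[OF G z uu(2,3)] nerve_ar[OF G z uu(1,4)] nerve_src[OF G z uu(2,3)]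
            nerve_tgt[OF G z uu(1,4)] tri
            lin_map_in[OF edge_op_lin[OF svV ijk(2,3)] yin[OF y, of u]]
            lin_map_in[OF edge_op_lin[OF svV ijk(1) b(2)] yin[OF y, of u]]
          by (simp add: dual_gpd_simps[OF svV])
      qed
      then show "of_nerve m z l y (edge i k) = of_nerve m z l y (edge j k) + of_nerve m z l y (edge i j)"
        unfolding of_nerve_edge[OF y b(1) ijk(3)] of_nerve_edge[OF y ijk(2,3)]
          of_nerve_edge[OF y ijk(1) b(2)] sum.distrib[symmetric]
        by (rule sum.cong[OF refl])
    qed (rule of_nerve_outside)
  next
    fix y y' assume y: "y \<in> sp (tensor V m) l" "y' \<in> sp (tensor V m) l"
    note yy = subspace_add[OF tsub y]
    show "of_nerve m z l (y + y') = of_nerve m z l y + of_nerve m z l y'"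
    proof (rule eq_on_edgesI)
      fix i j assume ij: "i \<le> j" "j \<le> l"
      show "of_nerve m z l (y + y') (edge i j) = (of_nerve m z l y + of_nerve m z l y') (edge i j)"
        unfolding plus_fun_apply of_nerve_edge[OF y(1) ij] of_nerve_edge[OF y(2) ij]
          of_nerve_edge[OF yy ij] sum.distrib[symmetric]
        by (rule sum.cong[OF refl]) (simp add: lin_map_add[OF summand[OF _ ij]] yin[OF y(1)] yin[OF y(2)])
    qed (simp add: of_nerve_outside)
  next
    fix r y assume y: "y \<in> sp (tensor V m) l"
    note ry = subspace_scale[OF tsub y]
    show "of_nerve m z l (r *\<^sub>R y) = r *\<^sub>R of_nerve m z l y"
    proof (rule eq_on_edgesI)
      fix i j assume ij: "i \<le> j" "j \<le> l"
      show "of_nerve m z l (r *\<^sub>R y) (edge i j) = (r *\<^sub>R of_nerve m z l y) (edge i j)"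
        unfolding scaleR_fun_apply of_nerve_edge[OF y ij] of_nerve_edge[OF ry ij] scaleR_sum_right
        by (rule sum.cong[OF refl]) (simp only: lin_map_scale[OF summand[OF _ ij]] yin[OF y])
    qed (simp add: of_nerve_outside scaleR_fun_apply)
  qed
  show "of_nerve m z l y = 0" if "y \<notin> sp (tensor V m) l" for y
    using that by (simp add: of_nerve_def)
  show "of_nerve m z l (face (tensor V m) (Suc l) p y) = face B1R (Suc l) p (of_nerve m z (Suc l) y)"
    if p: "p \<le> Suc l" and y: "y \<in> sp (tensor V m) (Suc l)" for p y
  proof (rule eq_on_edgesI)
    fix i j assume ij: "i \<le> j" "j \<le> l"
    have cij: "coface p i \<le> coface p j" "coface p j \<le> Suc l" "i \<le> l"
      using ij by (auto simp: coface_def)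
    have "of_nerve m z l (face (tensor V m) (Suc l) p y) (edge i j)
        = (\<Sum>u\<in>\<Delta> m l. snd z (u i) (u j) (edge_op V l i j (face (tensor V m) (Suc l) p y u)))"
      by (rule of_nerve_edge[OF face_tensor_in[OF svV p y] ij])
    also have "\<dots> = (\<Sum>u\<in>\<Delta> m (Suc l). snd z (sface (Suc l) p u i) (sface (Suc l) p u j)
        (edge_op V l i j (face V (Suc l) p (y u))))"
      unfolding face_tensor
      by (rule sum_over_at_simplex_sum[OF finite_simplices finite_simplices sface_in sv_subspace[OF svV]
            sv_face_in[OF svV p yin[OF y]] summand[OF _ ij]])
    also have "\<dots> = (\<Sum>u\<in>\<Delta> m (Suc l). snd z (u (coface p i)) (u (coface p j))
        (edge_op V (Suc l) (coface p i) (coface p j) (y u)))"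
      by (simp only: edge_op_face[OF svV ij p yin[OF y]] sface_apply[OF cij(3)] sface_apply[OF ij(2)])
    also have "\<dots> = face B1R (Suc l) p (of_nerve m z (Suc l) y) (edge i j)"
      unfolding face_B1R_edge[OF ij] of_nerve_edge[OF y cij(1,2)] ..
    finally show "of_nerve m z l (face (tensor V m) (Suc l) p y) (edge i j)
      = face B1R (Suc l) p (of_nerve m z (Suc l) y) (edge i j)" .
  qed (simp add: of_nerve_outside face_B1R_outside)
  show "of_nerve m z (Suc l) (degen (tensor V m) l p y) = degen B1R l p (of_nerve m z l y)"
    if p: "p \<le> l" and y: "y \<in> sp (tensor V m) l" for p y
  proof (rule eq_on_edgesI)
    fix i j assume ij: "i \<le> j" "j \<le> Suc l"
    have cij: "codegen p i \<le> codegen p j" "codegen p j \<le> l" "i \<le> Suc l"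
      using ij p by (auto simp: codegen_def)
    have "of_nerve m z (Suc l) (degen (tensor V m) l p y) (edge i j)
        = (\<Sum>u\<in>\<Delta> m (Suc l). snd z (u i) (u j) (edge_op V (Suc l) i j (degen (tensor V m) l p y u)))"
      by (rule of_nerve_edge[OF degen_tensor_in[OF svV p y] ij])
    also have "\<dots> = (\<Sum>u\<in>\<Delta> m l. snd z (sdegen l p u i) (sdegen l p u j)
        (edge_op V (Suc l) i j (degen V l p (y u))))"
      unfolding degen_tensor
      by (rule sum_over_at_simplex_sum[OF finite_simplices finite_simplices sdegen_in[OF _ p] sv_subspace[OF svV]
            sv_degen_in[OF svV p yin[OF y]] summand[OF _ ij]])
    also have "\<dots> = (\<Sum>u\<in>\<Delta> m l. snd z (u (codegen p i)) (u (codegen p j))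
        (edge_op V l (codegen p i) (codegen p j) (y u)))"
      by (simp only: edge_op_degen[OF svV ij p yin[OF y]] sdegen_apply[OF cij(3)] sdegen_apply[OF ij(2)])
    also have "\<dots> = degen B1R l p (of_nerve m z l y) (edge i j)"
      unfolding degen_B1R_edge[OF ij] of_nerve_edge[OF y cij(1,2)] ..
    finally show "of_nerve m z (Suc l) (degen (tensor V m) l p y) (edge i j)
      = degen B1R l p (of_nerve m z l y) (edge i j)" .
  qed (simp add: of_nerve_outside degen_B1R_outside)
qed

lemma edge_value_of_nerve:
  assumes z: "z \<in> sp (nerve (dual_gpd V)) m" and ij: "i \<le> j" "j \<le> m"
  shows "edge_value (of_nerve m z) i j = snd z i j"
proof
  fix v
  note ar = nerve_ar[OF groupoid_object_dual_gpd[OF svV] z, unfolded dual_gpd_simps[OF svV]]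
  show "edge_value (of_nerve m z) i j v = snd z i j v"
  proof (cases "v \<in> sp V 1")
    case True
    let ?y = "at_simplex (edge i j) v"
    have y: "?y \<in> sp (tensor V m) 1"
      unfolding sp_tensor by (rule at_simplex_in[OF sv_subspace[OF svV] edge_in[OF ij] True])
    have "edge_value (of_nerve m z) i j v
        = (\<Sum>u\<in>\<Delta> m 1. snd z (u 0) (u 1) (edge_op V 1 0 1 (?y u)))"
      unfolding edge_value_def by (rule of_nerve_edge[OF y]) auto
    also have "\<dots> = (\<Sum>u\<in>\<Delta> m 1. if u = edge i j then snd z i j v else 0)"
    proof (rule sum.cong[OF refl])
      fix u assume "u \<in> \<Delta> m 1"
      then have "snd z (u 0) (u 1) 0 = 0"
        using dual_space_linear(5)[OF svV ar] by (auto simp: simplex_iff)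
      then show "snd z (u 0) (u 1) (edge_op V 1 0 1 (?y u)) = (if u = edge i j then snd z i j v else 0)"
        by (auto simp: at_simplex_def edge_0 edge_1 edge_op_1)
    qed
    also have "\<dots> = snd z i j v" using edge_in[OF ij] by (simp add: finite_simplices)
    finally show ?thesis .
  next
    case False
    then show ?thesis
      using dual_space_linear(4)[OF svV edge_value_dual_space[OF svV of_nerve_in[OF z] ij]]
        dual_space_linear(4)[OF svV ar[OF ij]] by simp
  qed
qed

lemma to_nerve_of_nerve:
  assumes z: "z \<in> sp (nerve (dual_gpd V)) m"
  shows "to_nerve V m (of_nerve m z) = z"
proof (rule nerve_eqI)
  note G = groupoid_object_dual_gpd[OF svV]
  show "fst (to_nerve V m (of_nerve m z)) p = fst z p" for p
    using edge_value_of_nerve[OF z, of p p] nerve_ob_0[OF G z, of p] nerve_unit[OF G z, of p]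
    by (simp add: fst_to_nerve[OF svV of_nerve_in[OF z]] dual_gpd_simps[OF svV])
  show "snd (to_nerve V m (of_nerve m z)) p q = snd z p q" for p q
    using edge_value_of_nerve[OF z, of p q] nerve_ar_0[OF G z, of p q]
    by (auto simp: snd_to_nerve[OF svV of_nerve_in[OF z]])
qed

lemma lin_iso_to_nerve: "lin_iso (sp (dual1 V) m) (sp (nerve (dual_gpd V)) m) (to_nerve V m)"
  unfolding lin_iso_def bij_betw_def
proof (intro conjI to_nerve_lin[OF svV] inj_on_to_nerve[OF svV] subset_antisym subsetI)
  show "z \<in> to_nerve V m ` sp (dual1 V) m" if "z \<in> sp (nerve (dual_gpd V)) m" for z
    using to_nerve_of_nerve[OF that] of_nerve_in[OF that] by (metis imageI)
qed (auto intro: to_nerve_in[OF svV])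

lemma svec_iso_to_nerve: "svec_iso (to_nerve V) (dual1 V) (nerve (dual_gpd V))"
  unfolding svec_iso_def SVec_def
  using lin_iso_to_nerve to_nerve_lin[OF svV] to_nerve_face[OF svV] to_nerve_degen[OF svV]
  by (simp add: to_nerve_def[OF svV])

lemma simplicial_vs_dual1: "simplicial_vs (dual1 V)"
  by (rule simplicial_vs_transport[OF simplicial_vs_nerve[OF groupoid_object_dual_gpd[OF svV]]
        dual1_subspace[OF svV] lin_iso_to_nerve])
     (simp_all add: face_dual1_in[OF svV] degen_dual1_in[OF svV] to_nerve_face[OF svV] to_nerve_degen[OF svV])

lemma vs_groupoid_dual1: "vs_groupoid 1 (dual1 V)"
  by (rule vs_groupoid_transport[OF simplicial_vs_dual1
        vs_groupoid_nerve[OF groupoid_object_dual_gpd[OF svV]] svec_iso_to_nerve])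

lemma lin_iso_ident0: "lin_iso (sp (dual1 V) 0) (Ann (sp V 1) (degen V 0 0 ` sp V 0)) ident0"
proof (rule lin_iso_cong[OF _ dual1_subspace[OF svV]])
  show "lin_iso (sp (dual1 V) 0) (Ann (sp V 1) (degen V 0 0 ` sp V 0)) (\<lambda>f. fst (to_nerve V 0 f) 0)"
    using lin_iso_compose[OF lin_iso_to_nerve lin_iso_nerve_0[OF groupoid_object_dual_gpd[OF svV]]]
    by (simp add: dual_gpd_simps[OF svV])
qed (simp add: fst_to_nerve[OF svV] ident0_edge_value)

lemma lin_iso_ident1: "lin_iso (sp (dual1 V) 1) (dual_space (sp V 1)) ident1"
proof (rule lin_iso_cong[OF _ dual1_subspace[OF svV]])
  show "lin_iso (sp (dual1 V) 1) (dual_space (sp V 1)) (\<lambda>f. snd (to_nerve V 1 f) 0 1)"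
    using lin_iso_compose[OF lin_iso_to_nerve lin_iso_nerve_1[OF groupoid_object_dual_gpd[OF svV]]]
    by (simp add: dual_gpd_simps[OF svV])
qed (simp add: snd_to_nerve[OF svV] ident1_edge_value)

lemma ident0_face:
  assumes "\<xi> \<in> sp (dual1 V) 1"
  shows "ident0 (face (dual1 V) 1 0 \<xi>) = dual_tgt V (ident1 \<xi>)"
    and "ident0 (face (dual1 V) 1 1 \<xi>) = dual_src V (ident1 \<xi>)"
proof -
  have c: "ord_map 0 1 (coface i)" for i using ord_map_coface[of 0 i] by (simp add: One_nat_def)
  have "ident0 (face (dual1 V) 1 i \<xi>) = edge_value \<xi> (coface i 0) (coface i 0)" for i
    unfolding ident0_edge_value face_dual1
    using edge_value_dual_pull[OF svV assms c order_refl order_refl] by simp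
  then show "ident0 (face (dual1 V) 1 0 \<xi>) = dual_tgt V (ident1 \<xi>)"
    "ident0 (face (dual1 V) 1 1 \<xi>) = dual_src V (ident1 \<xi>)"
    using dual_tgt_edge_value[OF svV assms, of 0 1]
    by (simp_all add: ident1_edge_value coface_def One_nat_def)
qed

lemma ident1_degen:
  assumes "\<xi> \<in> sp (dual1 V) 0"
  shows "ident1 (degen (dual1 V) 0 0 \<xi>) = ident0 \<xi>"
  using edge_value_dual_pull[OF svV assms ord_map_codegen[of 0 0], of 0 1]
  by (simp add: ident1_edge_value ident0_edge_value degen_dual1 codegen_def One_nat_def)

text \<open>
  The composition formula holds for the dual as well as for \<open>\<V>\<close>, because both are \<open>1\<close>-groupoids, so the
  claim is the evaluation formula for composites of functionals.
\<close>
lemma pairing_face_mult: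
  assumes \<eta>\<xi>: "pair21 \<eta> \<xi> \<in> horn (dual1 V) 2 1" and vw: "pair21 v w \<in> horn V 2 1"
  shows "pairing (face_mult (dual1 V) \<eta> \<xi>) (face_mult V v w) = pairing \<eta> v + pairing \<xi> w"
proof -
  note h = pair21_in_horn[OF \<eta>\<xi>]
  have d\<eta>: "face (dual1 V) 1 1 \<eta> \<in> sp (dual1 V) 0"
    using face_dual1_in[OF svV, of \<eta> 0 1] h(1) by (simp add: One_nat_def)
  have "ident1 (face_mult (dual1 V) \<eta> \<xi>) = ident1 \<eta> + ident1 \<xi> - dual_src V (ident1 \<eta>)"
    unfolding face_mult_eq[OF vs_groupoid_dual1 \<eta>\<xi>]
    by (simp add: ident1_edge_value edge_value_lin flip: ident0_face(2)[OF h(1), unfolded ident1_edge_value]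
        ident1_degen[OF d\<eta>, unfolded ident1_edge_value])
  moreover have "dual_src V (ident1 \<eta>) = dual_tgt V (ident1 \<xi>)"
    using h(3) by (simp flip: ident0_face(2)[OF h(1)] ident0_face(1)[OF h(2)])
  moreover have "ident1 \<eta> \<in> dual_space (sp V 1)" "ident1 \<xi> \<in> dual_space (sp V 1)"
    using lin_iso_ident1 h by (auto simp: lin_iso_def lin_map_def)
  ultimately show ?thesis
    unfolding pairing_def face_mult_eq[OF V vw]
    using dual_cmp_eval[OF svV _ _ _ pair21_in_horn[OF vw]] by simp
qed

end

theorem proposition5p3:
  fixes V :: "'a::real_vector svec"
  assumes "vs_groupoid 1 V"
  shows "vs_groupoid 1 (dual1 V)
    \<and> lin_iso (sp (dual1 V) 0) (Ann (sp V 1) (degen V 0 0 ` sp V 0)) ident0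
    \<and> lin_iso (sp (dual1 V) 1) (dual_space (sp V 1)) ident1
    \<and> (\<forall>\<xi>\<in>sp (dual1 V) 1. \<forall>v\<in>sp V 1.
         ident0 (face (dual1 V) 1 0 \<xi>) v = ident1 \<xi> (v - degen V 0 0 (face V 1 1 v))
       \<and> ident0 (face (dual1 V) 1 1 \<xi>) v = ident1 \<xi> (v - degen V 0 0 (face V 1 0 v)))
    \<and> (\<forall>\<xi>\<in>sp (dual1 V) 0. ident1 (degen (dual1 V) 0 0 \<xi>) = ident0 \<xi>)
    \<and> (\<forall>\<eta> \<xi> v w. pair21 \<eta> \<xi> \<in> horn (dual1 V) 2 1 \<and> pair21 v w \<in> horn V 2 1 \<longrightarrow>
         pairing (face_mult (dual1 V) \<eta> \<xi>) (face_mult V v w) = pairing \<eta> v + pairing \<xi> w)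
    \<and> (\<exists>G \<Phi>. groupoid_object G
         \<and> Ar G = dual_space (sp V 1)
         \<and> Ob G = Ann (sp V 1) (degen V 0 0 ` sp V 0)
         \<and> (\<forall>\<xi>\<in>Ar G. \<forall>v\<in>sp V 1.
              tgt G \<xi> v = \<xi> (v - degen V 0 0 (face V 1 1 v))
            \<and> src G \<xi> v = \<xi> (v - degen V 0 0 (face V 1 0 v)))
         \<and> (\<forall>\<xi>\<in>Ob G. unt G \<xi> = \<xi>)
         \<and> (\<forall>(\<eta>, \<xi>)\<in>composable G. \<forall>v w. pair21 v w \<in> horn V 2 1 \<longrightarrow>
              cmp G \<eta> \<xi> (face_mult V v w) = \<eta> v + \<xi> w)
         \<and> svec_iso \<Phi> (dual1 V) (nerve G)
         \<and> (\<forall>f\<in>sp (dual1 V) 0. fst (\<Phi> 0 f) 0 = ident0 f)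
         \<and> (\<forall>f\<in>sp (dual1 V) 1. snd (\<Phi> 1 f) 0 1 = ident1 f))"
proof (intro conjI)
  note sv = V_simplicial[OF assms]
  note simps = dual_gpd_simps[OF sv]
  show "vs_groupoid 1 (dual1 V)"
    "lin_iso (sp (dual1 V) 0) (Ann (sp V 1) (degen V 0 0 ` sp V 0)) ident0"
    "lin_iso (sp (dual1 V) 1) (dual_space (sp V 1)) ident1"
    by (rule vs_groupoid_dual1[OF assms] lin_iso_ident0[OF assms] lin_iso_ident1[OF assms])+
  show "\<forall>\<xi>\<in>sp (dual1 V) 1. \<forall>v\<in>sp V 1.
         ident0 (face (dual1 V) 1 0 \<xi>) v = ident1 \<xi> (v - degen V 0 0 (face V 1 1 v))
       \<and> ident0 (face (dual1 V) 1 1 \<xi>) v = ident1 \<xi> (v - degen V 0 0 (face V 1 0 v))"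
    by (simp add: ident0_face[OF assms] dual_tgt_def[OF sv] dual_src_def[OF sv])
  show "\<forall>\<xi>\<in>sp (dual1 V) 0. ident1 (degen (dual1 V) 0 0 \<xi>) = ident0 \<xi>"
    using ident1_degen[OF assms] by blast
  show "\<forall>\<eta> \<xi> v w. pair21 \<eta> \<xi> \<in> horn (dual1 V) 2 1 \<and> pair21 v w \<in> horn V 2 1 \<longrightarrow>
         pairing (face_mult (dual1 V) \<eta> \<xi>) (face_mult V v w) = pairing \<eta> v + pairing \<xi> w"
    using pairing_face_mult[OF assms] by blast
  have cmp: "cmp (dual_gpd V) \<eta> \<xi> (face_mult V v w) = \<eta> v + \<xi> w"
    if "(\<eta>, \<xi>) \<in> composable (dual_gpd V)" "pair21 v w \<in> horn V 2 1" for \<eta> \<xi> v w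
    using that(1) dual_cmp_eval[OF sv _ _ _ pair21_in_horn[OF that(2)]]
    by (simp add: composable_def simps face_mult_eq[OF assms that(2)])
  show "\<exists>G \<Phi>. groupoid_object G
         \<and> Ar G = dual_space (sp V 1)
         \<and> Ob G = Ann (sp V 1) (degen V 0 0 ` sp V 0)
         \<and> (\<forall>\<xi>\<in>Ar G. \<forall>v\<in>sp V 1.
              tgt G \<xi> v = \<xi> (v - degen V 0 0 (face V 1 1 v))
            \<and> src G \<xi> v = \<xi> (v - degen V 0 0 (face V 1 0 v)))
         \<and> (\<forall>\<xi>\<in>Ob G. unt G \<xi> = \<xi>)
         \<and> (\<forall>(\<eta>, \<xi>)\<in>composable G. \<forall>v w. pair21 v w \<in> horn V 2 1 \<longrightarrow>
              cmp G \<eta> \<xi> (face_mult V v w) = \<eta> v + \<xi> w)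
         \<and> svec_iso \<Phi> (dual1 V) (nerve G)
         \<and> (\<forall>f\<in>sp (dual1 V) 0. fst (\<Phi> 0 f) 0 = ident0 f)
         \<and> (\<forall>f\<in>sp (dual1 V) 1. snd (\<Phi> 1 f) 0 1 = ident1 f)"
  proof (intro exI[of _ "dual_gpd V"] exI[of _ "to_nerve V"] conjI)
    show "\<forall>(\<eta>, \<xi>)\<in>composable (dual_gpd V). \<forall>v w. pair21 v w \<in> horn V 2 1 \<longrightarrow>
        cmp (dual_gpd V) \<eta> \<xi> (face_mult V v w) = \<eta> v + \<xi> w"
      using cmp by blast
  qed (simp_all add: groupoid_object_dual_gpd[OF sv] simps dual_tgt_def[OF sv] dual_src_def[OF sv]
      svec_iso_to_nerve[OF assms] fst_to_nerve[OF sv] snd_to_nerve[OF sv]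
      ident0_edge_value ident1_edge_value)
qed

end
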